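(* Let $I$ be a Blaschke product with zeros $\Lambda=\{\lambda_n\}_{n\ge1}\subset\mathbb{D}$ (listed with multiplicity), and let $h\in H^2$ be such that the truncated Toeplitz operator $A_{\overline{h}}$ is bounded on $K_I$. Let $\zeta\in\mathbb{T}$. Then every function in $\operatorname{Rng}A_{\overline{h}}$ has a finite non-tangential limit at $\zeta$ if and only if $$\sum_{n\ge1}|(A_{\overline{h}}\gamma_n)(\zeta)|^2<\infty .$$
   Context: $\mathbb{D}$ is the open unit disk, $\mathbb{T}$ the unit circle, $H^2$ the Hardy space of $\mathbb{D}$, regarded as a closed subspace of $L^2(\mathbb{T},d\theta/2\pi)$ via non-tangential boundary values, with inner product $\langle\cdot,\cdot\rangle$. For an inner function $I$, $K_I=H^2\ominus IH^2$ and $P_I$ is the orthogonal projection of $L^2$ onto $K_I$. For $h\in H^2$, the truncated Toeplitz operator is $A_{\overline{h}}f=P_I(\overline{h}f)$, initially defined on the dense set of bounded functions in $K_I$; "bounded" means it extends to a bounded operator on $K_I$, and $\operatorname{Rng}A_{\overline{h}}$ denotes the range of this extension. For $\lambda\in\mathbb{D}$, $b_\lambda(z)=\frac{z-\lambda}{1-\overline{\lambda}z}$. The Takenaka–Malmquist–Walsh functions are $\gamma_n(z)=\frac{\sqrt{1-|\lambda_n|^2}}{1-\overline{\lambda_n}z}\prod_{k=1}^{n-1}b_{\lambda_k}(z)$, an orthonormal basis of $K_I$. With $B_n=\prod_{k=1}^n b_{\lambda_k}$, one has $\gamma_n\in K_{B_n}$ and $A_{\overline{h}}\gamma_n\in K_{B_n}$,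 a finite-dimensional space of rational functions with no poles in the closed disk; $(A_{\overline{h}}\gamma_n)(\zeta)$ denotes the value of this rational function at $\zeta$. *)

theory Defs
  imports "HOL-Analysis.Analysis"
begin

text \<open>Hardy space H^2 of the unit disk: holomorphic functions on the open unit disk
  with bounded L^2 integral means (normalised measure d theta / 2 pi).
  Values outside the disk are irrelevant.\<close>
definition H2 :: "(complex \<Rightarrow> complex) set" where
  "H2 = {f. f holomorphic_on ball 0 1 \<and>
           (\<exists>C. \<forall>r. 0 \<le> r \<and> r < 1 \<longrightarrow>
              integral {0..2*pi} (\<lambda>t. (cmod (f (of_real r * cis t)))\<^sup>2) / (2*pi) \<le> C)}"

text \<open>Boundary function on the circle, parametrised by t in [0, 2 pi]
  (radial limit, which exists a.e. for H^2 functions and agrees a.e. with the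
  non-tangential limit).\<close>
definition bdry :: "(complex \<Rightarrow> complex) \<Rightarrow> real \<Rightarrow> complex" where
  "bdry f t = Lim (at_left 1) (\<lambda>r::real. f (of_real r * cis t))"

definition L2inner :: "(real \<Rightarrow> complex) \<Rightarrow> (real \<Rightarrow> complex) \<Rightarrow> complex" where
  "L2inner \<phi> \<psi> = integral {0..2*pi} (\<lambda>t. \<phi> t * cnj (\<psi> t)) / of_real (2*pi)"

definition H2norm :: "(complex \<Rightarrow> complex) \<Rightarrow> real" where
  "H2norm f = sqrt (integral {0..2*pi} (\<lambda>t. (cmod (bdry f t))\<^sup>2) / (2*pi))"

definition bfac :: "complex \<Rightarrow> complex \<Rightarrow> complex" where
  "bfac l z = (z - l) / (1 - cnj l * z)"

definition blaschke_factor :: "complex \<Rightarrow> complex \<Rightarrow> complex" where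
  "blaschke_factor l z = (if l = 0 then z else of_real (cmod l) / l * (l - z) / (1 - cnj l * z))"

definition blaschke_prod :: "(nat \<Rightarrow> complex) \<Rightarrow> complex \<Rightarrow> complex" where
  "blaschke_prod lam z = (\<Prod>n. blaschke_factor (lam n) z)"

definition model_space :: "(complex \<Rightarrow> complex) \<Rightarrow> (complex \<Rightarrow> complex) set" where
  "model_space I = {f \<in> H2. \<forall>g \<in> H2. L2inner (bdry f) (bdry (\<lambda>z. I z * g z)) = 0}"

text \<open>Bounded functions in K_I (the initial domain of the truncated Toeplitz operator).\<close>
definition bdd_model :: "(complex \<Rightarrow> complex) \<Rightarrow> (complex \<Rightarrow> complex) set" where
  "bdd_model I = {f \<in> model_space I. bounded (f ` ball 0 1)}"

text \<open>Truncated Toeplitz operator A_{conj h} f = P_I(conj h * f), P_I the orthogonal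
  projection of L^2 onto K_I: P_I phi is the element g of K_I with
  <g,k> = <phi,k> for all k in K_I.  Normalised to vanish off the disk.\<close>
definition tto :: "(complex \<Rightarrow> complex) \<Rightarrow> (complex \<Rightarrow> complex) \<Rightarrow> (complex \<Rightarrow> complex) \<Rightarrow> (complex \<Rightarrow> complex)" where
  "tto I h f = (THE g. g \<in> model_space I \<and> (\<forall>z. z \<notin> ball 0 1 \<longrightarrow> g z = 0) \<and>
      (\<forall>k \<in> model_space I. L2inner (bdry g) (bdry k) =
          L2inner (\<lambda>t. cnj (bdry h t) * bdry f t) (bdry k)))"

text \<open>A_{conj h} extends to a bounded operator on K_I.\<close>
definition tto_bounded :: "(complex \<Rightarrow> complex) \<Rightarrow> (complex \<Rightarrow> complex) \<Rightarrow> bool" where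
  "tto_bounded I h \<longleftrightarrow> (\<exists>C. \<forall>f \<in> bdd_model I. H2norm (tto I h f) \<le> C * H2norm f)"

text \<open>Range of the bounded extension: limits of A f_n where f_n are bounded functions
  in K_I converging in norm to some f in K_I.\<close>
definition tto_range :: "(complex \<Rightarrow> complex) \<Rightarrow> (complex \<Rightarrow> complex) \<Rightarrow> (complex \<Rightarrow> complex) set" where
  "tto_range I h = {g \<in> model_space I. \<exists>f \<in> model_space I. \<exists>fs.
      (\<forall>n. fs n \<in> bdd_model I) \<and>
      (\<lambda>n. H2norm (\<lambda>z. fs n z - f z)) \<longlonglongrightarrow> 0 \<and>
      (\<lambda>n. H2norm (\<lambda>z. tto I h (fs n) z - g z)) \<longlonglongrightarrow> 0}"

definition stolz :: "complex \<Rightarrow> real \<Rightarrow> complex set" where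
  "stolz \<zeta> \<alpha> = {z. cmod z < 1 \<and> cmod (z - \<zeta>) < \<alpha> * (1 - cmod z)}"

definition nt_limit :: "(complex \<Rightarrow> complex) \<Rightarrow> complex \<Rightarrow> complex \<Rightarrow> bool" where
  "nt_limit F \<zeta> L \<longleftrightarrow> (\<forall>\<alpha>>1. (F \<longlongrightarrow> L) (at \<zeta> within stolz \<zeta> \<alpha>))"

definition tmw :: "(nat \<Rightarrow> complex) \<Rightarrow> nat \<Rightarrow> complex \<Rightarrow> complex" where
  "tmw lam n z = of_real (sqrt (1 - (cmod (lam n))\<^sup>2)) / (1 - cnj (lam n) * z) *
                 (\<Prod>k<n. bfac (lam k) z)"

text \<open>Value at a boundary point of a function continuous on the closed disk
  (e.g. a rational function without poles there), through its values in the disk.\<close>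
definition bval :: "(complex \<Rightarrow> complex) \<Rightarrow> complex \<Rightarrow> complex" where
  "bval F \<zeta> = Lim (at \<zeta> within ball 0 1) F"

end

theory Submission
  imports Defs "HOL-Complex_Analysis.Complex_Analysis"
begin

text \<open>For bounded \<open>f\<close> in \<open>K_I\<close> one has \<open>(A f)(z) = <f, h k_z>\<close> with the Szego kernel \<open>k_z\<close>, so \<open>A\<close> is the
  restriction of a coanalytic Toeplitz operator and commutes with the backward shift \<open>S*\<close>.
  Write \<open>a_n\<close> for the value of \<open>A \<gamma>_n\<close> at \<open>\<zeta>\<close>.

  If \<open>(a_n)\<close> is square summable and \<open>f\<close> lies in the span of finitely many \<open>\<gamma>_n\<close>, put
  \<open>v = (1 - \<zeta> S*)(1 - z S*)^{-1} f\<close>. Then \<open>(A v)(\<zeta>) = (A f)(z)\<close>, whence \<open>|(A f)(z)|\<close> is at most the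
  norm of \<open>v\<close> times the norm of \<open>(a_n)\<close>, and the norm of \<open>v\<close> is at most
  \<open>(1 + |z - \<zeta>| / (1 - |z|))\<close> times the norm of \<open>f\<close>. This is uniform in Stolz angles, and \<open>A f\<close> is continuous
  at \<open>\<zeta>\<close> for the dense set of such \<open>f\<close>.

  Conversely, if all functions in the range have a radial limit at \<open>\<zeta>\<close>, the functionals
  \<open>f \<mapsto> (A f)(r \<zeta>)\<close> are pointwise bounded on \<open>K_I\<close>, hence uniformly bounded, and their square norms
  \<open>\<Sum>|(A \<gamma>_n)(r \<zeta>)|^2\<close> converge termwise to \<open>\<Sum>|a_n|^2\<close>.\<close>

section \<open>Integral means of power series\<close>

text \<open>\<open>H2norm\<close>, \<open>L2inner\<close>, and with them \<open>model_space\<close>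
  and \<open>tto\<close>, are defined through radial boundary values, so nothing about them can be
  computed until these limits are known to exist almost everywhere. This forces a maximal
  inequality: the Poisson kernel and Vitali's covering lemma give a weak type bound, which yields
  Fatou's theorem; after that, norm and inner product are those of Taylor coefficients. The vector
  \<open>v\<close> is designed so that the image F of f satisfies F + (z - zeta) (F - F(z)) / (w -
  z) = F(z) at w = zeta. Difference quotients at z have operator norm at most 1 / (1 - |z|), which
  is the source of the factor 1 + |z - zeta| / (1 - |z|). They preserve the span of the first N
  basis functions, so the image of \<open>v\<close> is again continuous at \<open>\<zeta>\<close>
  and Bessel's inequality controls its coefficients. Since \<open>h\<close> may be unbounded, it
  cannot be moved freely across inner products: only bounded test functions are paired directly, the
  others are reached by density. Boundedness of the operator serves the converse, where it turns
  every square summable coefficient sequence into an element of the range.\<close>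

lemma eventually_radius: "\<forall>\<^sub>F r in at_left (1::real). r \<in> {0<..<1}"
  by (rule eventually_at_left_real) simp

lemma has_integral_cis_multiple:
  "((\<lambda>t. cis (of_int k * t)) has_integral (if k = 0 then of_real (2*pi) else 0)) {0..2*pi}"
proof (cases "k = 0")
  case True
  then show ?thesis
    using has_integral_const_real[of "1::complex" 0 "2*pi"] by (simp add: scaleR_conv_of_real)
next
  case False
  have d: "((\<lambda>t. cis (of_int k * t) / (\<i> * of_int k)) has_vector_derivative cis (of_int k * t))
      (at t within {0..2*pi})" for t
  proof -
    have "((\<lambda>x. exp (\<i> * of_int k * x) / (\<i> * of_int k)) has_field_derivative exp (\<i> * of_int k * of_real t)) (at (of_real t))"
      by (rule derivative_eq_intros refl | simp add: False)+
    from has_vector_derivative_real_field[OF this] show ?thesis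
      by (simp add: cis_conv_exp mult.assoc)
  qed
  have "((\<lambda>t. cis (of_int k * t)) has_integral
      (cis (of_int k * (2*pi)) / (\<i> * of_int k) - cis (of_int k * 0) / (\<i> * of_int k))) {0..2*pi}"
    by (rule fundamental_theorem_of_calculus) (use d in auto)
  moreover have "cis (of_int k * (2*pi)) = 1"
    using cis_multiple_2pi[of "of_int k"] by (simp add: mult_ac)
  ultimately show ?thesis using False by simp
qed

lemma has_integral_trig_inner:
  fixes b c :: "nat \<Rightarrow> complex"
  shows "((\<lambda>t. (\<Sum>n<N. b n * cis (real n * t)) * cnj (\<Sum>n<N. c n * cis (real n * t)))
     has_integral of_real (2*pi) * (\<Sum>n<N. b n * cnj (c n))) {0..2*pi}"
proof -
  have e: "(\<Sum>n<N. b n * cis (real n * t)) * cnj (\<Sum>n<N. c n * cis (real n * t)) =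
      (\<Sum>n<N. \<Sum>m<N. b n * cnj (c m) * cis (of_int (int n - int m) * t))" for t
    by (simp add: sum_product cis_cnj cis_mult algebra_simps)
  have "((\<lambda>t. \<Sum>n<N. \<Sum>m<N. b n * cnj (c m) * cis (of_int (int n - int m) * t)) has_integral
     (\<Sum>n<N. \<Sum>m<N. b n * cnj (c m) * (if int n - int m = 0 then of_real (2*pi) else 0))) {0..2*pi}"
    by (intro has_integral_sum has_integral_mult_right has_integral_cis_multiple) auto
  moreover have "(\<Sum>n<N. \<Sum>m<N. b n * cnj (c m) * (if int n - int m = 0 then of_real (2*pi) else 0))
     = of_real (2*pi) * (\<Sum>n<N. b n * cnj (c n))"
    by (simp add: sum_distrib_left if_distrib cong: if_cong) (simp add: mult_ac)
  ultimately show ?thesis unfolding e by simp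
qed

abbreviation circle_mean :: "(complex \<Rightarrow> complex) \<Rightarrow> real \<Rightarrow> real" where
  "circle_mean f r \<equiv> integral {0..2*pi} (\<lambda>t. (cmod (f (of_real r * cis t)))\<^sup>2) / (2*pi)"

text \<open>Parseval on the circle of radius \<open>R\<close>. Convergence at a slightly larger
  radius makes the series absolutely convergent on this circle, so one constant dominates all
  partial sums and dominated convergence carries the identity over from trigonometric
  polynomials.\<close>

lemma circle_mean_sums:
  fixes a :: "nat \<Rightarrow> complex"
  assumes f: "\<And>z. cmod z < 1 \<Longrightarrow> (\<lambda>n. a n * z ^ n) sums f z" and R: "0 \<le> R" "R < 1"
  shows "(\<lambda>n. (cmod (a n))\<^sup>2 * R ^ (2*n)) sums circle_mean f R"
proof -
  define s where "s N t = (\<Sum>n<N. a n * of_real R ^ n * cis (real n * t))" for N t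
  have s_eq: "s N t = (\<Sum>n<N. a n * (of_real R * cis t) ^ n)" for N t
    unfolding s_def by (simp only: power_mult_distrib Complex.DeMoivre mult.assoc)
  obtain R' where R': "R < R'" "R' < 1" using R dense by blast
  have "summable (\<lambda>n. a n * of_real R' ^ n)"
    using f[of "of_real R'"] R R' by (auto simp: sums_iff)
  then have sm: "summable (\<lambda>n. norm (a n * of_real R ^ n))"
    by (rule powser_insidea) (use R R' in auto)
  define K where "K = (\<Sum>n. norm (a n * of_real R ^ n))"
  have sK: "cmod (s N t) \<le> K" for N t
  proof -
    have "cmod (s N t) \<le> (\<Sum>n<N. norm (a n * of_real R ^ n))"
      unfolding s_def by (rule order_trans[OF norm_sum]) (simp add: norm_mult)
    also have "\<dots> \<le> K" unfolding K_def by (rule sum_le_suminf[OF sm]) auto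
    finally show ?thesis .
  qed
  have hi: "((\<lambda>t. of_real ((cmod (s N t))\<^sup>2)) has_integral
     (of_real (2*pi) * of_real (\<Sum>n<N. (cmod (a n))\<^sup>2 * R ^ (2*n)) :: complex)) {0..2*pi}" for N
  proof -
    have "cmod (a n) ^ 2 * R ^ (2*n) = (cmod (a n * of_real R ^ n))\<^sup>2" for n
      using R by (simp add: norm_mult norm_power power_mult_distrib power_mult mult.commute[of 2])
    then have e2: "of_real (\<Sum>n<N. (cmod (a n))\<^sup>2 * R ^ (2*n)) =
        (\<Sum>n<N. (a n * of_real R ^ n) * cnj (a n * of_real R ^ n))"
      by (simp only: of_real_sum complex_norm_square)
    show ?thesis
      using has_integral_trig_inner[where N = N and b = "\<lambda>n. a n * of_real R ^ n" and c = "\<lambda>n. a n * of_real R ^ n"]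
      unfolding e2 complex_norm_square s_def .
  qed
  have hi': "((\<lambda>t. (cmod (s N t))\<^sup>2) has_integral
     2*pi * (\<Sum>n<N. (cmod (a n))\<^sup>2 * R ^ (2*n))) {0..2*pi}" for N
    using has_integral_Re[OF hi[of N]] by (simp del: of_real_sum flip: of_real_mult of_real_power)
  have lim: "(\<lambda>N. integral {0..2*pi} (\<lambda>t. (cmod (s N t))\<^sup>2)) \<longlonglongrightarrow>
      integral {0..2*pi} (\<lambda>t. (cmod (f (of_real R * cis t)))\<^sup>2)"
  proof (rule dominated_convergence(2))
    show "(\<lambda>t. (cmod (s N t))\<^sup>2) integrable_on {0..2*pi}" for N using hi' by (auto simp: integrable_on_def)
    show "(\<lambda>t. K\<^sup>2) integrable_on {0..2*pi}" by (rule integrable_const_ivl)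
    show "norm ((cmod (s N t))\<^sup>2) \<le> K\<^sup>2" for N t using sK[of N t] by (simp add: power_mono)
    show "(\<lambda>N. (cmod (s N t))\<^sup>2) \<longlonglongrightarrow> (cmod (f (of_real R * cis t)))\<^sup>2" for t
      using f[of "of_real R * cis t"] R unfolding sums_def s_eq
      by (intro tendsto_intros) (simp add: norm_mult)
  qed
  have "(\<lambda>N. integral {0..2*pi} (\<lambda>t. (cmod (s N t))\<^sup>2) / (2*pi)) \<longlonglongrightarrow>
      circle_mean f R"
    by (intro tendsto_intros lim) auto
  moreover have "integral {0..2*pi} (\<lambda>t. (cmod (s N t))\<^sup>2) / (2*pi) = (\<Sum>n<N. (cmod (a n))\<^sup>2 * R ^ (2*n))" for N
    using integral_unique[OF hi'[of N]] by simp
  ultimately show ?thesis by (simp add: sums_def)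
qed

section \<open>The radial maximal function\<close>

text \<open>Cauchy's formula at \<open>\<rho>\<close> for F(u) = G(u) (1 - rho^2) / (1 - rho u): the
  extra factor is 1 at u = rho, and on the circle (u - rho)(1 - rho u) = u (1 - 2 rho cos t +
  rho^2), so Cauchy's kernel becomes Poisson's. A real \<open>\<rho>\<close> is enough because
  rotations are later built into \<open>G\<close>.\<close>

lemma poisson_formula:
  assumes G: "continuous_on (cball 0 1) G" "G holomorphic_on ball 0 1" and \<rho>: "0 \<le> \<rho>" "\<rho> < 1"
  shows "((\<lambda>x. G (cis x) * of_real ((1-\<rho>\<^sup>2) / (1 - 2*\<rho>*cos x + \<rho>\<^sup>2))) has_integral
      of_real (2*pi) * G (of_real \<rho>)) {0..2*pi}"
proof -
  define F where "F u = G u * of_real (1-\<rho>\<^sup>2) / (1 - of_real \<rho> * u)" for u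
  have nz: "1 - of_real \<rho> * u \<noteq> 0" if "cmod u \<le> 1" for u :: complex
  proof
    assume "1 - of_real \<rho> * u = 0"
    then have "cmod (of_real \<rho> * u) = 1" by (metis eq_iff_diff_eq_0 norm_one)
    moreover have "\<rho> * cmod u \<le> \<rho> * 1" using that \<rho> by (intro mult_left_mono) auto
    ultimately show False using \<rho> by (simp add: norm_mult)
  qed
  have "((\<lambda>u. F u / (u - of_real \<rho>)) has_contour_integral (2 * of_real pi * \<i> * F (of_real \<rho>))) (circlepath 0 1)"
    by (rule Cauchy_integral_circlepath)
       (use \<rho> G nz in \<open>auto simp: F_def intro!: continuous_intros holomorphic_intros\<close>)
  moreover have "F (of_real \<rho>) = G (of_real \<rho>)"
    using \<rho> nz[of "of_real \<rho>"] by (simp add: F_def power2_eq_square)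
  ultimately have "((\<lambda>t. F (cis t) / (cis t - of_real \<rho>) * \<i> * cis t) has_integral
      (2 * of_real pi * \<i> * G (of_real \<rho>))) {0..2*pi}"
    unfolding circlepath_def using has_contour_integral_part_circlepath_iff[of 0 "2*pi" _ _ 0 1] by simp
  then have "((\<lambda>t. F (cis t) / (cis t - of_real \<rho>) * \<i> * cis t / \<i>) has_integral
      (2 * of_real pi * \<i> * G (of_real \<rho>)) / \<i>) {0..2*pi}"
    by (rule has_integral_divide)
  moreover have "F (cis t) / (cis t - of_real \<rho>) * \<i> * cis t / \<i> =
     G (cis t) * of_real ((1-\<rho>\<^sup>2) / (1 - 2*\<rho>*cos t + \<rho>\<^sup>2))" for t
  proof -
    have n: "cis t - of_real \<rho> \<noteq> 0" using \<rho> by (metis abs_of_nonneg eq_iff_diff_eq_0 less_irrefl norm_cis norm_of_real)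
    have "cis t * (cis t + cnj (cis t)) = cis t * cis t + 1" 
      by (simp add: algebra_simps cis_cnj cis_mult)
    moreover have "cis t + cnj (cis t) = 2 * of_real (cos t)" by (simp add: complex_eq_iff)
    ultimately have c: "cis t * (2 * of_real (cos t)) = cis t * cis t + 1" by simp
    have "(cis t - of_real \<rho>) * (1 - of_real \<rho> * cis t) = cis t + (of_real \<rho>)\<^sup>2 * cis t - of_real \<rho> * (cis t * cis t + 1)"
      by (simp add: algebra_simps power2_eq_square)
    also have "\<dots> = cis t * of_real (1 - 2*\<rho>*cos t + \<rho>\<^sup>2)"
      unfolding c[symmetric] by (simp add: algebra_simps)
    finally have "(cis t - of_real \<rho>) * (1 - of_real \<rho> * cis t) = cis t * of_real (1 - 2*\<rho>*cos t + \<rho>\<^sup>2)" .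
    then have "cis t / ((cis t - of_real \<rho>) * (1 - of_real \<rho> * cis t)) = 1 / of_real (1 - 2*\<rho>*cos t + \<rho>\<^sup>2)"
      by (simp del: of_real_add of_real_diff)
    then have "G (cis t) * of_real (1-\<rho>\<^sup>2) * (cis t / ((cis t - of_real \<rho>) * (1 - of_real \<rho> * cis t)))
       = G (cis t) * of_real ((1-\<rho>\<^sup>2) / (1 - 2*\<rho>*cos t + \<rho>\<^sup>2))"
      by (simp only: of_real_divide) simp
    then show ?thesis unfolding F_def by (simp add: mult_ac)
  qed
  moreover have "2 * of_real pi * \<i> * G (of_real \<rho>) / \<i> = of_real (2*pi) * G (of_real \<rho>)" by simp
  ultimately show ?thesis by (simp only:)
qed

lemma poisson_denominator_pos:
  fixes \<rho> x :: real
  assumes "0 \<le> \<rho>" "\<rho> < 1"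
  shows "1 - 2*\<rho>*cos x + \<rho>\<^sup>2 > 0"
proof -
  have "2*\<rho>*cos x \<le> 2*\<rho>*1" using assms by (intro mult_left_mono) auto
  moreover have "(1-\<rho>)\<^sup>2 > 0" using assms by simp
  ultimately show ?thesis by (simp add: power2_eq_square algebra_simps)
qed

text \<open>Integration by parts: the Poisson kernel is decreasing on \<open>[0, pi]\<close>, so a bound for the
  symmetric averages of \<open>u\<close> is inherited by its Poisson integral.\<close>

lemma poisson_integral_le:
  fixes u :: "real \<Rightarrow> real" and \<rho> la t :: real
  defines "P \<equiv> \<lambda>x. (1-\<rho>\<^sup>2) / (1 - 2*\<rho>*cos x + \<rho>\<^sup>2)"
  assumes u: "continuous_on UNIV u" and \<rho>: "0 \<le> \<rho>" "\<rho> < 1"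
    and avg: "\<And>x. 0 < x \<Longrightarrow> x \<le> pi \<Longrightarrow> integral {t-x..t+x} u \<le> 2*la*x"
  shows "integral {0..pi} (\<lambda>x. P x * (u (t+x) + u (t-x))) \<le> 2*la * integral {0..pi} P"
proof -
  \<comment> \<open>Since pi < 4, the antiderivative is differentiable on an open interval
    containing every point t + x and t - x with 0 <= x <= pi.\<close>
  obtain U where U: "\<And>y. y \<in> {t-4..t+4} \<Longrightarrow> (U has_vector_derivative u y) (at y within {t-4..t+4})"
    using antiderivative_continuous[of "t-4" "t+4" u] continuous_on_subset[OF u] by blast
  have pi4: "pi < 4" using pi_less_4 .
  have U': "(U has_real_derivative u y) (at y)" if "y \<in> {t-4<..<t+4}" for y
    using U[of y] that at_within_Icc_at[of "t-4" y "t+4"]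
    by (simp add: has_real_derivative_iff_has_vector_derivative)
  define d where "d x = 1 - 2*\<rho>*cos x + \<rho>\<^sup>2" for x
  have d: "d x > 0" for x unfolding d_def by (rule poisson_denominator_pos[OF \<rho>])
  have r2: "1 - \<rho>\<^sup>2 > 0" using \<rho> by (simp add: power_less_one_iff abs_square_less_1)
  have P: "P = (\<lambda>x. (1-\<rho>\<^sup>2) / d x)" by (simp add: P_def d_def)
  have cP: "continuous_on A P" for A unfolding P d_def
    by (intro continuous_intros) (metis d d_def less_irrefl)
  \<comment> \<open>The slack in the hypothesis \<open>avg\<close>: nonnegative on [0, pi] and zero
    at 0.\<close>
  define ch where "ch x = 2*la*x - (U (t+x) - U (t-x))" for x
  have ch: "ch x \<ge> 0" if "x \<in> {0..pi}" for x
  proof (cases "x = 0")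
    case False
    have "(u has_integral U (t+x) - U (t-x)) {t-x..t+x}"
    proof (rule fundamental_theorem_of_calculus)
      show "(U has_vector_derivative u y) (at y within {t-x..t+x})" if "y \<in> {t-x..t+x}" for y
        using U'[of y] that pi4 \<open>x \<in> _\<close>
        by (auto simp: has_real_derivative_iff_has_vector_derivative intro: has_vector_derivative_at_within)
    qed (use that in auto)
    then show ?thesis using avg[of x] False that by (auto simp: ch_def integral_unique)
  qed (simp add: ch_def)
  define Pd where "Pd x = - ((1 - \<rho>\<^sup>2) * (2 * \<rho> * sin x) / (d x)\<^sup>2)" for x
  have dd: "(d has_real_derivative 2*\<rho>* sin x) (at x)" for x
    unfolding d_def[abs_def] by (auto intro!: derivative_eq_intros)
  have dP: "(P has_real_derivative Pd x) (at x)" for x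
    using DERIV_divide[OF DERIV_const[of "1-\<rho>\<^sup>2"] dd[of x]] d[of x]
    unfolding P Pd_def by (simp add: power2_eq_square)
  have dch: "(ch has_real_derivative (2*la - (u (t+x) + u (t-x)))) (at x)" if "x \<in> {0..pi}" for x
  proof -
    have 1: "((\<lambda>x. U (t+x)) has_real_derivative u (t+x) * 1) (at x)"
      by (rule DERIV_chain2[OF U']) (use that pi4 in \<open>auto intro!: derivative_eq_intros\<close>)
    have 2: "((\<lambda>x. U (t-x)) has_real_derivative u (t-x) * (-1)) (at x)"
      by (rule DERIV_chain2[OF U']) (use that pi4 in \<open>auto intro!: derivative_eq_intros\<close>)
    show ?thesis unfolding ch_def by (rule derivative_eq_intros 1 2 refl | simp)+
  qed
  \<comment> \<open>The derivative of P ch. Its boundary value at pi is nonnegative and that at 0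
    vanishes, while the part with the derivative of \<open>P\<close> is at most 0 and may be
    dropped.\<close>
  have W: "((\<lambda>x. Pd x * ch x + (2*la - (u (t+x) + u (t-x))) * P x) has_integral
      (P pi * ch pi - P 0 * ch 0)) {0..pi}"
    by (rule fundamental_theorem_of_calculus)
       (auto simp: has_real_derivative_iff_has_vector_derivative[symmetric]
          intro!: DERIV_mult' has_field_derivative_at_within[OF DERIV_mult[OF dP dch]])
  have cu: "continuous_on {0..pi} (\<lambda>x. P x * (u (t+x) + u (t-x)))"
    by (intro continuous_intros cP continuous_on_compose2[OF u]) auto
  have iP: "(\<lambda>x. 2*la * P x) integrable_on {0..pi}"
    by (intro integrable_continuous_interval continuous_intros cP)
  have iu: "(\<lambda>x. P x * (u (t+x) + u (t-x))) integrable_on {0..pi}"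
    by (rule integrable_continuous_interval[OF cu])
  have "((\<lambda>x. 2*la * P x - P x * (u (t+x) + u (t-x))) has_integral
      2*la * integral {0..pi} P - integral {0..pi} (\<lambda>x. P x * (u (t+x) + u (t-x)))) {0..pi}"
    using has_integral_diff[OF integrable_integral[OF iP] integrable_integral[OF iu]]
    by simp
  then have "P pi * ch pi - P 0 * ch 0 \<le> 2*la * integral {0..pi} P - integral {0..pi} (\<lambda>x. P x * (u (t+x) + u (t-x)))"
  proof (rule has_integral_le[OF W])
    fix x assume x: "x \<in> {0..pi}"
    have "Pd x \<le> 0" unfolding Pd_def using x r2 \<rho> sin_ge_zero[of x] by simp
    then have "Pd x * ch x \<le> 0" using ch[OF x] by (simp add: mult_nonpos_nonneg)
    then show "Pd x * ch x + (2*la - (u (t+x) + u (t-x))) * P x \<le> 2*la * P x - P x * (u (t+x) + u (t-x))"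
      by (simp add: algebra_simps)
  qed
  moreover have "P pi * ch pi \<ge> 0" using ch[of pi] d[of pi] r2 by (simp add: P)
  moreover have "ch 0 = 0" by (simp add: ch_def)
  ultimately show ?thesis by simp
qed

lemma cis_plus_2pi: "cis (x + 2*pi) = cis x"
  by (simp add: complex_eq_iff)

lemma integral_fold_circle:
  fixes f :: "real \<Rightarrow> 'a::euclidean_space"
  assumes "continuous_on UNIV f" and per: "\<And>x. f (x + 2*pi) = f x"
  shows "integral {0..2*pi} f = integral {0..pi} (\<lambda>x. f x + f (- x))"
proof -
  have c: "continuous_on A f" for A using assms(1) continuous_on_subset by blast
  have i: "f integrable_on {a..b}" for a b by (rule integrable_continuous_interval[OF c])
  have "integral {pi..2*pi} f = integral {-pi..0} (\<lambda>x. f (x + 2*pi))"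
    using integral_shift_real_ivl[of pi "2*pi" "2*pi" f] by simp
  also have "\<dots> = integral {-pi..0} f" by (simp add: per)
  also have "\<dots> = integral {0..pi} (\<lambda>x. f (- x))"
    using Henstock_Kurzweil_Integration.integral_reflect_real[of pi 0 "\<lambda>x. f (- x)"] by simp
  finally have "integral {pi..2*pi} f = integral {0..pi} (\<lambda>x. f (- x))" .
  moreover have "(\<lambda>x. f (- x)) integrable_on {0..pi}"
    by (intro integrable_continuous_interval continuous_on_compose2[OF assms(1)] continuous_intros) auto
  ultimately show ?thesis
    using Henstock_Kurzweil_Integration.integral_combine[of 0 pi "2*pi" f] i by (simp add: integral_add)
qed

text \<open>The value at radius \<open>r\<close> is at most the Poisson average of |g| over the
  circle of radius \<open>R\<close>. The kernel is even, so folding pairs t + x with t - x, which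
  brings in the symmetric averages; the kernel has integral pi over [0, pi], so the bound comes out
  as \<open>la\<close> exactly. Staying at a radius \<open>R\<close> below 1 keeps everything
  continuous up to the circle.\<close>

lemma radial_le_symmetric_average:
  assumes g: "g holomorphic_on ball 0 1" and R: "R < 1" and r: "0 \<le> r" "r < R"
    and avg: "\<And>x. 0 < x \<Longrightarrow> x \<le> pi \<Longrightarrow> integral {t-x..t+x} (\<lambda>s. cmod (g (of_real R * cis s))) \<le> 2*la*x"
  shows "cmod (g (of_real r * cis t)) \<le> la"
proof -
  define \<rho> where "\<rho> = r / R"
  have \<rho>: "0 \<le> \<rho>" "\<rho> < 1" "R * \<rho> = r" and R0: "R > 0" using r by (auto simp: \<rho>_def)
  define P where "P = (\<lambda>x. (1-\<rho>\<^sup>2) / (1 - 2*\<rho>*cos x + \<rho>\<^sup>2))"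
  note d = poisson_denominator_pos[OF \<rho>(1,2)]
  have r2: "1 - \<rho>\<^sup>2 > 0" using \<rho> by (simp add: power_less_one_iff abs_square_less_1)
  have P0: "P x \<ge> 0" for x unfolding P_def using d[of x] r2 by simp
  have cP: "continuous_on A P" for A unfolding P_def
    by (intro continuous_intros) (metis d less_irrefl)
  have Peven: "P (-x) = P x" "P (x + 2*pi) = P x" for x by (auto simp: P_def)
  define u where "u s = cmod (g (of_real R * cis s))" for s
  \<comment> \<open>Rescaling by \<open>R\<close> and rotating by \<open>t\<close> moves the circle
    of radius \<open>R\<close> to the unit circle and the point in question to the real number
    \<open>\<rho>\<close>.\<close>
  define G where "G w = g (of_real R * w * cis t)" for w
  have ball: "of_real R * w * cis t \<in> ball 0 1" if "cmod w \<le> 1" for w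
  proof -
    have "R * cmod w \<le> R * 1" using that R0 by (intro mult_left_mono) auto
    then have "R * cmod w < 1" using R by linarith
    then show ?thesis using R0 by (simp add: norm_mult)
  qed
  have cg: "continuous_on (ball 0 1) g" using g by (rule holomorphic_on_imp_continuous_on)
  have cG: "continuous_on (cball 0 1) G" unfolding G_def
    by (rule continuous_on_compose2[OF cg]) (use ball in \<open>auto intro!: continuous_intros\<close>)
  have hG: "G holomorphic_on ball 0 1" unfolding G_def
    by (rule holomorphic_on_compose_gen[OF _ g, unfolded o_def]) (use ball in \<open>auto intro!: holomorphic_intros\<close>)
  have cu: "continuous_on UNIV u" unfolding u_def
    by (intro continuous_intros continuous_on_compose2[OF cg])
       (use ball[of "cis (_ - t)"] R R0 in \<open>auto simp: norm_mult intro!: continuous_intros\<close>)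
  have cGc: "continuous_on UNIV (\<lambda>x. G (cis x))"
    by (rule continuous_on_compose2[OF cG]) (auto intro!: continuous_intros)
  have cGm: "continuous_on S (\<lambda>x. G (cis (-x)))" for S
    by (rule continuous_on_compose2[OF cG]) (auto intro!: continuous_intros)
  have one: "((\<lambda>x. of_real (P x) :: complex) has_integral of_real (2*pi)) {0..2*pi}"
    using poisson_formula[of "\<lambda>_. 1" \<rho>] \<rho> by (simp add: P_def)
  have "(P has_integral 2*pi) {0..2*pi}"
    using has_integral_Re[OF one] by simp
  moreover have "integral {0..2*pi} P = integral {0..pi} (\<lambda>x. P x + P (-x))"
    by (rule integral_fold_circle[OF cP]) (simp add: Peven)
  moreover have "integral {0..pi} (\<lambda>x. P x + P (-x)) = 2 * integral {0..pi} P"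
    by (simp add: Peven flip: mult_2)
  ultimately have iP: "integral {0..pi} P = pi" by (simp add: integral_unique)
  have "of_real (2*pi) * G (of_real \<rho>) = integral {0..2*pi} (\<lambda>x. G (cis x) * of_real (P x))"
    using poisson_formula[OF cG hG \<rho>(1,2)] by (simp add: P_def integral_unique)
  also have "\<dots> = integral {0..pi} (\<lambda>x. G (cis x) * of_real (P x) + G (cis (-x)) * of_real (P (-x)))"
  proof (rule integral_fold_circle)
    show "continuous_on UNIV (\<lambda>x. G (cis x) * of_real (P x))"
      by (intro continuous_intros cGc continuous_on_of_real cP)
    show "G (cis (x + 2*pi)) * of_real (P (x + 2*pi)) = G (cis x) * of_real (P x)" for x
      by (simp only: Peven cis_plus_2pi)
  qed
  finally have "cmod (of_real (2*pi) * G (of_real \<rho>)) =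
      cmod (integral {0..pi} (\<lambda>x. G (cis x) * of_real (P x) + G (cis (-x)) * of_real (P (-x))))"
    by (rule arg_cong)
  then have "2*pi * cmod (G (of_real \<rho>)) =
      cmod (integral {0..pi} (\<lambda>x. G (cis x) * of_real (P x) + G (cis (-x)) * of_real (P (-x))))"
    by (simp only: norm_mult norm_of_real) simp
  also have "\<dots> \<le> integral {0..pi} (\<lambda>x. P x * (u (t+x) + u (t-x)))"
  proof (rule integral_norm_bound_integral)
    show "(\<lambda>x. G (cis x) * of_real (P x) + G (cis (-x)) * of_real (P (-x))) integrable_on {0..pi}"
      unfolding Peven by (intro integrable_continuous_interval continuous_on_add continuous_on_mult continuous_on_of_real cP
          continuous_on_subset[OF cGc] cGm) auto
    show "(\<lambda>x. P x * (u (t+x) + u (t-x))) integrable_on {0..pi}"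
      by (intro integrable_continuous_interval continuous_intros cP continuous_on_compose2[OF cu]) auto
    fix x
    have rot: "of_real R * cis x * cis t = of_real R * cis (t+x)" "of_real R * cis (-x) * cis t = of_real R * cis (t-x)"
      by (simp_all add: cis_mult mult.assoc add.commute)
    have "norm (G (cis x) * of_real (P x) + G (cis (-x)) * of_real (P (-x))) \<le> u (t+x) * P x + u (t-x) * P x"
      by (rule order_trans[OF norm_triangle_ineq])
         (simp add: norm_mult Peven P0 u_def G_def rot)
    then show "norm (G (cis x) * of_real (P x) + G (cis (-x)) * of_real (P (-x))) \<le> P x * (u (t+x) + u (t-x))"
      by (simp add: algebra_simps)
  qed
  also have "\<dots> \<le> 2*la * integral {0..pi} P"
    unfolding P_def by (rule poisson_integral_le[OF cu \<rho>(1,2)]) (use avg in \<open>auto simp: u_def[abs_def]\<close>)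
  finally have "cmod (G (of_real \<rho>)) \<le> la" by (simp add: iP)
  then show ?thesis unfolding G_def using \<rho>(3) by (simp flip: of_real_mult)
qed

text \<open>The intervals [t - x, t + x] with t in [0, 2 pi] and x <= pi all lie in [-pi, 3 pi],
  which is exactly two periods.\<close>

lemma integral_two_periods:
  fixes f :: "real \<Rightarrow> real"
  assumes "continuous_on UNIV f" and per: "\<And>x. f (x + 2*pi) = f x"
  shows "integral {-pi..3*pi} f = 2 * integral {0..2*pi} f"
proof -
  have i: "f integrable_on {a..b}" for a b
    by (rule integrable_continuous_interval) (rule continuous_on_subset[OF assms(1)], simp)
  have "integral {-pi..0} f = integral {pi..2*pi} f"
    using integral_shift_real_ivl[of pi "2*pi" "2*pi" f] by (simp add: per)
  moreover have "integral {2*pi..3*pi} f = integral {0..pi} f"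
    using integral_shift_real_ivl[of "2*pi" "2*pi" "3*pi" f] by (simp add: per)
  moreover have "integral {-pi..0} f + integral {0..3*pi} f = integral {-pi..3*pi} f"
    by (rule Henstock_Kurzweil_Integration.integral_combine) (auto simp: i)
  moreover have "integral {0..2*pi} f + integral {2*pi..3*pi} f = integral {0..3*pi} f"
    by (rule Henstock_Kurzweil_Integration.integral_combine) (auto simp: i)
  moreover have "integral {0..pi} f + integral {pi..2*pi} f = integral {0..2*pi} f"
    by (rule Henstock_Kurzweil_Integration.integral_combine) (auto simp: i)
  ultimately show ?thesis by simp
qed

lemma continuous_on_circle:
  assumes g: "g holomorphic_on ball 0 1" and R: "\<bar>R\<bar> < 1"
  shows "continuous_on A (\<lambda>s. g (of_real R * cis s))"
  by (rule continuous_on_compose2[OF holomorphic_on_imp_continuous_on[OF g]])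
     (use R in \<open>auto simp: norm_mult intro!: continuous_intros\<close>)

text \<open>Every point of \<open>E\<close> is the centre of an interval on which |g| has average
  above \<open>la\<close>. Vitali's lemma selects disjoint ones whose fivefold enlargements cover
  \<open>E\<close>. An enlarged interval has length 10 X, less than 5/la times the integral over the
  original one, and the disjoint integrals add up to at most 4 pi A; this gives 20 pi A /
  la.\<close>

lemma weak_type_radial_aux:
  assumes g: "g holomorphic_on ball 0 1" and A: "A > 0" and la: "la > 0" and R: "0 < R" "R < 1"
    and mean: "circle_mean g R \<le> A\<^sup>2"
  defines "E \<equiv> {t\<in>{0..2*pi}. \<exists>r\<in>{0..<R}. cmod (g (of_real r * cis t)) > la}"
  shows "E \<in> lmeasurable" "measure lebesgue E \<le> 20*pi*A/la"
proof -
  define u where "u s = cmod (g (of_real R * cis s))" for s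
  have cu: "continuous_on S u" for S unfolding u_def
    using R by (intro continuous_intros continuous_on_circle[OF g]) auto
  have iu: "u integrable_on {a..b}" for a b by (rule integrable_continuous_interval[OF cu])
  have u0: "u s \<ge> 0" for s by (simp add: u_def)
  \<comment> \<open>From the mean of u^2 to the mean of u by u <= (A^2 + u^2) / (2A), in place of
    the Cauchy-Schwarz inequality.\<close>
  have "integral {0..2*pi} u \<le> integral {0..2*pi} (\<lambda>t. (A\<^sup>2 + (u t)\<^sup>2) / (2*A))"
  proof (rule integral_le[OF iu])
    show "(\<lambda>t. (A\<^sup>2 + (u t)\<^sup>2) / (2*A)) integrable_on {0..2*pi}"
      using A by (intro integrable_continuous_interval continuous_intros cu) auto
    show "u t \<le> (A\<^sup>2 + (u t)\<^sup>2) / (2*A)" for t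
      using A sum_squares_bound[of A "u t"] by (simp add: field_simps)
  qed
  also have "\<dots> = (integral {0..2*pi} (\<lambda>t. A\<^sup>2 + (u t)\<^sup>2)) / (2*A)" by simp
  also have "integral {0..2*pi} (\<lambda>t. A\<^sup>2 + (u t)\<^sup>2) = 2*pi*A\<^sup>2 + integral {0..2*pi} (\<lambda>t. (u t)\<^sup>2)"
    by (subst integral_add) (auto intro!: integrable_continuous_interval continuous_intros cu)
  also have "\<dots> \<le> 2*pi*A\<^sup>2 + 2*pi*A\<^sup>2"
    using mean by (simp add: u_def field_simps)
  finally have "integral {0..2*pi} u \<le> (2*pi*A\<^sup>2 + 2*pi*A\<^sup>2) / (2*A)"
    using A by (simp add: divide_right_mono)
  also have "\<dots> = 2*pi*A" using A by (simp add: power2_eq_square)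
  finally have "integral {0..2*pi} u \<le> 2*pi*A" .
  moreover have "integral {-pi..3*pi} u = 2 * integral {0..2*pi} u"
    by (rule integral_two_periods[OF cu]) (simp add: u_def cis_plus_2pi)
  ultimately have Iu: "integral {-pi..3*pi} u \<le> 4*pi*A" by linarith
  \<comment> \<open>For each fixed radius the condition on \<open>t\<close> is open, so the union
    over uncountably many radii is still open and \<open>E\<close> is measurable.\<close>
  have E_alt: "E = {0..2*pi} \<inter> (\<Union>r\<in>{0..<R}. {t. cmod (g (of_real r * cis t)) > la})"
    by (auto simp: E_def)
  have "open (\<Union>r\<in>{0..<R}. {t. cmod (g (of_real r * cis t)) > la})"
    using R by (intro open_UN ballI open_Collect_less continuous_intros continuous_on_circle[OF g]) auto
  then have "E \<in> sets lebesgue" unfolding E_alt by (intro sets.Int) (auto intro: borel_open)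
  moreover have "E \<subseteq> {0..2*pi}" by (auto simp: E_def)
  ultimately show Em: "E \<in> lmeasurable"
    by (metis bounded_set_imp_lmeasurable bounded_closed_interval bounded_subset)
  have ex: "\<exists>x. 0 < x \<and> x \<le> pi \<and> 2*la*x < integral {t-x..t+x} u" if t: "t \<in> E" for t
  proof (rule ccontr)
    assume "\<not> ?thesis"
    then have a: "\<And>x. 0 < x \<Longrightarrow> x \<le> pi \<Longrightarrow> integral {t-x..t+x} u \<le> 2*la*x" by force
    have "cmod (g (of_real r * cis t)) \<le> la" if "0 \<le> r" "r < R" for r
      by (rule radial_le_symmetric_average[OF g R(2) that]) (use a in \<open>simp add: u_def[abs_def]\<close>)
    then show False using t by (force simp: E_def)
  qed
  define X where "X t = (SOME x. 0 < x \<and> x \<le> pi \<and> 2*la*x < integral {t-x..t+x} u)" for t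
  have X: "0 < X t" "X t \<le> pi" "2*la*X t < integral {t-X t..t+X t} u" if "t \<in> E" for t
    using someI_ex[OF ex[OF that]] unfolding X_def by auto
  have "E \<subseteq> (\<Union>i\<in>E. cball i (X i))" using X(1) by force
  then obtain C where C: "countable C" "C \<subseteq> E"
      "pairwise (\<lambda>i j. disjnt (cball i (X i)) (cball j (X j))) C"
      "E \<subseteq> (\<Union>i\<in>C. cball i (5 * X i))"
    by (rule Vitali_covering_lemma_cballs[where B = pi]) (use X in auto)
  \<comment> \<open>A bound uniform over finite subfamilies; \<open>measure_UN_bound\<close> extends
    it to the countable cover.\<close>
  have bnd: "measure lebesgue (\<Union>i\<in>I. cball i (5 * X i)) \<le> 20*pi*A/la" if I: "I \<subseteq> C" "finite I" for I
  proof -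
    have pn: "pairwise (\<lambda>i i'. negligible (cball i (X i) \<inter> cball i' (X i'))) I"
      unfolding pairwise_def
    proof (intro ballI impI)
      fix i j assume "i \<in> I" "j \<in> I" "i \<noteq> j"
      then have "disjnt (cball i (X i)) (cball j (X j))" using C(3) I(1) unfolding pairwise_def by blast
      then show "negligible (cball i (X i) \<inter> cball j (X j))" by (simp add: disjnt_def)
    qed
    have sub: "integral (\<Union>i\<in>I. cball i (X i)) u \<le> integral {-pi..3*pi} u"
    proof (rule integral_subset_le)
      show "(\<Union>i\<in>I. cball i (X i)) \<subseteq> {-pi..3*pi}"
      proof
        fix y assume "y \<in> (\<Union>i\<in>I. cball i (X i))"
        then obtain i where i: "i \<in> I" "\<bar>i - y\<bar> \<le> X i" by (auto simp: dist_real_def)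
        then have "i \<in> E" using I C by blast
        with X(2)[of i] i show "y \<in> {-pi..3*pi}" by (auto simp: E_def)
      qed
      have "(u has_integral (\<Sum>i\<in>I. integral (cball i (X i)) u)) (\<Union>i\<in>I. cball i (X i))"
        by (rule has_integral_UN[OF I(2) _ pn]) (use iu in \<open>auto simp: cball_eq_atLeastAtMost integrable_integral\<close>)
      then show "u integrable_on (\<Union>i\<in>I. cball i (X i))" by (rule has_integral_integrable)
    qed (use iu u0 in auto)
    have "measure lebesgue (\<Union>i\<in>I. cball i (5 * X i)) \<le> (\<Sum>i\<in>I. measure lebesgue (cball i (5 * X i)))"
      by (rule measure_UNION_le) (use I in auto)
    also have "\<dots> = (\<Sum>i\<in>I. 10 * X i)"
    proof (rule sum.cong)
      fix i assume "i \<in> I"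
      then have "X i > 0" using X(1) I C by blast
      then show "measure lebesgue (cball i (5 * X i)) = 10 * X i"
        by (simp add: cball_eq_atLeastAtMost)
    qed simp
    also have "\<dots> \<le> (\<Sum>i\<in>I. (5/la) * integral (cball i (X i)) u)"
    proof (rule sum_mono)
      fix i assume "i \<in> I"
      then have "2*la*X i < integral {i-X i..i+X i} u" using X(3) I C by blast
      then show "10 * X i \<le> (5/la) * integral (cball i (X i)) u"
        using la by (simp add: cball_eq_atLeastAtMost field_simps)
    qed
    also have "\<dots> = (5/la) * (\<Sum>i\<in>I. integral (cball i (X i)) u)" by (simp add: sum_distrib_left)
    also have "(\<Sum>i\<in>I. integral (cball i (X i)) u) = integral (\<Union>i\<in>I. cball i (X i)) u"
    proof (rule integral_unique[symmetric, OF has_integral_UN])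
      show "finite I" by (rule I)
      show "(u has_integral integral (cball i (X i)) u) (cball i (X i))" for i
        using iu by (simp add: cball_eq_atLeastAtMost integrable_integral)
      show "pairwise (\<lambda>i i'. negligible (cball i (X i) \<inter> cball i' (X i'))) I" by (rule pn)
    qed
    also have "(5/la) * integral (\<Union>i\<in>I. cball i (X i)) u \<le> (5/la) * (4*pi*A)"
      using sub Iu la by (intro mult_left_mono) auto
    finally show ?thesis by simp
  qed
  have lm: "cball i (5 * X i) \<in> lmeasurable" for i by simp
  have "measure lebesgue E \<le> measure lebesgue (\<Union>i\<in>C. cball i (5 * X i))"
    by (rule measure_mono_fmeasurable[OF C(4)])
       (use Em fmeasurable_UN_bound[OF C(1) lm bnd] in auto)
  also have "\<dots> \<le> 20*pi*A/la" by (rule measure_UN_bound[OF C(1) lm bnd])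
  finally show "measure lebesgue E \<le> 20*pi*A/la" .
qed

text \<open>The sets for the radii R = 1 - 1/(n+2) increase to \<open>E\<close>, and the bound of
  \<open>weak_type_radial_aux\<close> does not depend on R. A finite union of them is its largest
  member, so the same bound passes to the limit.\<close>

lemma weak_type_radial:
  assumes g: "g holomorphic_on ball 0 1" and A: "A > 0" and la: "la > 0"
    and mean: "\<And>R. 0 \<le> R \<Longrightarrow> R < 1 \<Longrightarrow> circle_mean g R \<le> A\<^sup>2"
  defines "E \<equiv> {t\<in>{0..2*pi}. \<exists>r\<in>{0..<1}. cmod (g (of_real r * cis t)) > la}"
  shows "E \<in> lmeasurable" "measure lebesgue E \<le> 20*pi*A/la"
proof -
  define F where "F n = {t\<in>{0..2*pi}. \<exists>r\<in>{0..<1 - 1 / real (n+2)}. cmod (g (of_real r * cis t)) > la}" for n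
  have R: "0 < 1 - 1 / real (n+2)" "1 - 1 / real (n+2) < 1" for n by (auto simp: field_simps)
  note aux = weak_type_radial_aux[OF g A la R mean, folded F_def]
  have F: "F n \<in> lmeasurable" "measure lebesgue (F n) \<le> 20*pi*A/la" for n
    using aux[of n] R[of n] by auto
  have Fmono: "F m \<subseteq> F n" if "m \<le> n" for m n
  proof -
    have "1 / real (n+2) \<le> 1 / real (m+2)" using that by (simp add: frac_le)
    then have "{0..<1 - 1 / real (m+2)} \<subseteq> {0..<1 - 1 / real (n+2)}" by auto
    then show ?thesis unfolding F_def by blast
  qed
  have EF: "E = (\<Union>n. F n)"
  proof -
    have "\<exists>n. r < 1 - 1 / real (n+2)" if r1: "r < 1" for r
    proof -
      obtain n where "inverse (real (Suc n)) < 1 - r" using reals_Archimedean[of "1-r"] r1 by auto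
      moreover have "1 / real (n+2) \<le> inverse (real (Suc n))" by (simp add: field_simps)
      ultimately show ?thesis by (intro exI[of _ n]) linarith
    qed
    then have "E \<subseteq> (\<Union>n. F n)" unfolding E_def F_def by fastforce
    moreover have "F n \<subseteq> E" for n
    proof
      fix t assume "t \<in> F n"
      then obtain r where "t \<in> {0..2*pi}" "0 \<le> r" "r < 1 - 1 / real (n+2)" "la < cmod (g (of_real r * cis t))"
        by (auto simp: F_def)
      moreover have "r < 1" using calculation(3) R(2)[of n] by linarith
      ultimately show "t \<in> E" by (auto simp: E_def)
    qed
    ultimately show ?thesis by blast
  qed
  have b: "measure lebesgue (\<Union>n\<in>I. F n) \<le> 20*pi*A/la" if "finite I" for I
  proof (cases "I = {}")
    case False
    have "(\<Union>n\<in>I. F n) \<subseteq> F (Max I)" using Fmono Max_ge[OF that] by blast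
    then have "(\<Union>n\<in>I. F n) = F (Max I)" using Max_in[OF that False] by blast
    then show ?thesis using F(2) by simp
  qed (use A la in simp)
  show "E \<in> lmeasurable" unfolding EF by (rule fmeasurable_UN_bound[OF _ F(1) b]) auto
  show "measure lebesgue E \<le> 20*pi*A/la" unfolding EF by (rule measure_UN_bound[OF _ F(1) b]) auto
qed

section \<open>Taylor coefficients of Hardy space functions\<close>

definition taylor :: "(complex \<Rightarrow> complex) \<Rightarrow> nat \<Rightarrow> complex" where
  "taylor f n = (deriv ^^ n) f 0 / fact n"

lemma taylor_sums:
  assumes "f holomorphic_on ball 0 1" "cmod z < 1"
  shows "(\<lambda>n. taylor f n * z ^ n) sums f z"
  using holomorphic_power_series[OF assms(1), of z] assms(2) by (simp add: taylor_def)

text \<open>The differences of the coefficients form a power series with sum 0. If one of them were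
  nonzero, this sum would have no zeros in some punctured disk around 0.\<close>

lemma taylor_unique:
  assumes f: "\<And>z. cmod z < 1 \<Longrightarrow> (\<lambda>n. a n * z ^ n) sums f z" and hf: "f holomorphic_on ball 0 1"
  shows "taylor f = a"
proof (rule ext)
  fix n
  define d where "d n = taylor f n - a n" for n
  have d0: "(\<lambda>n. d n * w ^ n) sums 0" if "norm w < 1" for w
    using sums_diff[OF taylor_sums[OF hf that] f[OF that]] by (simp add: d_def algebra_simps)
  have "d n = 0"
  proof (rule ccontr)
    assume "d n \<noteq> 0"
    moreover have "d 0 = 0" using sums_unique2[OF powser_sums_zero d0[of 0]] by simp
    ultimately have "d n \<noteq> 0" "n > 0" by (auto intro: Nat.gr0I)
    then obtain s where s: "0 < s" "\<And>z. z \<in> cball 0 s - {0::complex} \<Longrightarrow> (0::complex) \<noteq> 0"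
      using powser_0_nonzero[where r = 1 and a = d and \<xi> = 0 and f = "\<lambda>_. 0" and m = n] d0 by auto
    from s(2)[of "of_real s"] s(1) show False by auto
  qed
  then show "taylor f n = a n" by (simp add: d_def)
qed

text \<open>By Parseval the circle mean at radius r is the sum of |a_n|^2 r^(2n). In one direction r
  tends to 1 in finite partial sums, which avoids exchanging limits; in the other, r^(2n) <=
  1.\<close>

lemma H2_iff_summable_taylor:
  assumes hf: "f holomorphic_on ball 0 1"
  shows "f \<in> H2 \<longleftrightarrow> summable (\<lambda>n. (cmod (taylor f n))\<^sup>2)"
proof
  assume "f \<in> H2"
  then obtain C where C: "\<And>r. 0 \<le> r \<Longrightarrow> r < 1 \<Longrightarrow> circle_mean f r \<le> C"
    by (auto simp: H2_def)
  have "(\<Sum>n<N. (cmod (taylor f n))\<^sup>2) \<le> C" for N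
  proof (rule tendsto_upperbound)
    show "((\<lambda>r. \<Sum>n<N. (cmod (taylor f n))\<^sup>2 * r ^ (2*n)) \<longlongrightarrow> (\<Sum>n<N. (cmod (taylor f n))\<^sup>2)) (at_left (1::real))"
      by (auto intro!: tendsto_eq_intros)
    show "\<forall>\<^sub>F r in at_left (1::real). (\<Sum>n<N. (cmod (taylor f n))\<^sup>2 * r ^ (2*n)) \<le> C"
      using eventually_radius
    proof eventually_elim
      case (elim r)
      then have *: "(\<lambda>n. (cmod (taylor f n))\<^sup>2 * r ^ (2*n)) sums circle_mean f r"
        by (intro circle_mean_sums taylor_sums hf) auto
      have "(\<Sum>n<N. (cmod (taylor f n))\<^sup>2 * r ^ (2*n)) \<le> (\<Sum>n. (cmod (taylor f n))\<^sup>2 * r ^ (2*n))"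
        using elim by (intro sum_le_suminf sums_summable[OF *]) auto
      also have "\<dots> \<le> C" using sums_unique[OF *] C[of r] elim by simp
      finally show ?case .
    qed
  qed simp
  then show "summable (\<lambda>n. (cmod (taylor f n))\<^sup>2)"
    by (intro summableI_nonneg_bounded[where x = C]) auto
next
  assume s: "summable (\<lambda>n. (cmod (taylor f n))\<^sup>2)"
  have "circle_mean f r \<le> (\<Sum>n. (cmod (taylor f n))\<^sup>2)"
    if r: "0 \<le> r" "r < 1" for r
  proof -
    have *: "(\<lambda>n. (cmod (taylor f n))\<^sup>2 * r ^ (2*n)) sums circle_mean f r"
      by (intro circle_mean_sums taylor_sums hf r) auto
    show ?thesis unfolding sums_unique[OF *]
      by (rule suminf_le[OF _ sums_summable[OF *] s])
         (use r in \<open>auto intro!: mult_left_le power_le_one\<close>)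
  qed
  then show "f \<in> H2" using hf by (auto simp: H2_def)
qed

lemma H2_holomorphic: "f \<in> H2 \<Longrightarrow> f holomorphic_on ball 0 1"
  by (simp add: H2_def)

lemma H2_summable: "f \<in> H2 \<Longrightarrow> summable (\<lambda>n. (cmod (taylor f n))\<^sup>2)"
  using H2_iff_summable_taylor H2_holomorphic by blast

text \<open>The squared distance in H^2 from f to its Taylor polynomial of \<open>N\<close> terms.
  The \<open>if\<close> keeps the index unshifted, so that such series can be compared term by
  term.\<close>

definition taylor_tail :: "(complex \<Rightarrow> complex) \<Rightarrow> nat \<Rightarrow> real" where
  "taylor_tail f N = (\<Sum>n. if n < N then 0 else (cmod (taylor f n))\<^sup>2)"

lemma taylor_tail:
  assumes "f \<in> H2"
  shows taylor_tail_summable: "summable (\<lambda>n. if n < N then 0 else (cmod (taylor f n))\<^sup>2)"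
    and taylor_tail_nonneg: "taylor_tail f N \<ge> 0"
    and taylor_tail_tendsto: "taylor_tail f \<longlonglongrightarrow> 0"
proof -
  have *: "(\<lambda>n. if n < N then 0 else (cmod (taylor f n))\<^sup>2) sums
     ((\<Sum>n. (cmod (taylor f n))\<^sup>2) - (\<Sum>n<N. (cmod (taylor f n))\<^sup>2))" for N
    using sums_diff[OF summable_sums[OF H2_summable[OF assms]] sums_If_finite_set[of "{..<N}" "\<lambda>n. (cmod (taylor f n))\<^sup>2"]]
    by (simp add: if_distrib[of "\<lambda>x. _ - x"] lessThan_def cong: if_cong)
  show s: "summable (\<lambda>n. if n < N then 0 else (cmod (taylor f n))\<^sup>2)" using * sums_summable by blast
  show "taylor_tail f N \<ge> 0" unfolding taylor_tail_def by (rule suminf_nonneg[OF s]) auto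
  have "(\<lambda>N. (\<Sum>n. (cmod (taylor f n))\<^sup>2) - (\<Sum>n<N. (cmod (taylor f n))\<^sup>2)) \<longlonglongrightarrow>
      (\<Sum>n. (cmod (taylor f n))\<^sup>2) - (\<Sum>n. (cmod (taylor f n))\<^sup>2)"
    by (intro tendsto_intros summable_LIMSEQ H2_summable assms)
  then show "taylor_tail f \<longlonglongrightarrow> 0" unfolding taylor_tail_def using sums_unique[OF *] by simp
qed

lemma circle_mean_tail_le:
  assumes f: "f \<in> H2" and r: "0 \<le> r" "r < 1"
  shows "circle_mean (\<lambda>z. f z - (\<Sum>n<N. taylor f n * z ^ n)) r
     \<le> taylor_tail f N"
proof -
  have *: "(\<lambda>n. (cmod (if n < N then 0 else taylor f n))\<^sup>2 * r ^ (2*n)) sums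
    (circle_mean (\<lambda>z. f z - (\<Sum>n<N. taylor f n * z ^ n)) r)"
  proof (rule circle_mean_sums[OF _ r])
    fix z :: complex assume "cmod z < 1"
    from sums_diff[OF taylor_sums[OF H2_holomorphic[OF f] this] sums_If_finite_set[of "{..<N}" "\<lambda>n. taylor f n * z ^ n"]]
    show "(\<lambda>n. (if n < N then 0 else taylor f n) * z ^ n) sums (f z - (\<Sum>n<N. taylor f n * z ^ n))"
      by (simp add: if_distrib[of "\<lambda>x. _ - x"] if_distrib[of "\<lambda>x. x * _"] lessThan_def cong: if_cong)
  qed
  show ?thesis unfolding sums_unique[OF *] taylor_tail_def
    by (rule suminf_le[OF _ sums_summable[OF *] taylor_tail_summable[OF f]])
       (use r in \<open>auto intro!: mult_left_le power_le_one\<close>)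
qed

section \<open>Radial boundary values\<close>

text \<open>Fatou's theorem: subtracting a Taylor polynomial makes the maximal function small outside a set of
  small measure, and polynomials have limits everywhere.\<close>

lemma negligible_no_radial_limit:
  assumes f: "f \<in> H2"
  shows "negligible {t\<in>{0..2*pi}. \<not> (\<exists>L. ((\<lambda>r. f (of_real r * cis t)) \<longlongrightarrow> L) (at_left 1))}"
proof -
  note hf = H2_holomorphic[OF f]
  \<comment> \<open>The Cauchy condition for the radial limit at \<open>t\<close>, relaxed to the
    single tolerance \<open>\<epsilon>\<close>.\<close>
  define osc where "osc \<epsilon> t \<longleftrightarrow> (\<exists>P. eventually P (at_left (1::real)) \<and>
     (\<forall>r s. P r \<and> P s \<longrightarrow> dist (f (of_real r * cis t)) (f (of_real s * cis t)) < \<epsilon>))" for \<epsilon> t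
  have B: "negligible {t\<in>{0..2*pi}. \<not> osc \<epsilon> t}" if \<epsilon>: "\<epsilon> > 0" for \<epsilon>
    unfolding negligible_outer_le
  proof (intro allI impI)
    fix e :: real assume e: "e > 0"
    \<comment> \<open>Chosen so that the weak type bound 20 pi A / (epsilon/4) equals e.\<close>
    define A where "A = e * \<epsilon> / (80 * pi)"
    have A: "A > 0" using e \<epsilon> by (simp add: A_def)
    then have "\<forall>\<^sub>F N in sequentially. taylor_tail f N < A\<^sup>2"
      by (intro order_tendstoD(2)[OF taylor_tail_tendsto[OF f]]) auto
    then obtain N where N: "taylor_tail f N < A\<^sup>2" by (auto simp: eventually_sequentially)
    define S where "S z = (\<Sum>n<N. taylor f n * z ^ n)" for z
    define g where "g z = f z - S z" for z
    have hg: "g holomorphic_on ball 0 1" unfolding g_def S_def by (intro holomorphic_intros hf)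
    have mean: "circle_mean g R \<le> A\<^sup>2" if "0 \<le> R" "R < 1" for R
      using circle_mean_tail_le[OF f that, of N] N by (simp add: g_def S_def)
    \<comment> \<open>The level epsilon/4 leaves room for four terms: the remainder \<open>g\<close>
      and the oscillation of the polynomial \<open>S\<close>, each at two radii.\<close>
    define E where "E = {t\<in>{0..2*pi}. \<exists>r\<in>{0..<1}. cmod (g (of_real r * cis t)) > \<epsilon>/4}"
    have E: "E \<in> lmeasurable" "measure lebesgue E \<le> 20*pi*A/(\<epsilon>/4)"
      using weak_type_radial[OF hg A _ mean, of "\<epsilon>/4"] \<epsilon> by (auto simp: E_def)
    have "20*pi*A/(\<epsilon>/4) = e" using \<epsilon> by (simp add: A_def)
    moreover have "osc \<epsilon> t" if t: "t \<in> {0..2*pi}" "t \<notin> E" for t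
    proof -
      have g: "cmod (g (of_real r * cis t)) \<le> \<epsilon>/4" if "0 \<le> r" "r < 1" for r
        using t that by (force simp: E_def)
      have "((\<lambda>r. S (of_real r * cis t)) \<longlongrightarrow> S (of_real 1 * cis t)) (at_left 1)"
        unfolding S_def by (intro tendsto_intros)
      then have 1: "\<forall>\<^sub>F r in at_left 1. dist (S (of_real r * cis t)) (S (cis t)) < \<epsilon>/4"
        using \<epsilon> by (intro tendstoD) auto
      show ?thesis unfolding osc_def
      proof (intro exI conjI allI impI)
        show "\<forall>\<^sub>F r in at_left 1. dist (S (of_real r * cis t)) (S (cis t)) < \<epsilon>/4 \<and> r \<in> {0<..<1}"
          using 1 eventually_radius by eventually_elim auto
        fix r s :: real
        assume *: "(dist (S (of_real r * cis t)) (S (cis t)) < \<epsilon>/4 \<and> r \<in> {0<..<1}) \<and>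
          dist (S (of_real s * cis t)) (S (cis t)) < \<epsilon>/4 \<and> s \<in> {0<..<1}"
        have "f (of_real r * cis t) - f (of_real s * cis t) =
           g (of_real r * cis t) - g (of_real s * cis t) + ((S (of_real r * cis t) - S (cis t)) - (S (of_real s * cis t) - S (cis t)))"
          by (simp add: g_def)
        also have "cmod \<dots> \<le> (cmod (g (of_real r * cis t)) + cmod (g (of_real s * cis t))) +
            (cmod (S (of_real r * cis t) - S (cis t)) + cmod (S (of_real s * cis t) - S (cis t)))"
          by (intro order_trans[OF norm_triangle_ineq] add_mono norm_triangle_ineq4)
        also have "\<dots> < (\<epsilon>/4 + \<epsilon>/4) + (\<epsilon>/4 + \<epsilon>/4)"
          using g[of r] g[of s] * by (intro add_le_less_mono add_mono add_strict_mono) (auto simp: dist_norm)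
        finally show "dist (f (of_real r * cis t)) (f (of_real s * cis t)) < \<epsilon>" by (simp add: dist_norm)
      qed
    qed
    ultimately show "\<exists>T. {t \<in> {0..2*pi}. \<not> osc \<epsilon> t} \<subseteq> T \<and> T \<in> lmeasurable \<and> measure lebesgue T \<le> e"
      using E by (intro exI[of _ E]) auto
  qed
  \<comment> \<open>Countably many tolerances 1/(m+1) already give the full Cauchy condition, so the
    exceptional set is a countable union of null sets.\<close>
  have "\<exists>L. ((\<lambda>r. f (of_real r * cis t)) \<longlongrightarrow> L) (at_left 1)"
    if "\<And>m::nat. osc (inverse (real (Suc m))) t" for t
  proof -
    have "cauchy_filter (filtermap (\<lambda>r. f (of_real r * cis t)) (at_left 1))"
      unfolding cauchy_filter_metric_filtermap
    proof (intro allI impI)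
      fix e :: real assume "e > 0"
      then obtain m where m: "inverse (real (Suc m)) < e" using reals_Archimedean by blast
      show "\<exists>P. eventually P (at_left 1) \<and> (\<forall>x y. P x \<and> P y \<longrightarrow> dist (f (of_real x * cis t)) (f (of_real y * cis t)) < e)"
        using that[of m] m unfolding osc_def by (meson less_trans)
    qed
    moreover have "filtermap (\<lambda>r. f (of_real r * cis t)) (at_left 1) \<noteq> bot"
      by (simp add: filtermap_bot_iff)
    ultimately obtain c where "filtermap (\<lambda>r. f (of_real r * cis t)) (at_left 1) \<le> nhds c"
      using cauchy_filter_complete_converges[of _ UNIV] complete_UNIV by auto
    then show ?thesis by (auto simp: filterlim_def)
  qed
  then have "{t\<in>{0..2*pi}. \<not> (\<exists>L. ((\<lambda>r. f (of_real r * cis t)) \<longlongrightarrow> L) (at_left 1))}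
      \<subseteq> (\<Union>m::nat. {t\<in>{0..2*pi}. \<not> osc (inverse (real (Suc m))) t})" by blast
  moreover have "negligible (\<Union>m::nat. {t\<in>{0..2*pi}. \<not> osc (inverse (real (Suc m))) t})"
    by (rule negligible_Union_nat) (rule B, simp)
  ultimately show ?thesis using negligible_subset by blast
qed

abbreviation circ :: "real measure" where "circ \<equiv> lebesgue_on {0..2*pi}"

lemma AE_circ_I:
  assumes "negligible N" "\<And>t. 0 \<le> t \<Longrightarrow> t \<le> 2*pi \<Longrightarrow> t \<notin> N \<Longrightarrow> P t"
  shows "AE t in circ. P t"
  unfolding AE_restrict_space_iff[of "{0..2*pi}" lebesgue, simplified]
  by (rule AE_I'[of N]) (use assms in \<open>auto simp: negligible_iff_null_sets[symmetric]\<close>)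

lemma AE_bdry:
  assumes f: "f \<in> H2"
  shows "AE t in circ. ((\<lambda>r. f (of_real r * cis t)) \<longlongrightarrow> bdry f t) (at_left 1)"
proof (rule AE_circ_I[OF negligible_no_radial_limit[OF f]])
  fix t assume "0 \<le> t" "t \<le> 2*pi" "t \<notin> {t\<in>{0..2*pi}. \<not> (\<exists>L. ((\<lambda>r. f (of_real r * cis t)) \<longlongrightarrow> L) (at_left 1))}"
  then obtain L where "((\<lambda>r. f (of_real r * cis t)) \<longlongrightarrow> L) (at_left 1)" by auto
  then show "((\<lambda>r. f (of_real r * cis t)) \<longlongrightarrow> bdry f t) (at_left 1)"
    unfolding bdry_def using tendsto_Lim[of "at_left (1::real)"] by (metis trivial_limit_at_left_real)
qed

lemma bdryI:
  "((\<lambda>r. f (of_real r * cis t)) \<longlongrightarrow> L) (at_left 1) \<Longrightarrow> bdry f t = L"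
  unfolding bdry_def by (rule tendsto_Lim) auto

section \<open>Square integrable functions on the circle\<close>

lemma norm_add_square_le: "(norm (x + y))\<^sup>2 \<le> 2 * (norm x)\<^sup>2 + 2 * (norm y)\<^sup>2"
proof -
  have "(norm (x + y))\<^sup>2 \<le> (norm x + norm y)\<^sup>2"
    by (intro power_mono norm_triangle_ineq) auto
  also have "\<dots> \<le> 2 * (norm x)\<^sup>2 + 2 * (norm y)\<^sup>2"
    using sum_squares_bound[of "norm x" "norm y"] by (simp add: power2_sum)
  finally show ?thesis .
qed

text \<open>The underlying measure is complete, so a function almost everywhere equal to a member is
  again a member. This matters because boundary values are under control only almost
  everywhere.\<close>

definition sqint :: "(real \<Rightarrow> complex) set" where
  "sqint = {\<phi> \<in> borel_measurable circ. integrable circ (\<lambda>t. (cmod (\<phi> t))\<^sup>2)}"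

text \<open>The Lebesgue counterpart of \<open>H2norm\<close>, which is written with the gauge
  integral; \<open>H2norm_l2n\<close> identifies the two.\<close>

definition l2n :: "(real \<Rightarrow> complex) \<Rightarrow> real" where
  "l2n \<phi> = sqrt ((LINT t|circ. (cmod (\<phi> t))\<^sup>2) / (2*pi))"

lemma sqint_measurable[measurable_dest]: "\<phi> \<in> sqint \<Longrightarrow> \<phi> \<in> borel_measurable circ"
  and sqint_integrable: "\<phi> \<in> sqint \<Longrightarrow> integrable circ (\<lambda>t. (cmod (\<phi> t))\<^sup>2)"
  by (auto simp: sqint_def)

lemma l2n_nonneg [simp]: "l2n \<phi> \<ge> 0"
  by (simp add: l2n_def)

lemma l2n_square: "(l2n \<phi>)\<^sup>2 = (LINT t|circ. (cmod (\<phi> t))\<^sup>2) / (2*pi)"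
  by (simp add: l2n_def)

lemma measurable_cnj [measurable (raw)]:
  "f \<in> borel_measurable M \<Longrightarrow> (\<lambda>x. cnj (f x)) \<in> borel_measurable M"
  using measurable_compose[OF _ borel_measurable_continuous_onI[of cnj]] continuous_on_cnj[OF continuous_on_id] by blast

lemma integrable_mult_sqint:
  assumes "\<phi> \<in> sqint" "\<psi> \<in> sqint"
  shows "integrable circ (\<lambda>t. \<phi> t * cnj (\<psi> t))"
proof (rule Bochner_Integration.integrable_bound)
  show "integrable circ (\<lambda>t. (cmod (\<phi> t))\<^sup>2 + (cmod (\<psi> t))\<^sup>2)"
    using assms by (intro Bochner_Integration.integrable_add sqint_integrable)
  show "(\<lambda>t. \<phi> t * cnj (\<psi> t)) \<in> borel_measurable circ"
    using assms[THEN sqint_measurable] by measurable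
  have "norm (\<phi> t * cnj (\<psi> t)) \<le> norm ((cmod (\<phi> t))\<^sup>2 + (cmod (\<psi> t))\<^sup>2)" for t
  proof -
    have "2 * cmod (\<phi> t) * cmod (\<psi> t) \<le> (cmod (\<phi> t))\<^sup>2 + (cmod (\<psi> t))\<^sup>2"
      by (rule sum_squares_bound)
    moreover have "cmod (\<phi> t) * cmod (\<psi> t) \<ge> 0" by simp
    ultimately have "cmod (\<phi> t) * cmod (\<psi> t) \<le> (cmod (\<phi> t))\<^sup>2 + (cmod (\<psi> t))\<^sup>2" by linarith
    then show ?thesis by (simp add: norm_mult)
  qed
  then show "AE t in circ. norm (\<phi> t * cnj (\<psi> t)) \<le> norm ((cmod (\<phi> t))\<^sup>2 + (cmod (\<psi> t))\<^sup>2)" by simp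
qed

lemma L2inner_lebesgue:
  assumes "\<phi> \<in> sqint" "\<psi> \<in> sqint"
  shows "L2inner \<phi> \<psi> = (LINT t|circ. \<phi> t * cnj (\<psi> t)) / of_real (2*pi)"
  unfolding L2inner_def by (subst lebesgue_integral_eq_integral[OF integrable_mult_sqint[OF assms]]) auto

lemma integral_circ_eq: "integrable circ f \<Longrightarrow> integral {0..2*pi} f = (LINT t|circ. f t)"
  for f :: "real \<Rightarrow> 'a::euclidean_space"
  using lebesgue_integral_eq_integral[of "{0..2*pi}" f] by simp

lemma L2inner_self:
  assumes "\<phi> \<in> sqint"
  shows "L2inner \<phi> \<phi> = of_real ((l2n \<phi>)\<^sup>2)"
proof -
  have "(LINT t|circ. \<phi> t * cnj (\<phi> t)) = (LINT t|circ. of_real ((cmod (\<phi> t))\<^sup>2))"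
    by (simp only: complex_norm_square)
  also have "\<dots> = of_real (LINT t|circ. (cmod (\<phi> t))\<^sup>2)" by (rule integral_of_real[OF sqint_integrable[OF assms]])
  finally show ?thesis by (simp add: L2inner_lebesgue assms l2n_square)
qed

lemma sqint_add:
  assumes "\<phi> \<in> sqint" "\<psi> \<in> sqint"
  shows "(\<lambda>t. \<phi> t + \<psi> t) \<in> sqint"
proof -
  have m: "(\<lambda>t. \<phi> t + \<psi> t) \<in> borel_measurable circ" using assms[THEN sqint_measurable] by measurable
  have "integrable circ (\<lambda>t. (cmod (\<phi> t + \<psi> t))\<^sup>2)"
  proof (rule Bochner_Integration.integrable_bound)
    show "integrable circ (\<lambda>t. 2 * (cmod (\<phi> t))\<^sup>2 + 2 * (cmod (\<psi> t))\<^sup>2)"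
      using assms by (intro Bochner_Integration.integrable_add integrable_mult_right sqint_integrable)
    show "AE t in circ. norm ((cmod (\<phi> t + \<psi> t))\<^sup>2) \<le> norm (2 * (cmod (\<phi> t))\<^sup>2 + 2 * (cmod (\<psi> t))\<^sup>2)"
      using norm_add_square_le by (intro AE_I2) simp
  qed (use m in measurable)
  with m show ?thesis by (simp add: sqint_def)
qed

lemma sqint_mult_bounded:
  assumes "\<phi> \<in> sqint" and b: "b \<in> borel_measurable circ" "AE t in circ. cmod (b t) \<le> K"
  shows "(\<lambda>t. b t * \<phi> t) \<in> sqint"
proof -
  have m: "(\<lambda>t. b t * \<phi> t) \<in> borel_measurable circ" using assms(1)[THEN sqint_measurable] b by measurable
  have "integrable circ (\<lambda>t. (cmod (b t * \<phi> t))\<^sup>2)"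
  proof (rule Bochner_Integration.integrable_bound)
    show "integrable circ (\<lambda>t. K\<^sup>2 * (cmod (\<phi> t))\<^sup>2)"
      using assms by (intro integrable_mult_right sqint_integrable)
    show "AE t in circ. norm ((cmod (b t * \<phi> t))\<^sup>2) \<le> norm (K\<^sup>2 * (cmod (\<phi> t))\<^sup>2)"
      using b(2) by eventually_elim (auto simp: norm_mult power_mult_distrib intro!: mult_right_mono power_mono)
  qed (use m in measurable)
  with m show ?thesis by (simp add: sqint_def)
qed

lemma sqint_cmult: "\<phi> \<in> sqint \<Longrightarrow> (\<lambda>t. c * \<phi> t) \<in> sqint"
  by (rule sqint_mult_bounded[where K = "cmod c"]) auto

lemma sqint_diff: "\<phi> \<in> sqint \<Longrightarrow> \<psi> \<in> sqint \<Longrightarrow> (\<lambda>t. \<phi> t - \<psi> t) \<in> sqint"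
  using sqint_add[OF _ sqint_cmult[of \<psi> "-1"], of \<phi>] by simp

lemma sqint_zero: "(\<lambda>t. 0) \<in> sqint"
  by (simp add: sqint_def)

lemma sqint_sum: "(\<And>k. k \<in> A \<Longrightarrow> u k \<in> sqint) \<Longrightarrow> (\<lambda>t. \<Sum>k\<in>A. c k * u k t) \<in> sqint"
  by (induction A rule: infinite_finite_induct) (auto intro!: sqint_zero sqint_add sqint_cmult)

lemma sqint_continuous: "continuous_on {0..2*pi} \<phi> \<Longrightarrow> \<phi> \<in> sqint"
  unfolding sqint_def
  by (auto intro!: continuous_imp_measurable_on_sets_lebesgue absolutely_integrable_imp_integrable
      absolutely_integrable_continuous_real continuous_intros)

lemma measurable_circ_AE_cong:
  fixes \<phi> \<psi> :: "real \<Rightarrow> complex"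
  assumes "\<phi> \<in> borel_measurable circ" and ae: "AE t in circ. \<phi> t = \<psi> t"
  shows "\<psi> \<in> borel_measurable circ"
proof -
  have "(\<lambda>t. indicator {0..2*pi} t *\<^sub>R \<phi> t) \<in> borel_measurable lebesgue"
    using assms(1) borel_measurable_restrict_space_iff[of "{0..2*pi}" lebesgue \<phi>] by simp
  moreover have "AE t in lebesgue. indicator {0..2*pi} t *\<^sub>R \<phi> t = indicator {0..2*pi} t *\<^sub>R \<psi> t"
    using ae unfolding AE_restrict_space_iff[of "{0..2*pi}" lebesgue, simplified]
    by eventually_elim (auto simp: indicator_def)
  ultimately have "(\<lambda>t. indicator {0..2*pi} t *\<^sub>R \<psi> t) \<in> borel_measurable lebesgue"
    by (rule borel_measurable_AE)
  then show ?thesis using borel_measurable_restrict_space_iff[of "{0..2*pi}" lebesgue \<psi>] by simp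
qed

lemma sqint_AE_cong:
  assumes "\<phi> \<in> sqint" and ae: "AE t in circ. \<phi> t = \<psi> t"
  shows "\<psi> \<in> sqint"
proof -
  have m: "\<psi> \<in> borel_measurable circ" using assms measurable_circ_AE_cong sqint_measurable by blast
  have "integrable circ (\<lambda>t. (cmod (\<psi> t))\<^sup>2)"
  proof (rule Bochner_Integration.integrable_cong_AE_imp[OF sqint_integrable[OF assms(1)]])
    show "(\<lambda>t. (cmod (\<psi> t))\<^sup>2) \<in> borel_measurable circ" using m by measurable
    show "AE t in circ. (cmod (\<phi> t))\<^sup>2 = (cmod (\<psi> t))\<^sup>2" using ae by eventually_elim simp
  qed
  with m show ?thesis by (simp add: sqint_def)
qed

lemma L2inner_AE_cong:
  assumes "\<phi> \<in> sqint" "\<psi> \<in> sqint" "AE t in circ. \<phi> t * cnj (\<psi> t) = \<phi>' t * cnj (\<psi>' t)"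
    "\<phi>' \<in> sqint" "\<psi>' \<in> sqint"
  shows "L2inner \<phi> \<psi> = L2inner \<phi>' \<psi>'"
  using assms by (auto simp: L2inner_lebesgue intro!: integral_cong_AE integrable_mult_sqint borel_measurable_integrable)

lemma l2n_AE_cong:
  assumes "\<phi> \<in> sqint" "AE t in circ. \<phi> t = \<psi> t"
  shows "l2n \<psi> = l2n \<phi>"
proof -
  have "\<psi> \<in> sqint" using sqint_AE_cong assms by blast
  then have "(LINT t|circ. (cmod (\<psi> t))\<^sup>2) = (LINT t|circ. (cmod (\<phi> t))\<^sup>2)"
    using assms by (intro integral_cong_AE) (auto intro!: borel_measurable_integrable sqint_integrable)
  then show ?thesis by (simp add: l2n_def)
qed

lemma L2inner_add_left:
  "\<phi> \<in> sqint \<Longrightarrow> \<phi>' \<in> sqint \<Longrightarrow> \<psi> \<in> sqint \<Longrightarrow> L2inner (\<lambda>t. \<phi> t + \<phi>' t) \<psi> = L2inner \<phi> \<psi> + L2inner \<phi>' \<psi>"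
  using integrable_mult_sqint[of \<phi> \<psi>] integrable_mult_sqint[of \<phi>' \<psi>]
  by (simp add: L2inner_lebesgue sqint_add distrib_right add_divide_distrib)

lemma L2inner_cmult_left:
  "\<phi> \<in> sqint \<Longrightarrow> \<psi> \<in> sqint \<Longrightarrow> L2inner (\<lambda>t. c * \<phi> t) \<psi> = c * L2inner \<phi> \<psi>"
  by (simp add: L2inner_lebesgue sqint_cmult mult.assoc)

lemma L2inner_cnj: "L2inner \<psi> \<phi> = cnj (L2inner \<phi> \<psi>)"
  by (simp add: L2inner_def integral_cnj mult.commute)

lemma L2inner_diff_left:
  "\<phi> \<in> sqint \<Longrightarrow> \<phi>' \<in> sqint \<Longrightarrow> \<psi> \<in> sqint \<Longrightarrow> L2inner (\<lambda>t. \<phi> t - \<phi>' t) \<psi> = L2inner \<phi> \<psi> - L2inner \<phi>' \<psi>"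
  using L2inner_add_left[of \<phi> "\<lambda>t. -1 * \<phi>' t" \<psi>] L2inner_cmult_left[of \<phi>' \<psi> "-1"] sqint_cmult[of \<phi>' "-1"] by simp

lemma L2inner_zero_left [simp]: "L2inner (\<lambda>t. 0) \<psi> = 0"
  by (simp add: L2inner_def)

lemma L2inner_sum_left:
  assumes "\<And>k. k \<in> A \<Longrightarrow> u k \<in> sqint" "\<psi> \<in> sqint"
  shows "L2inner (\<lambda>t. \<Sum>k\<in>A. c k * u k t) \<psi> = (\<Sum>k\<in>A. c k * L2inner (u k) \<psi>)"
  using assms by (induction A rule: infinite_finite_induct)
    (simp_all add: L2inner_add_left L2inner_cmult_left sqint_cmult sqint_sum)

lemma L2inner_diff_right:
  "\<phi> \<in> sqint \<Longrightarrow> \<phi>' \<in> sqint \<Longrightarrow> \<psi> \<in> sqint \<Longrightarrow> L2inner \<psi> (\<lambda>t. \<phi> t - \<phi>' t) = L2inner \<psi> \<phi> - L2inner \<psi> \<phi>'"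
  using L2inner_diff_left[of \<phi> \<phi>' \<psi>] by (metis L2inner_cnj complex_cnj_diff)

lemma L2inner_sum_right:
  assumes "\<And>k. k \<in> A \<Longrightarrow> u k \<in> sqint" "\<psi> \<in> sqint"
  shows "L2inner \<psi> (\<lambda>t. \<Sum>k\<in>A. c k * u k t) = (\<Sum>k\<in>A. cnj (c k) * L2inner \<psi> (u k))"
proof -
  have "L2inner \<psi> (\<lambda>t. \<Sum>k\<in>A. c k * u k t) = cnj (\<Sum>k\<in>A. c k * L2inner (u k) \<psi>)"
    by (subst L2inner_cnj, subst L2inner_sum_left) (use assms in auto)
  then show ?thesis by (simp add: L2inner_cnj[of \<psi>])
qed

text \<open>Integrate |phi psi| <= (s |phi|^2 + |psi|^2 / s) / 2 and take s = (b+e)/(a+e), where a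
  and b are the two norms. The shift e > 0 keeps s positive and finite when a norm vanishes; then e
  tends to 0.\<close>

lemma L2inner_Cauchy_Schwarz:
  assumes "\<phi> \<in> sqint" "\<psi> \<in> sqint"
  shows "cmod (L2inner \<phi> \<psi>) \<le> l2n \<phi> * l2n \<psi>"
proof -
  define a b where "a = l2n \<phi>" and "b = l2n \<psi>"
  have ab: "a \<ge> 0" "b \<ge> 0" by (auto simp: a_def b_def)
  have S: "cmod (L2inner \<phi> \<psi>) \<le> (s * a\<^sup>2 + b\<^sup>2 / s) / 2" if s: "s > 0" for s
  proof -
    have i: "integrable circ (\<lambda>t. (s * (cmod (\<phi> t))\<^sup>2 + (cmod (\<psi> t))\<^sup>2 / s) / 2)"
      using assms by (intro integrable_divide Bochner_Integration.integrable_add integrable_mult_right sqint_integrable)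
    have "cmod (LINT t|circ. \<phi> t * cnj (\<psi> t)) \<le> (LINT t|circ. cmod (\<phi> t * cnj (\<psi> t)))"
      by (rule integral_norm_bound)
    also have "\<dots> \<le> (LINT t|circ. (s * (cmod (\<phi> t))\<^sup>2 + (cmod (\<psi> t))\<^sup>2 / s) / 2)"
    proof (rule integral_mono[OF _ i])
      show "integrable circ (\<lambda>t. cmod (\<phi> t * cnj (\<psi> t)))"
        by (intro integrable_norm integrable_mult_sqint assms)
      show "cmod (\<phi> t * cnj (\<psi> t)) \<le> (s * (cmod (\<phi> t))\<^sup>2 + (cmod (\<psi> t))\<^sup>2 / s) / 2" for t
        using sum_squares_bound[of "s * cmod (\<phi> t)" "cmod (\<psi> t)"] s
        by (simp add: norm_mult field_simps power2_eq_square)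
    qed
    also have "\<dots> = (s * (LINT t|circ. (cmod (\<phi> t))\<^sup>2) + (LINT t|circ. (cmod (\<psi> t))\<^sup>2) / s) / 2"
      using assms by (simp add: sqint_integrable)
    finally have "cmod (LINT t|circ. \<phi> t * cnj (\<psi> t)) / (2*pi) \<le>
        ((s * (LINT t|circ. (cmod (\<phi> t))\<^sup>2) + (LINT t|circ. (cmod (\<psi> t))\<^sup>2) / s) / 2) / (2*pi)"
      by (rule divide_right_mono) simp
    also have "\<dots> = (s * a\<^sup>2 + b\<^sup>2 / s) / 2"
      unfolding a_def b_def l2n_square using s by (simp add: field_simps)
    finally show ?thesis unfolding L2inner_lebesgue[OF assms] by (simp add: norm_divide norm_mult)
  qed
  have "cmod (L2inner \<phi> \<psi>) \<le> (a + e) * (b + e)" if e: "e > 0" for e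
  proof -
    have pos: "a + e > 0" "b + e > 0" using ab e by auto
    have "cmod (L2inner \<phi> \<psi>) \<le> ((b+e)/(a+e) * a\<^sup>2 + b\<^sup>2 / ((b+e)/(a+e))) / 2"
      using S[of "(b+e)/(a+e)"] pos by simp
    also have "\<dots> \<le> ((b+e)/(a+e) * (a+e)\<^sup>2 + (b+e)\<^sup>2 / ((b+e)/(a+e))) / 2"
      using pos ab e by (intro divide_right_mono add_mono mult_left_mono power_mono) auto
    also have "\<dots> = (a+e) * (b+e)" using pos by (simp add: power2_eq_square)
    finally show ?thesis .
  qed
  then have "\<forall>\<^sub>F e in at_right 0. cmod (L2inner \<phi> \<psi>) \<le> (a + e) * (b + e)"
    by (auto simp: eventually_at_right_less eventually_at_filter intro: always_eventually)
  moreover have "((\<lambda>e. (a + e) * (b + e)) \<longlongrightarrow> (a+0) * (b+0)) (at_right 0)"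
    by (intro tendsto_intros)
  ultimately have "cmod (L2inner \<phi> \<psi>) \<le> (a+0) * (b+0)"
    by (intro tendsto_lowerbound[where F = "at_right (0::real)"]) auto
  then show ?thesis by (simp add: a_def b_def)
qed

text \<open>Completing the square in the coefficients. With \<open>c\<close> the Fourier
  coefficients of phi the last sum vanishes, which is Bessel's inequality; with phi the combination
  itself the left side vanishes, which gives its norm.\<close>

lemma l2n_orthonormal_remainder:
  fixes N :: nat
  assumes u: "\<And>k. k < N \<Longrightarrow> u k \<in> sqint" and \<phi>: "\<phi> \<in> sqint"
    and on: "\<And>j k. j < N \<Longrightarrow> k < N \<Longrightarrow> L2inner (u j) (u k) = (if j = k then 1 else 0)"
  shows "(l2n (\<lambda>t. \<phi> t - (\<Sum>k<N. c k * u k t)))\<^sup>2 =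
    (l2n \<phi>)\<^sup>2 - (\<Sum>k<N. (cmod (L2inner \<phi> (u k)))\<^sup>2) + (\<Sum>k<N. (cmod (L2inner \<phi> (u k) - c k))\<^sup>2)"
proof -
  define p where "p t = (\<Sum>k<N. c k * u k t)" for t
  have p: "p \<in> sqint" unfolding p_def by (rule sqint_sum) (use u in auto)
  have pp: "L2inner p \<psi> = (\<Sum>k<N. c k * L2inner (u k) \<psi>)" if "\<psi> \<in> sqint" for \<psi>
    unfolding p_def by (rule L2inner_sum_left) (use u that in auto)
  have up: "L2inner (u j) p = cnj (c j)" if "j < N" for j
  proof -
    have "L2inner (u j) p = (\<Sum>k<N. cnj (c k) * L2inner (u j) (u k))"
      unfolding p_def by (rule L2inner_sum_right) (use u that in auto)
    also have "\<dots> = (\<Sum>k<N. if j = k then cnj (c k) else 0)"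
      by (rule sum.cong) (use on that in auto)
    also have "\<dots> = cnj (c j)" using that by (subst sum.delta') auto
    finally show ?thesis .
  qed
  have "of_real ((l2n (\<lambda>t. \<phi> t - p t))\<^sup>2) = L2inner (\<lambda>t. \<phi> t - p t) (\<lambda>t. \<phi> t - p t)"
    by (rule L2inner_self[symmetric]) (intro sqint_diff \<phi> p)
  also have "\<dots> = L2inner \<phi> \<phi> - L2inner p \<phi> - (L2inner \<phi> p - L2inner p p)"
    by (simp add: L2inner_diff_left L2inner_diff_right sqint_diff \<phi> p)
  also have "\<dots> = of_real ((l2n \<phi>)\<^sup>2) - (\<Sum>k<N. c k * cnj (L2inner \<phi> (u k))) -
      ((\<Sum>k<N. cnj (c k) * L2inner \<phi> (u k)) - (\<Sum>k<N. c k * cnj (c k)))"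
  proof -
    have "L2inner p \<phi> = (\<Sum>k<N. c k * cnj (L2inner \<phi> (u k)))"
      unfolding pp[OF \<phi>] by (simp flip: L2inner_cnj)
    moreover from this have "L2inner \<phi> p = (\<Sum>k<N. cnj (c k) * L2inner \<phi> (u k))"
      using L2inner_cnj[of \<phi> p] by simp
    moreover have "L2inner p p = (\<Sum>k<N. c k * cnj (c k))" unfolding pp[OF p] by (simp add: up)
    ultimately show ?thesis by (simp add: L2inner_self \<phi>)
  qed
  also have "\<dots> = of_real ((l2n \<phi>)\<^sup>2 - (\<Sum>k<N. (cmod (L2inner \<phi> (u k)))\<^sup>2) + (\<Sum>k<N. (cmod (L2inner \<phi> (u k) - c k))\<^sup>2))"
    unfolding of_real_diff of_real_add of_real_sum complex_norm_square
    by (simp add: sum_subtractf[symmetric] sum.distrib[symmetric] algebra_simps)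
  finally show ?thesis unfolding p_def of_real_eq_iff .
qed

lemma l2n_Bessel:
  fixes N :: nat
  assumes u: "\<And>k. k < N \<Longrightarrow> u k \<in> sqint" and \<phi>: "\<phi> \<in> sqint"
    and on: "\<And>j k. j < N \<Longrightarrow> k < N \<Longrightarrow> L2inner (u j) (u k) = (if j = k then 1 else 0)"
  shows "(\<Sum>k<N. (cmod (L2inner \<phi> (u k)))\<^sup>2) \<le> (l2n \<phi>)\<^sup>2"
proof -
  have "0 \<le> (l2n (\<lambda>t. \<phi> t - (\<Sum>k<N. L2inner \<phi> (u k) * u k t)))\<^sup>2" by simp
  then show ?thesis using l2n_orthonormal_remainder[OF assms, where c = "\<lambda>k. L2inner \<phi> (u k)"] by simp
qed

section \<open>The Hardy space as a Hilbert space\<close>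

lemma filterlim_radii: "filterlim (\<lambda>n. 1 - 1 / real (n+2)) (at_left 1) sequentially"
  by real_asymp

lemma continuous_circle_path:
  assumes "continuous_on (cball 0 1) S"
  shows "((\<lambda>r. S (of_real r * cis t)) \<longlongrightarrow> S (cis t)) (at_left 1)"
proof -
  have "continuous_on {0..1} (\<lambda>r. S (of_real r * cis t))"
    by (rule continuous_on_compose2[OF assms]) (auto intro!: continuous_intros simp: norm_mult)
  then have "((\<lambda>r. S (of_real r * cis t)) \<longlongrightarrow> S (of_real 1 * cis t)) (at 1 within {0..1})"
    unfolding continuous_on_def by (metis atLeastAtMost_iff order_refl zero_le_one)
  then show ?thesis by (simp add: at_within_Icc_at_left)
qed

lemma bdry_continuous:
  "continuous_on (cball 0 1) S \<Longrightarrow> bdry S t = S (cis t)"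
  by (intro bdryI continuous_circle_path)

text \<open>Fatou's lemma along the radii 1 - 1/(n+2), with the circle means of f minus its Taylor
  polynomial bounded by \<open>taylor_tail\<close>. An inequality suffices: as \<open>N\<close>
  grows it says that Taylor polynomials converge to \<open>bdry f\<close> in L^2, and this
  determines all inner products. The case N = 0 gives square integrability.\<close>

lemma
  assumes f: "f \<in> H2"
  shows bdry_sqint: "bdry f \<in> sqint"
    and l2n_bdry_tail: "(l2n (\<lambda>t. bdry f t - (\<Sum>n<N. taylor f n * cis (real n * t))))\<^sup>2 \<le> taylor_tail f N"
proof -
  define r where "r n = 1 - 1 / real (n+2)" for n
  have r: "0 \<le> r n" "r n < 1" for n by (auto simp: r_def field_simps)
  have c: "continuous_on {0..2*pi} (\<lambda>t. f (of_real (r n) * cis t))" for n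
    using r[of n] by (intro continuous_on_circle H2_holomorphic f) auto
  have lim: "AE t in circ. (\<lambda>n. f (of_real (r n) * cis t)) \<longlonglongrightarrow> bdry f t"
    using AE_bdry[OF f]
  proof eventually_elim
    case (elim t)
    then show ?case unfolding r_def by (rule filterlim_compose[OF _ filterlim_radii])
  qed
  have "(\<lambda>t. lim (\<lambda>n. f (of_real (r n) * cis t))) \<in> borel_measurable circ"
    by (intro borel_measurable_lim_metric continuous_imp_measurable_on_sets_lebesgue c) auto
  moreover have "AE t in circ. lim (\<lambda>n. f (of_real (r n) * cis t)) = bdry f t"
    using lim by eventually_elim (rule limI)
  ultimately have m: "bdry f \<in> borel_measurable circ" by (rule measurable_circ_AE_cong)
  have *: "(\<lambda>t. bdry f t - (\<Sum>n<N. taylor f n * cis (real n * t))) \<in> sqint \<and>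
     (l2n (\<lambda>t. bdry f t - (\<Sum>n<N. taylor f n * cis (real n * t))))\<^sup>2 \<le> taylor_tail f N" for N
  proof -
    define S where "S z = (\<Sum>n<N. taylor f n * z ^ n)" for z
    have S_cis: "S (cis t) = (\<Sum>n<N. taylor f n * cis (real n * t))" for t
      unfolding S_def by (simp only: Complex.DeMoivre)
    have cS: "continuous_on A S" for A unfolding S_def by (intro continuous_intros)
    define p where "p t = bdry f t - S (cis t)" for t
    have pm: "p \<in> borel_measurable circ" unfolding p_def
      by (intro borel_measurable_diff m continuous_imp_measurable_on_sets_lebesgue continuous_on_compose2[OF cS])
         (auto intro!: continuous_intros)
    define q where "q n t = (cmod (f (of_real (r n) * cis t) - S (of_real (r n) * cis t)))\<^sup>2" for n t
    have cq: "continuous_on {0..2*pi} (q n)" for n unfolding q_def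
      by (intro continuous_intros c continuous_on_compose2[OF cS]) auto
    have iq: "integrable circ (q n)" for n
      by (intro absolutely_integrable_imp_integrable absolutely_integrable_continuous_real cq) auto
    have bq: "(\<integral>\<^sup>+ t. ennreal (q n t) \<partial>circ) \<le> ennreal (2*pi * taylor_tail f N)" for n
    proof -
      have "(\<integral>\<^sup>+ t. ennreal (q n t) \<partial>circ) = ennreal (LINT t|circ. q n t)"
        by (rule nn_integral_eq_integral[OF iq]) (simp add: q_def)
      also have "(LINT t|circ. q n t) = integral {0..2*pi} (q n)"
        by (rule integral_circ_eq[OF iq, symmetric])
      also have "integral {0..2*pi} (q n) \<le> 2*pi * taylor_tail f N"
        using circle_mean_tail_le[OF f r, of n N] unfolding q_def S_def by (simp add: field_simps)
      finally show ?thesis using ennreal_leI by blast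
    qed
    have ae: "AE t in circ. ennreal ((cmod (p t))\<^sup>2) = liminf (\<lambda>n. ennreal (q n t))"
      using lim
    proof eventually_elim
      case (elim t)
      have "((\<lambda>\<rho>. S (of_real \<rho> * cis t)) \<longlongrightarrow> S (cis t)) (at_left 1)" by (intro continuous_circle_path cS)
      then have "(\<lambda>n. S (of_real (r n) * cis t)) \<longlonglongrightarrow> S (cis t)"
        unfolding r_def by (rule filterlim_compose[OF _ filterlim_radii])
      then have "(\<lambda>n. ennreal (q n t)) \<longlonglongrightarrow> ennreal ((cmod (p t))\<^sup>2)"
        unfolding q_def p_def by (intro tendsto_intros elim)
      then show ?case by (simp add: lim_imp_Liminf)
    qed
    have "(\<integral>\<^sup>+ t. ennreal ((cmod (p t))\<^sup>2) \<partial>circ) = (\<integral>\<^sup>+ t. liminf (\<lambda>n. ennreal (q n t)) \<partial>circ)"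
      by (rule nn_integral_cong_AE[OF ae])
    also have "\<dots> \<le> liminf (\<lambda>n. \<integral>\<^sup>+ t. ennreal (q n t) \<partial>circ)"
      using borel_measurable_integrable[OF iq] by (intro nn_integral_liminf) measurable
    also have "\<dots> \<le> ennreal (2*pi * taylor_tail f N)"
      using bq by (intro Liminf_le) (auto intro!: always_eventually)
    finally have fin: "(\<integral>\<^sup>+ t. ennreal ((cmod (p t))\<^sup>2) \<partial>circ) \<le> ennreal (2*pi * taylor_tail f N)" .
    have ip: "integrable circ (\<lambda>t. (cmod (p t))\<^sup>2)"
      by (rule integrableI_nonneg) (use pm fin in \<open>auto intro: le_less_trans\<close>)
    then have "(\<integral>\<^sup>+ t. ennreal ((cmod (p t))\<^sup>2) \<partial>circ) = ennreal (LINT t|circ. (cmod (p t))\<^sup>2)"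
      by (intro nn_integral_eq_integral) auto
    with fin have "(LINT t|circ. (cmod (p t))\<^sup>2) \<le> 2*pi * taylor_tail f N"
      using taylor_tail_nonneg[OF f, of N] by (simp add: ennreal_le_iff)
    then have "(l2n p)\<^sup>2 \<le> taylor_tail f N" by (simp add: l2n_square field_simps)
    then show ?thesis using pm ip by (simp add: sqint_def p_def[abs_def] S_cis[symmetric])
  qed
  show "bdry f \<in> sqint" using *[of 0] by simp
  show "(l2n (\<lambda>t. bdry f t - (\<Sum>n<N. taylor f n * cis (real n * t))))\<^sup>2 \<le> taylor_tail f N" using * by simp
qed

lemma H2norm_l2n: "f \<in> H2 \<Longrightarrow> H2norm f = l2n (bdry f)"
  unfolding H2norm_def l2n_def by (subst integral_circ_eq[OF sqint_integrable[OF bdry_sqint]]) auto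

section \<open>Algebraic closure of H^2 and almost everywhere rules for boundary values\<close>

lemma H2_cong:
  assumes "f \<in> H2" "\<And>z. cmod z < 1 \<Longrightarrow> g z = f z"
  shows "g \<in> H2"
proof -
  have "g holomorphic_on ball 0 1"
    using H2_holomorphic[OF assms(1)] assms(2) by (metis holomorphic_transform mem_ball_0)
  moreover have "g (of_real r * cis t) = f (of_real r * cis t)" if "0 \<le> r" "r < 1" for r t
    using that by (intro assms(2)) (simp add: norm_mult)
  ultimately show ?thesis using assms(1) unfolding H2_def by auto
qed

lemma bdry_cong:
  assumes "\<And>z. cmod z < 1 \<Longrightarrow> g z = f z"
  shows "bdry g = bdry f"
proof
  fix t
  have ev: "\<forall>\<^sub>F r in at_left 1. g (of_real r * cis t) = f (of_real r * cis t)"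
    using eventually_radius by eventually_elim (auto intro!: assms simp: norm_mult)
  have "((\<lambda>r. g (of_real r * cis t)) \<longlongrightarrow> L) (at_left 1) = ((\<lambda>r. f (of_real r * cis t)) \<longlongrightarrow> L) (at_left 1)" for L
    by (rule tendsto_cong[OF ev])
  then show "bdry g t = bdry f t" by (simp add: bdry_def Topological_Spaces.Lim_def)
qed

lemma taylor_add:
  "f holomorphic_on ball 0 1 \<Longrightarrow> g holomorphic_on ball 0 1 \<Longrightarrow> taylor (\<lambda>z. f z + g z) = (\<lambda>n. taylor f n + taylor g n)"
  by (rule taylor_unique) (auto intro!: holomorphic_intros sums_add taylor_sums simp: distrib_right)

lemma taylor_cmult:
  "f holomorphic_on ball 0 1 \<Longrightarrow> taylor (\<lambda>z. c * f z) = (\<lambda>n. c * taylor f n)"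
  by (rule taylor_unique) (auto intro!: holomorphic_intros sums_mult taylor_sums simp: mult.assoc)

lemma taylor_diff:
  "f holomorphic_on ball 0 1 \<Longrightarrow> g holomorphic_on ball 0 1 \<Longrightarrow> taylor (\<lambda>z. f z - g z) = (\<lambda>n. taylor f n - taylor g n)"
  by (rule taylor_unique) (auto intro!: holomorphic_intros sums_diff taylor_sums simp: left_diff_distrib)

lemma H2_bounded_mult:
  assumes b: "b holomorphic_on ball 0 1" "\<And>z. cmod z < 1 \<Longrightarrow> cmod (b z) \<le> K" and f: "f \<in> H2"
  shows "(\<lambda>z. b z * f z) \<in> H2"
proof -
  have hf: "f holomorphic_on ball 0 1" by (rule H2_holomorphic[OF f])
  then have h: "(\<lambda>z. b z * f z) holomorphic_on ball 0 1" by (intro holomorphic_intros b)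
  obtain C where C: "\<And>r. 0 \<le> r \<Longrightarrow> r < 1 \<Longrightarrow> circle_mean f r \<le> C"
    using f by (auto simp: H2_def)
  have "integral {0..2*pi} (\<lambda>t. (cmod (b (of_real r * cis t) * f (of_real r * cis t)))\<^sup>2) / (2*pi) \<le> K\<^sup>2 * C"
    if r: "0 \<le> r" "r < 1" for r
  proof -
    have "integral {0..2*pi} (\<lambda>t. (cmod (b (of_real r * cis t) * f (of_real r * cis t)))\<^sup>2) \<le>
       integral {0..2*pi} (\<lambda>t. K\<^sup>2 * (cmod (f (of_real r * cis t)))\<^sup>2)"
    proof (rule integral_le)
      show "(cmod (b (of_real r * cis t) * f (of_real r * cis t)))\<^sup>2 \<le> K\<^sup>2 * (cmod (f (of_real r * cis t)))\<^sup>2" for t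
        using b(2)[of "of_real r * cis t"] r
        by (auto simp: norm_mult power_mult_distrib intro!: mult_right_mono power_mono)
    qed (use r in \<open>auto intro!: integrable_continuous_interval continuous_intros continuous_on_circle[OF b(1)] continuous_on_circle[OF hf]\<close>)
    also have "\<dots> = K\<^sup>2 * integral {0..2*pi} (\<lambda>t. (cmod (f (of_real r * cis t)))\<^sup>2)" by simp
    finally have "integral {0..2*pi} (\<lambda>t. (cmod (b (of_real r * cis t) * f (of_real r * cis t)))\<^sup>2) / (2*pi)
        \<le> K\<^sup>2 * circle_mean f r"
      by (simp add: divide_right_mono)
    also have "\<dots> \<le> K\<^sup>2 * C" using C[OF r] by (intro mult_left_mono) auto
    finally show ?thesis .
  qed
  then show ?thesis using h by (auto simp: H2_def)
qed

lemma H2_one: "(\<lambda>z. 1) \<in> H2"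
  unfolding H2_def by (auto intro!: exI[of _ 1])

lemma H2_bounded:
  "b holomorphic_on ball 0 1 \<Longrightarrow> (\<And>z. cmod z < 1 \<Longrightarrow> cmod (b z) \<le> K) \<Longrightarrow> b \<in> H2"
  using H2_bounded_mult[OF _ _ H2_one, of b K] by simp

lemma H2_cmult: "f \<in> H2 \<Longrightarrow> (\<lambda>z. c * f z) \<in> H2"
  by (rule H2_bounded_mult[where K = "cmod c"]) auto

lemma H2_zero: "(\<lambda>z. 0) \<in> H2"
  using H2_cmult[OF H2_one, of 0] by simp

lemma H2_add:
  assumes "f \<in> H2" "g \<in> H2"
  shows "(\<lambda>z. f z + g z) \<in> H2"
proof -
  note h = assms[THEN H2_holomorphic]
  have "summable (\<lambda>n. (cmod (taylor f n + taylor g n))\<^sup>2)"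
  proof (rule summable_comparison_test')
    show "summable (\<lambda>n. 2 * (cmod (taylor f n))\<^sup>2 + 2 * (cmod (taylor g n))\<^sup>2)"
      by (intro summable_add summable_mult H2_summable assms)
    show "norm ((cmod (taylor f n + taylor g n))\<^sup>2) \<le> 2 * (cmod (taylor f n))\<^sup>2 + 2 * (cmod (taylor g n))\<^sup>2" if "0 \<le> n" for n
      using norm_add_square_le[of "taylor f n" "taylor g n"] by simp
  qed
  then show ?thesis
    using H2_iff_summable_taylor[of "\<lambda>z. f z + g z"] h by (simp add: taylor_add holomorphic_on_add)
qed

lemma H2_diff: "f \<in> H2 \<Longrightarrow> g \<in> H2 \<Longrightarrow> (\<lambda>z. f z - g z) \<in> H2"
  using H2_add[OF _ H2_cmult[of g "-1"], of f] by simp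

lemma H2_sum: "(\<And>k. k \<in> A \<Longrightarrow> u k \<in> H2) \<Longrightarrow> (\<lambda>z. \<Sum>k\<in>A. c k * u k z) \<in> H2"
  by (induction A rule: infinite_finite_induct) (auto intro!: H2_zero H2_add H2_cmult)

lemma AE_bdry_diff:
  "f \<in> H2 \<Longrightarrow> g \<in> H2 \<Longrightarrow> AE t in circ. bdry f t - bdry g t = bdry (\<lambda>z. f z - g z) t"
  using AE_bdry[of f] AE_bdry[of g] by (auto elim!: eventually_elim2 intro!: bdryI[symmetric] tendsto_diff)

lemma AE_bdry_mult:
  "f \<in> H2 \<Longrightarrow> g \<in> H2 \<Longrightarrow> AE t in circ. bdry f t * bdry g t = bdry (\<lambda>z. f z * g z) t"
  using AE_bdry[of f] AE_bdry[of g] by (auto elim!: eventually_elim2 intro!: bdryI[symmetric] tendsto_mult)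

lemma AE_bdry_sum:
  assumes "\<And>k. k \<in> A \<Longrightarrow> u k \<in> H2"
  shows "AE t in circ. (\<Sum>k\<in>A. c k * bdry (u k) t) = bdry (\<lambda>z. \<Sum>k\<in>A. c k * u k z) t"
proof (cases "finite A")
  case True
  then have "AE t in circ. \<forall>k\<in>A. ((\<lambda>r. u k (of_real r * cis t)) \<longlongrightarrow> bdry (u k) t) (at_left 1)"
    using assms AE_bdry by (simp add: AE_finite_all)
  then show ?thesis
    by eventually_elim (auto intro!: bdryI[symmetric] tendsto_sum tendsto_mult)
next
  case False
  then show ?thesis using bdry_continuous[of "\<lambda>_. 0"] by (auto intro!: always_eventually)
qed

lemma AE_norm_bdry_le:
  assumes "f \<in> H2" "\<And>z. cmod z < 1 \<Longrightarrow> cmod (f z) \<le> K"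
  shows "AE t in circ. cmod (bdry f t) \<le> K"
  using AE_bdry[OF assms(1)]
proof eventually_elim
  case (elim t)
  show ?case
  proof (rule tendsto_upperbound[OF tendsto_norm[OF elim]])
    show "\<forall>\<^sub>F r in at_left 1. cmod (f (of_real r * cis t)) \<le> K"
      using eventually_radius by eventually_elim (auto intro!: assms simp: norm_mult)
  qed simp
qed

section \<open>The boundary inner product expressed by Taylor coefficients\<close>

definition hin :: "(complex \<Rightarrow> complex) \<Rightarrow> (complex \<Rightarrow> complex) \<Rightarrow> complex" where
  "hin f g = L2inner (bdry f) (bdry g)"

lemma L2inner_cis_cis:
  "L2inner (\<lambda>t. cis (real n * t)) (\<lambda>t. cis (real m * t)) = (if n = m then 1 else 0)"
proof -
  have "cis (real n * t) * cnj (cis (real m * t)) = cis (of_int (int n - int m) * t)" for t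
    by (simp add: cis_cnj cis_mult algebra_simps)
  then have "integral {0..2*pi} (\<lambda>t. cis (real n * t) * cnj (cis (real m * t))) = (if int n - int m = 0 then of_real (2*pi) else 0)"
    using has_integral_cis_multiple[of "int n - int m"] by (simp only: integral_unique)
  then show ?thesis by (simp add: L2inner_def)
qed

lemma cis_sqint: "(\<lambda>t. cis (real n * t)) \<in> sqint"
  by (intro sqint_continuous continuous_intros)

text \<open>Taylor polynomials converge to \<open>bdry g\<close> in L^2, and pairing with phi is
  continuous by Cauchy-Schwarz. Here phi need not come from H^2, which the construction of the Szego
  projection requires.\<close>

lemma L2inner_bdry_sums:
  assumes \<phi>: "\<phi> \<in> sqint" and g: "g \<in> H2"
  shows "(\<lambda>n. cnj (taylor g n) * L2inner \<phi> (\<lambda>t. cis (real n * t))) sums L2inner \<phi> (bdry g)"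
proof -
  define S where "S N t = (\<Sum>n<N. taylor g n * cis (real n * t))" for N t
  have S: "S N \<in> sqint" for N unfolding S_def by (intro sqint_sum cis_sqint)
  have LS: "L2inner \<phi> (S N) = (\<Sum>n<N. cnj (taylor g n) * L2inner \<phi> (\<lambda>t. cis (real n * t)))" for N
    unfolding S_def by (intro L2inner_sum_right cis_sqint \<phi>)
  have "(\<lambda>N. L2inner \<phi> (bdry g) - L2inner \<phi> (S N)) \<longlonglongrightarrow> 0"
  proof (rule Lim_null_comparison)
    show "\<forall>\<^sub>F N in sequentially. norm (L2inner \<phi> (bdry g) - L2inner \<phi> (S N)) \<le> l2n \<phi> * sqrt (taylor_tail g N)"
    proof (intro always_eventually allI)
      fix N
      have "L2inner \<phi> (bdry g) - L2inner \<phi> (S N) = L2inner \<phi> (\<lambda>t. bdry g t - S N t)"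
        using \<phi> S bdry_sqint[OF g] by (simp add: L2inner_diff_right)
      also have "cmod \<dots> \<le> l2n \<phi> * l2n (\<lambda>t. bdry g t - S N t)"
        by (intro L2inner_Cauchy_Schwarz \<phi> sqint_diff bdry_sqint g S)
      also have "l2n (\<lambda>t. bdry g t - S N t) \<le> sqrt (taylor_tail g N)"
        by (rule real_le_rsqrt) (use l2n_bdry_tail[OF g, of N] in \<open>simp add: S_def\<close>)
      finally show "norm (L2inner \<phi> (bdry g) - L2inner \<phi> (S N)) \<le> l2n \<phi> * sqrt (taylor_tail g N)"
        by (simp add: mult_left_mono)
    qed
    have "(\<lambda>N. l2n \<phi> * sqrt (taylor_tail g N)) \<longlonglongrightarrow> l2n \<phi> * sqrt 0"
      by (intro tendsto_intros taylor_tail_tendsto g)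
    then show "(\<lambda>N. l2n \<phi> * sqrt (taylor_tail g N)) \<longlonglongrightarrow> 0" by simp
  qed
  then have "(\<lambda>N. L2inner \<phi> (bdry g) - (L2inner \<phi> (bdry g) - L2inner \<phi> (S N))) \<longlonglongrightarrow> L2inner \<phi> (bdry g) - 0"
    by (intro tendsto_intros)
  then show ?thesis by (simp add: sums_def LS)
qed

lemma L2inner_bdry_cis:
  assumes "f \<in> H2"
  shows "L2inner (bdry f) (\<lambda>t. cis (real n * t)) = taylor f n"
proof -
  have "(\<lambda>m. cnj (taylor f m) * L2inner (\<lambda>t. cis (real n * t)) (\<lambda>t. cis (real m * t))) sums L2inner (\<lambda>t. cis (real n * t)) (bdry f)"
    by (rule L2inner_bdry_sums[OF cis_sqint assms])
  moreover have "(\<lambda>m. cnj (taylor f m) * L2inner (\<lambda>t. cis (real n * t)) (\<lambda>t. cis (real m * t))) =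
      (\<lambda>m. if m = n then cnj (taylor f m) else 0)" by (auto simp: L2inner_cis_cis)
  ultimately have "L2inner (\<lambda>t. cis (real n * t)) (bdry f) = cnj (taylor f n)"
    using sums_single[of n "\<lambda>m. cnj (taylor f m)"] sums_unique2 by metis
  then show ?thesis by (subst L2inner_cnj) simp
qed

text \<open>From here on, linearity of \<open>hin\<close> is read off from coefficients, with no
  need for almost everywhere identities between boundary functions.\<close>

lemma hin_sums:
  assumes "f \<in> H2" "g \<in> H2"
  shows "(\<lambda>n. taylor f n * cnj (taylor g n)) sums hin f g"
  using L2inner_bdry_sums[OF bdry_sqint[OF assms(1)] assms(2)] L2inner_bdry_cis[OF assms(1)]
  by (simp add: hin_def mult.commute)

lemma hin_cnj: "hin g f = cnj (hin f g)"
  unfolding hin_def by (rule L2inner_cnj)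

lemma hin_add_left:
  assumes "f \<in> H2" "g \<in> H2" "k \<in> H2"
  shows "hin (\<lambda>z. f z + g z) k = hin f k + hin g k"
proof -
  have "(\<lambda>n. taylor f n * cnj (taylor k n) + taylor g n * cnj (taylor k n)) sums (hin f k + hin g k)"
    by (intro sums_add hin_sums assms)
  moreover have "(\<lambda>n. taylor f n * cnj (taylor k n) + taylor g n * cnj (taylor k n)) sums hin (\<lambda>z. f z + g z) k"
    using hin_sums[OF H2_add[OF assms(1,2)] assms(3)] assms[THEN H2_holomorphic] by (simp add: taylor_add distrib_right)
  ultimately show ?thesis using sums_unique2 by blast
qed

lemma hin_cmult_left:
  assumes "f \<in> H2" "k \<in> H2"
  shows "hin (\<lambda>z. c * f z) k = c * hin f k"
proof -
  have "(\<lambda>n. c * (taylor f n * cnj (taylor k n))) sums (c * hin f k)"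
    by (intro sums_mult hin_sums assms)
  moreover have "(\<lambda>n. c * (taylor f n * cnj (taylor k n))) sums hin (\<lambda>z. c * f z) k"
    using hin_sums[OF H2_cmult[OF assms(1)] assms(2)] assms[THEN H2_holomorphic] by (simp add: taylor_cmult mult.assoc)
  ultimately show ?thesis using sums_unique2 by blast
qed

lemma hin_diff_left:
  "f \<in> H2 \<Longrightarrow> g \<in> H2 \<Longrightarrow> k \<in> H2 \<Longrightarrow> hin (\<lambda>z. f z - g z) k = hin f k - hin g k"
  using hin_add_left[of f "\<lambda>z. -1 * g z" k] hin_cmult_left[of g k "-1"] H2_cmult[of g "-1"] by simp

lemma hin_zero_left: "hin (\<lambda>z. 0) k = 0"
  using bdry_continuous[of "\<lambda>_. 0"] by (simp add: hin_def L2inner_def)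

lemma hin_sum_left:
  "(\<And>j. j \<in> A \<Longrightarrow> u j \<in> H2) \<Longrightarrow> k \<in> H2 \<Longrightarrow> hin (\<lambda>z. \<Sum>j\<in>A. c j * u j z) k = (\<Sum>j\<in>A. c j * hin (u j) k)"
  by (induction A rule: infinite_finite_induct)
     (simp_all add: hin_zero_left hin_add_left hin_cmult_left H2_cmult H2_sum)

lemma hin_add_right: "f \<in> H2 \<Longrightarrow> g \<in> H2 \<Longrightarrow> k \<in> H2 \<Longrightarrow> hin k (\<lambda>z. f z + g z) = hin k f + hin k g"
  using hin_add_left[of f g k] hin_cnj[of k] by simp

lemma hin_diff_right: "f \<in> H2 \<Longrightarrow> g \<in> H2 \<Longrightarrow> k \<in> H2 \<Longrightarrow> hin k (\<lambda>z. f z - g z) = hin k f - hin k g"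
  using hin_diff_left[of f g k] hin_cnj[of k] by simp

lemma hin_cmult_right: "f \<in> H2 \<Longrightarrow> k \<in> H2 \<Longrightarrow> hin k (\<lambda>z. c * f z) = cnj c * hin k f"
  using hin_cmult_left[of f k c] hin_cnj[of k] by simp

lemma hin_cong:
  "(\<And>z. cmod z < 1 \<Longrightarrow> f z = f' z) \<Longrightarrow> (\<And>z. cmod z < 1 \<Longrightarrow> g z = g' z) \<Longrightarrow> hin f g = hin f' g'"
  unfolding hin_def using bdry_cong[of f f'] bdry_cong[of g g'] by simp

lemma hin_self: "f \<in> H2 \<Longrightarrow> hin f f = of_real ((H2norm f)\<^sup>2)"
  by (simp add: hin_def L2inner_self bdry_sqint H2norm_l2n)

lemma hin_Cauchy_Schwarz: "f \<in> H2 \<Longrightarrow> g \<in> H2 \<Longrightarrow> cmod (hin f g) \<le> H2norm f * H2norm g"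
  by (simp add: hin_def H2norm_l2n L2inner_Cauchy_Schwarz bdry_sqint)

lemma H2norm_nonneg [simp]: "H2norm f \<ge> 0"
proof (cases "(\<lambda>t. (cmod (bdry f t))\<^sup>2) integrable_on {0..2*pi}")
  case True
  then show ?thesis unfolding H2norm_def by (simp add: Henstock_Kurzweil_Integration.integral_nonneg)
next
  case False
  then show ?thesis unfolding H2norm_def by (simp add: not_integrable_integral)
qed

lemma H2norm_cong: "(\<And>z. cmod z < 1 \<Longrightarrow> f z = g z) \<Longrightarrow> H2norm f = H2norm g"
  unfolding H2norm_def using bdry_cong[of f g] by simp

lemma H2norm_square_sums:
  assumes "f \<in> H2"
  shows "(\<lambda>n. (cmod (taylor f n))\<^sup>2) sums (H2norm f)\<^sup>2"
proof -
  have "(\<lambda>n. of_real ((cmod (taylor f n))\<^sup>2) :: complex) sums of_real ((H2norm f)\<^sup>2)"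
    using hin_sums[OF assms assms] hin_self[OF assms] by (simp only: complex_norm_square)
  then show ?thesis by (simp only: sums_of_real_iff)
qed

lemma H2norm_cmult: "f \<in> H2 \<Longrightarrow> H2norm (\<lambda>z. c * f z) = cmod c * H2norm f"
proof -
  assume f: "f \<in> H2"
  have "(\<lambda>n. (cmod c)\<^sup>2 * (cmod (taylor f n))\<^sup>2) sums (H2norm (\<lambda>z. c * f z))\<^sup>2"
    using H2norm_square_sums[OF H2_cmult[OF f, of c]] by (simp add: taylor_cmult H2_holomorphic[OF f] norm_mult power_mult_distrib)
  then have "(H2norm (\<lambda>z. c * f z))\<^sup>2 = (cmod c * H2norm f)\<^sup>2"
    using sums_mult[OF H2norm_square_sums[OF f], of "(cmod c)\<^sup>2"] sums_unique2 by (simp add: power_mult_distrib) blast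
  then show ?thesis by (simp add: power2_eq_iff_nonneg)
qed

lemma H2norm_add_le:
  assumes "f \<in> H2" "g \<in> H2"
  shows "H2norm (\<lambda>z. f z + g z) \<le> H2norm f + H2norm g"
proof -
  have "of_real ((H2norm (\<lambda>z. f z + g z))\<^sup>2) = hin f f + hin f g + (hin g f + hin g g)"
    using assms by (simp del: of_real_power add: hin_self[symmetric] H2_add hin_add_left hin_add_right)
  then have "(H2norm (\<lambda>z. f z + g z))\<^sup>2 = cmod (hin f f + hin f g + (hin g f + hin g g))"
    by (metis abs_of_nonneg norm_of_real zero_le_power2)
  also have "\<dots> \<le> cmod (hin f f) + cmod (hin f g) + (cmod (hin g f) + cmod (hin g g))"
    by (intro order_trans[OF norm_triangle_ineq] add_mono norm_triangle_ineq)
  also have "\<dots> \<le> H2norm f * H2norm f + H2norm f * H2norm g + (H2norm g * H2norm f + H2norm g * H2norm g)"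
    by (intro add_mono hin_Cauchy_Schwarz assms)
  also have "\<dots> = (H2norm f + H2norm g)\<^sup>2" by (simp add: power2_eq_square algebra_simps)
  finally show ?thesis by (rule power2_le_imp_le) simp
qed

lemma H2norm_minus_commute: "f \<in> H2 \<Longrightarrow> g \<in> H2 \<Longrightarrow> H2norm (\<lambda>z. f z - g z) = H2norm (\<lambda>z. g z - f z)"
  using H2norm_cmult[OF H2_diff[of g f], of "-1"] by simp

lemma H2norm_triangle_sub:
  "f \<in> H2 \<Longrightarrow> g \<in> H2 \<Longrightarrow> H2norm f \<le> H2norm g + H2norm (\<lambda>z. f z - g z)"
  using H2norm_add_le[of g "\<lambda>z. f z - g z"] H2_diff[of f g] by simp

lemma H2norm_triangle_dist:
  "f \<in> H2 \<Longrightarrow> g \<in> H2 \<Longrightarrow> k \<in> H2 \<Longrightarrow> H2norm (\<lambda>z. f z - k z) \<le> H2norm (\<lambda>z. f z - g z) + H2norm (\<lambda>z. g z - k z)"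
  using H2norm_add_le[of "\<lambda>z. f z - g z" "\<lambda>z. g z - k z"] H2_diff[of f g] H2_diff[of g k] by simp

lemma hin_tendsto_left:
  assumes "\<And>n. fs n \<in> H2" "f \<in> H2" "u \<in> H2" and lim: "(\<lambda>n. H2norm (\<lambda>z. fs n z - f z)) \<longlonglongrightarrow> 0"
  shows "(\<lambda>n. hin (fs n) u) \<longlonglongrightarrow> hin f u"
proof -
  have "(\<lambda>n. hin (fs n) u - hin f u) \<longlonglongrightarrow> 0"
  proof (rule Lim_null_comparison)
    show "\<forall>\<^sub>F n in sequentially. norm (hin (fs n) u - hin f u) \<le> H2norm (\<lambda>z. fs n z - f z) * H2norm u"
      using hin_Cauchy_Schwarz[OF H2_diff[OF assms(1,2)] assms(3)]
      by (intro always_eventually allI) (simp add: hin_diff_left assms)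
    show "(\<lambda>n. H2norm (\<lambda>z. fs n z - f z) * H2norm u) \<longlonglongrightarrow> 0"
      using tendsto_mult_right[OF lim, of "H2norm u"] by simp
  qed
  then show ?thesis by (simp add: LIM_zero_iff)
qed

section \<open>Szego kernels, completeness of H^2 and the Szego projection\<close>

definition kern :: "complex \<Rightarrow> complex \<Rightarrow> complex" where
  "kern z w = 1 / (1 - cnj z * w)"

lemma kern_denom: 
  assumes "cmod z < 1" "cmod w \<le> 1"
  shows "cmod (1 - cnj z * w) \<ge> 1 - cmod z" "1 - cnj z * w \<noteq> 0"
proof -
  have "cmod (cnj z * w) \<le> cmod z" using assms by (simp add: norm_mult mult_left_le)
  then show *: "cmod (1 - cnj z * w) \<ge> 1 - cmod z"
    using norm_triangle_ineq2[of 1 "cnj z * w"] by simp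
  show "1 - cnj z * w \<noteq> 0" using * assms by auto
qed

lemma kern_bound: "cmod z < 1 \<Longrightarrow> cmod w \<le> 1 \<Longrightarrow> cmod (kern z w) \<le> 1 / (1 - cmod z)"
  using kern_denom[of z w] by (simp add: kern_def norm_divide frac_le)

lemma kern_holomorphic: "cmod z < 1 \<Longrightarrow> kern z holomorphic_on ball 0 1"
  unfolding kern_def[abs_def] by (intro holomorphic_intros) (use kern_denom in auto)

lemma kern_continuous: "cmod z < 1 \<Longrightarrow> continuous_on (cball 0 1) (kern z)"
  unfolding kern_def[abs_def] by (intro continuous_intros) (use kern_denom in auto)

lemma kern_H2: "cmod z < 1 \<Longrightarrow> kern z \<in> H2"
  by (rule H2_bounded[where K = "1 / (1 - cmod z)"]) (auto intro: kern_holomorphic kern_bound)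

lemma taylor_kern:
  assumes z: "cmod z < 1"
  shows "taylor (kern z) = (\<lambda>n. cnj z ^ n)"
proof (rule taylor_unique[OF _ kern_holomorphic[OF z]])
  fix w :: complex assume w: "cmod w < 1"
  have "cmod z * cmod w \<le> cmod z * 1" using w by (intro mult_left_mono) auto
  then have "cmod (cnj z * w) < 1" using z by (simp add: norm_mult)
  from geometric_sums[OF this] show "(\<lambda>n. cnj z ^ n * w ^ n) sums kern z w"
    by (simp add: kern_def power_mult_distrib)
qed

lemma hin_kern:
  assumes "f \<in> H2" "cmod z < 1"
  shows "hin f (kern z) = f z"
  using hin_sums[OF assms(1) kern_H2[OF assms(2)]] taylor_sums[OF H2_holomorphic[OF assms(1)] assms(2)]
  by (simp add: taylor_kern assms(2) sums_unique2)

lemma H2_tendsto_pointwise: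
  assumes "\<And>n. fs n \<in> H2" "f \<in> H2" "(\<lambda>n. H2norm (\<lambda>z. fs n z - f z)) \<longlonglongrightarrow> 0" "cmod z < 1"
  shows "(\<lambda>n. fs n z) \<longlonglongrightarrow> f z"
  using hin_tendsto_left[OF assms(1,2) kern_H2[OF assms(4)] assms(3)] by (simp add: hin_kern assms)

lemma hin_const_right: "f \<in> H2 \<Longrightarrow> hin f (\<lambda>z. 1) = f 0"
  using hin_kern[of f 0] by (simp add: kern_def[abs_def])

lemma H2_point_bound:
  assumes "f \<in> H2" "cmod z < 1"
  shows "cmod (f z) \<le> H2norm f * H2norm (kern z)"
  using hin_Cauchy_Schwarz[OF assms(1) kern_H2[OF assms(2)]] hin_kern[OF assms] by simp

lemma H2norm_eq_0_imp:
  "f \<in> H2 \<Longrightarrow> H2norm f = 0 \<Longrightarrow> cmod z < 1 \<Longrightarrow> f z = 0"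
  using H2_point_bound[of f z] by simp

text \<open>Square summable coefficients are bounded, so their power series converges throughout the
  disk and defines the required function.\<close>

lemma H2_of_square_summable:
  assumes c: "summable (\<lambda>n. (cmod (c n))\<^sup>2)"
  obtains g where "g \<in> H2" "taylor g = c"
proof -
  define K where "K = (\<Sum>n. (cmod (c n))\<^sup>2)"
  have K: "(cmod (c n))\<^sup>2 \<le> K" for n
    unfolding K_def using sum_le_suminf[OF c, of "{n}"] by simp
  have cK: "cmod (c n) \<le> K + 1" for n
  proof -
    have "cmod (c n) \<le> (cmod (c n))\<^sup>2 + 1"
      using sum_squares_bound[of "cmod (c n)" 1] norm_ge_zero[of "c n"] unfolding one_power2 mult_1_right by linarith
    also have "\<dots> \<le> K + 1" using K[of n] by simp
    finally show ?thesis .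
  qed
  have s: "summable (\<lambda>n. c n * z ^ n)" if "cmod z < 1" for z
  proof (rule summable_comparison_test')
    show "summable (\<lambda>n. (K + 1) * cmod z ^ n)" using that by (intro summable_mult summable_geometric) simp
    show "norm (c n * z ^ n) \<le> (K + 1) * cmod z ^ n" if "0 \<le> n" for n
      using cK[of n] by (simp add: norm_mult norm_power mult_right_mono)
  qed
  define g where "g z = (\<Sum>n. c n * z ^ n)" for z
  have g: "(\<lambda>n. c n * z ^ n) sums g z" if "cmod z < 1" for z
    unfolding g_def using s[OF that] by (rule summable_sums)
  have hg: "g holomorphic_on ball 0 1"
    using power_series_holomorphic[of 0 1 c g] g by simp
  have t: "taylor g = c" by (rule taylor_unique[OF g hg])
  then have "g \<in> H2" using H2_iff_summable_taylor[OF hg] c by simp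
  with t that show ?thesis by blast
qed

text \<open>The Fourier coefficients of phi with index n >= 0 are square summable by Bessel, hence
  Taylor coefficients of some \<open>g\<close> in H^2. Projecting onto H^2 rather than
  \<open>model_space\<close> is enough, since in the application \<open>g\<close> turns out to lie
  in the model space.\<close>

lemma szego_projection:
  assumes \<phi>: "\<phi> \<in> sqint"
  obtains g where "g \<in> H2" "\<And>k. k \<in> H2 \<Longrightarrow> hin g k = L2inner \<phi> (bdry k)"
proof -
  define c where "c n = L2inner \<phi> (\<lambda>t. cis (real n * t))" for n
  have "(\<Sum>n<N. (cmod (c n))\<^sup>2) \<le> (l2n \<phi>)\<^sup>2" for N
    unfolding c_def by (rule l2n_Bessel) (auto intro: cis_sqint \<phi> simp: L2inner_cis_cis)
  then have "summable (\<lambda>n. (cmod (c n))\<^sup>2)"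
    by (intro summableI_nonneg_bounded[where x = "(l2n \<phi>)\<^sup>2"]) auto
  then obtain g where g: "g \<in> H2" "taylor g = c" by (rule H2_of_square_summable)
  have "hin g k = L2inner \<phi> (bdry k)" if "k \<in> H2" for k
    using hin_sums[OF g(1) that] L2inner_bdry_sums[OF \<phi> that] sums_unique2
    by (simp add: g(2) c_def mult.commute) blast
  with g(1) show ?thesis by (rule that)
qed

text \<open>Completeness of l^2 on the level of Taylor coefficients: they converge one by one, and
  bounds on finite sums of squares survive the passage to the limit.\<close>

lemma H2_complete:
  assumes fs: "\<And>n. fs n \<in> H2"
    and Cauchy: "\<And>e. e > 0 \<Longrightarrow> \<exists>M. \<forall>m\<ge>M. \<forall>n\<ge>M. H2norm (\<lambda>z. fs m z - fs n z) \<le> e"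
  obtains f where "f \<in> H2" "(\<lambda>n. H2norm (\<lambda>z. fs n z - f z)) \<longlonglongrightarrow> 0"
proof -
  have tay: "taylor (\<lambda>z. fs m z - fs n z) k = taylor (fs m) k - taylor (fs n) k" for m n k
    by (simp add: taylor_diff fs H2_holomorphic)
  have fin: "(\<Sum>k<N. (cmod (taylor (fs m) k - taylor (fs n) k))\<^sup>2) \<le> (H2norm (\<lambda>z. fs m z - fs n z))\<^sup>2" for m n N
  proof -
    note * = H2norm_square_sums[OF H2_diff[OF fs[of m] fs[of n]], unfolded tay]
    show ?thesis unfolding sums_unique[OF *] by (rule sum_le_suminf[OF sums_summable[OF *]]) auto
  qed
  have one: "cmod (taylor (fs m) k - taylor (fs n) k) \<le> H2norm (\<lambda>z. fs m z - fs n z)" for m n k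
  proof -
    have "(cmod (taylor (fs m) k - taylor (fs n) k))\<^sup>2 \<le> (\<Sum>k<Suc k. (cmod (taylor (fs m) k - taylor (fs n) k))\<^sup>2)"
      by (simp add: sum_nonneg)
    also note fin
    finally show ?thesis by (rule power2_le_imp_le) simp
  qed
  have "Cauchy (\<lambda>n. taylor (fs n) k)" for k
    unfolding Cauchy_def dist_norm
  proof (intro allI impI)
    fix e :: real assume "e > 0"
    then obtain M where "\<forall>m\<ge>M. \<forall>n\<ge>M. H2norm (\<lambda>z. fs m z - fs n z) \<le> e/2" using Cauchy[of "e/2"] by auto
    then show "\<exists>M. \<forall>m\<ge>M. \<forall>n\<ge>M. cmod (taylor (fs m) k - taylor (fs n) k) < e"
      using \<open>e > 0\<close> by (intro exI[of _ M]) (auto intro!: le_less_trans[OF order_trans[OF one], where y = "e/2"])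
  qed
  then have "\<exists>c. (\<lambda>n. taylor (fs n) k) \<longlonglongrightarrow> c" for k
    using Cauchy_convergent_iff convergent_def by blast
  then obtain c where c: "\<And>k. (\<lambda>n. taylor (fs n) k) \<longlonglongrightarrow> c k" by metis
  have bnd: "(\<Sum>k<N. (cmod (taylor (fs m) k - c k))\<^sup>2) \<le> e\<^sup>2"
    if M: "\<forall>m\<ge>M. \<forall>n\<ge>M. H2norm (\<lambda>z. fs m z - fs n z) \<le> e" and m: "m \<ge> M" and e: "e > 0" for e M m N
  proof (rule tendsto_upperbound)
    show "(\<lambda>n. \<Sum>k<N. (cmod (taylor (fs m) k - taylor (fs n) k))\<^sup>2) \<longlonglongrightarrow> (\<Sum>k<N. (cmod (taylor (fs m) k - c k))\<^sup>2)"
      by (intro tendsto_intros c)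
    show "\<forall>\<^sub>F n in sequentially. (\<Sum>k<N. (cmod (taylor (fs m) k - taylor (fs n) k))\<^sup>2) \<le> e\<^sup>2"
      using eventually_ge_at_top[of M]
    proof eventually_elim
      case (elim n)
      then have "(H2norm (\<lambda>z. fs m z - fs n z))\<^sup>2 \<le> e\<^sup>2" using M m by (intro power_mono) auto
      with fin show ?case by (rule order_trans)
    qed
  qed simp
  obtain M1 where M1: "\<forall>m\<ge>M1. \<forall>n\<ge>M1. H2norm (\<lambda>z. fs m z - fs n z) \<le> 1" using Cauchy[of 1] by auto
  have "summable (\<lambda>k. (cmod (taylor (fs M1) k - c k))\<^sup>2)"
    by (rule summableI_nonneg_bounded[where x = "1\<^sup>2"]) (use bnd[OF M1] in auto)
  then obtain d where d: "d \<in> H2" "taylor d = (\<lambda>k. taylor (fs M1) k - c k)" by (rule H2_of_square_summable)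
  \<comment> \<open>What is known to be square summable is the difference between the coefficients
    of \<open>fs M1\<close> and the limits, so the limit function is obtained by
    subtraction.\<close>
  define f where "f z = fs M1 z - d z" for z
  have f: "f \<in> H2" unfolding f_def by (intro H2_diff fs d)
  have tf: "taylor f = c"
    unfolding f_def by (simp add: taylor_diff fs d H2_holomorphic)
  have "(\<lambda>n. H2norm (\<lambda>z. fs n z - f z)) \<longlonglongrightarrow> 0"
  proof (rule LIMSEQ_I)
    fix e :: real assume e: "e > 0"
    then obtain M where M: "\<forall>m\<ge>M. \<forall>n\<ge>M. H2norm (\<lambda>z. fs m z - fs n z) \<le> e/2" using Cauchy[of "e/2"] by auto
    have "H2norm (\<lambda>z. fs n z - f z) < e" if "n \<ge> M" for n
    proof -
      have *: "(\<lambda>k. (cmod (taylor (fs n) k - c k))\<^sup>2) sums (H2norm (\<lambda>z. fs n z - f z))\<^sup>2"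
        using H2norm_square_sums[OF H2_diff[OF fs[of n] f]] by (simp add: taylor_diff fs f H2_holomorphic tf)
      have "(H2norm (\<lambda>z. fs n z - f z))\<^sup>2 \<le> (e/2)\<^sup>2"
        unfolding sums_unique[OF *]
        by (rule suminf_le_const[OF sums_summable[OF *]]) (use bnd[OF M that] e in simp)
      then have "H2norm (\<lambda>z. fs n z - f z) \<le> e/2" by (rule power2_le_imp_le) (use e in simp)
      then show ?thesis using e by simp
    qed
    then show "\<exists>M. \<forall>n\<ge>M. norm (H2norm (\<lambda>z. fs n z - f z) - 0) < e" by auto
  qed
  with f show ?thesis by (rule that)
qed

lemma H2norm_bounded_mult_le:
  assumes b: "b holomorphic_on ball 0 1" "\<And>z. cmod z < 1 \<Longrightarrow> cmod (b z) \<le> K" and f: "f \<in> H2"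
  shows "H2norm (\<lambda>z. b z * f z) \<le> K * H2norm f"
proof -
  have bH: "b \<in> H2" by (rule H2_bounded[OF b])
  have K: "K \<ge> 0" using b(2)[of 0] norm_ge_zero[of "b 0"] by (simp del: norm_ge_zero)
  have bb: "AE t in circ. cmod (bdry b t) \<le> K" by (rule AE_norm_bdry_le[OF bH b(2)])
  have ae: "AE t in circ. (cmod (bdry (\<lambda>z. b z * f z) t))\<^sup>2 \<le> K\<^sup>2 * (cmod (bdry f t))\<^sup>2"
    using AE_bdry_mult[OF bH f] bb
  proof eventually_elim
    case (elim t)
    then show ?case using elim(1)[symmetric]
      by (auto simp: norm_mult power_mult_distrib intro!: mult_right_mono power_mono)
  qed
  have m: "(\<lambda>z. b z * f z) \<in> H2" by (rule H2_bounded_mult[OF b f])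
  have "(LINT t|circ. (cmod (bdry (\<lambda>z. b z * f z) t))\<^sup>2) \<le> (LINT t|circ. K\<^sup>2 * (cmod (bdry f t))\<^sup>2)"
    by (rule integral_mono_AE[OF _ _ ae]) (intro integrable_mult_right sqint_integrable bdry_sqint m f)+
  also have "\<dots> = K\<^sup>2 * (LINT t|circ. (cmod (bdry f t))\<^sup>2)" by simp
  finally have "(l2n (bdry (\<lambda>z. b z * f z)))\<^sup>2 \<le> K\<^sup>2 * (l2n (bdry f))\<^sup>2"
    by (simp add: l2n_square divide_right_mono)
  then have "(H2norm (\<lambda>z. b z * f z))\<^sup>2 \<le> (K * H2norm f)\<^sup>2"
    by (simp add: H2norm_l2n m f power_mult_distrib)
  then show ?thesis by (rule power2_le_imp_le) (use K in simp)
qed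

text \<open>On a closed disk of radius rho > |z| the quotient is bounded by compactness; outside it
  |w - z| >= rho - |z|, so |q| is at most a constant times |f|. The sum of both bounds holds
  everywhere and has bounded circle means.\<close>

lemma H2_divide:
  assumes f: "f \<in> H2" and z: "cmod z < 1" and q: "q holomorphic_on ball 0 1"
    and fq: "\<And>w. cmod w < 1 \<Longrightarrow> f w = (w - z) * q w"
  shows "q \<in> H2"
proof -
  define \<rho> where "\<rho> = (1 + cmod z) / 2"
  have \<rho>: "cmod z < \<rho>" "\<rho> < 1" using z by (auto simp: \<rho>_def)
  have "compact (q ` cball 0 \<rho>)"
    by (rule compact_continuous_image[OF continuous_on_subset[OF holomorphic_on_imp_continuous_on[OF q]]]) (use \<rho> in auto)
  then have "bounded (q ` cball 0 \<rho>)" by (rule compact_imp_bounded)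
  then obtain M where "\<forall>x\<in>cball 0 \<rho>. cmod (q x) \<le> M"
    unfolding bounded_iff by auto
  then have M: "cmod (q w) \<le> M" if "cmod w \<le> \<rho>" for w using that by simp
  define K where "K = 1 / (\<rho> - cmod z)"
  have K: "K > 0" using \<rho> by (simp add: K_def)
  have bd: "(cmod (q w))\<^sup>2 \<le> M\<^sup>2 + K\<^sup>2 * (cmod (f w))\<^sup>2" if w: "cmod w < 1" for w
  proof (cases "cmod w \<le> \<rho>")
    case True
    then have "(cmod (q w))\<^sup>2 \<le> M\<^sup>2" using M by (intro power_mono) auto
    then show ?thesis by (simp add: add_increasing2)
  next
    case False
    then have "\<rho> - cmod z \<le> cmod (w - z)" using norm_triangle_ineq2[of w z] by linarith
    then have "(\<rho> - cmod z) * cmod (q w) \<le> cmod (f w)"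
      unfolding fq[OF w] norm_mult by (rule mult_right_mono) simp
    then have "cmod (q w) \<le> K * cmod (f w)" using \<rho> by (simp add: K_def field_simps)
    then have "(cmod (q w))\<^sup>2 \<le> (K * cmod (f w))\<^sup>2" by (rule power_mono) simp
    then show ?thesis by (simp add: power_mult_distrib add_increasing)
  qed
  obtain C where C: "\<And>r. 0 \<le> r \<Longrightarrow> r < 1 \<Longrightarrow> circle_mean f r \<le> C"
    using f by (auto simp: H2_def)
  have "circle_mean q r \<le> M\<^sup>2 + K\<^sup>2 * C"
    if r: "0 \<le> r" "r < 1" for r
  proof -
    have i: "(\<lambda>t. K\<^sup>2 * (cmod (f (of_real r * cis t)))\<^sup>2) integrable_on {0..2*pi}"
      using r by (intro integrable_continuous_interval continuous_intros continuous_on_circle[OF H2_holomorphic[OF f]]) auto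
    have "integral {0..2*pi} (\<lambda>t. (cmod (q (of_real r * cis t)))\<^sup>2) \<le>
        integral {0..2*pi} (\<lambda>t. M\<^sup>2 + K\<^sup>2 * (cmod (f (of_real r * cis t)))\<^sup>2)"
    proof (rule integral_le)
      show "(\<lambda>t. (cmod (q (of_real r * cis t)))\<^sup>2) integrable_on {0..2*pi}"
        using r by (intro integrable_continuous_interval continuous_intros continuous_on_circle[OF q]) auto
      show "(\<lambda>t. M\<^sup>2 + K\<^sup>2 * (cmod (f (of_real r * cis t)))\<^sup>2) integrable_on {0..2*pi}"
        by (intro integrable_add integrable_const_ivl i)
    qed (use r in \<open>auto intro!: bd simp: norm_mult\<close>)
    also have "\<dots> = integral {0..2*pi} (\<lambda>t. M\<^sup>2) + integral {0..2*pi} (\<lambda>t. K\<^sup>2 * (cmod (f (of_real r * cis t)))\<^sup>2)"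
      by (rule integral_add) (use i in auto)
    also have "\<dots> = 2*pi*M\<^sup>2 + K\<^sup>2 * integral {0..2*pi} (\<lambda>t. (cmod (f (of_real r * cis t)))\<^sup>2)" by simp
    finally have "circle_mean q r \<le>
        (2*pi*M\<^sup>2 + K\<^sup>2 * integral {0..2*pi} (\<lambda>t. (cmod (f (of_real r * cis t)))\<^sup>2)) / (2*pi)"
      by (simp add: divide_right_mono)
    also have "\<dots> = M\<^sup>2 + K\<^sup>2 * circle_mean f r"
      by (simp add: add_divide_distrib)
    also have "\<dots> \<le> M\<^sup>2 + K\<^sup>2 * C" using C[OF r] by (intro add_left_mono mult_left_mono) auto
    finally show ?thesis .
  qed
  then show ?thesis using q by (auto simp: H2_def)
qed

section \<open>Difference quotients and multipliers on H^2\<close>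

definition quot :: "complex \<Rightarrow> (complex \<Rightarrow> complex) \<Rightarrow> complex \<Rightarrow> complex" where
  "quot z f w = (if w = z then deriv f z else (f w - f z) / (w - z))"

lemma quot_eq: "f w - f z = (w - z) * quot z f w"
  by (simp add: quot_def)

lemma quot_holomorphic:
  assumes "f holomorphic_on ball 0 1" "cmod z < 1"
  shows "quot z f holomorphic_on ball 0 1"
proof -
  have "(\<lambda>w. if w = z then deriv f z else (f w - f z) / (w - z)) holomorphic_on ball 0 1"
    by (rule pole_lemma_open) (use assms in auto)
  then show ?thesis by (simp add: quot_def[abs_def])
qed

lemma quot_H2:
  assumes f: "f \<in> H2" and z: "cmod z < 1"
  shows "quot z f \<in> H2"
proof (rule H2_divide[OF _ z quot_holomorphic[OF H2_holomorphic[OF f] z]])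
  show "(\<lambda>w. f w - f z * 1) \<in> H2" by (intro H2_diff H2_cmult f H2_one)
qed (simp add: quot_eq)

lemma H2_continuous_cball:
  assumes "b holomorphic_on ball 0 1" "continuous_on (cball 0 1) b"
  obtains K where "\<And>z. cmod z \<le> 1 \<Longrightarrow> cmod (b z) \<le> K"
proof -
  have "bounded (b ` cball 0 1)"
    by (intro compact_imp_bounded compact_continuous_image assms) simp
  then obtain K where "\<forall>x\<in>cball 0 1. cmod (b x) \<le> K" unfolding bounded_iff by auto
  then show ?thesis by (intro that[of K]) simp
qed

text \<open>Two multipliers are allowed so as to cover two uses: \<open>b\<close> = \<open>c\<close>
  a finite Blaschke product, where multiplication preserves inner products, and the pair w - z and w
  \<open>kern z w\<close> behind the adjoint of the difference quotient. Continuity on the closed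
  disk makes their boundary values explicit at every point.\<close>

lemma hin_unimodular_mult:
  assumes b: "b holomorphic_on ball 0 1" "continuous_on (cball 0 1) b"
    and c: "c holomorphic_on ball 0 1" "continuous_on (cball 0 1) c"
    and bc: "\<And>t. b (cis t) * cnj (c (cis t)) = 1"
    and f: "f \<in> H2" and g: "g \<in> H2"
  shows "hin (\<lambda>z. b z * f z) (\<lambda>z. c z * g z) = hin f g"
proof -
  obtain K where K: "\<And>z. cmod z \<le> 1 \<Longrightarrow> cmod (b z) \<le> K" using H2_continuous_cball[OF b] by blast
  obtain L where L: "\<And>z. cmod z \<le> 1 \<Longrightarrow> cmod (c z) \<le> L" using H2_continuous_cball[OF c] by blast
  have bH: "b \<in> H2" by (rule H2_bounded[OF b(1) K]) simp
  have cH: "c \<in> H2" by (rule H2_bounded[OF c(1) L]) simp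
  have bf: "(\<lambda>z. b z * f z) \<in> H2" by (rule H2_bounded_mult[OF b(1) K f]) simp
  have cg: "(\<lambda>z. c z * g z) \<in> H2" by (rule H2_bounded_mult[OF c(1) L g]) simp
  have "AE t in circ. bdry (\<lambda>z. b z * f z) t * cnj (bdry (\<lambda>z. c z * g z) t) = bdry f t * cnj (bdry g t)"
    using AE_bdry_mult[OF bH f] AE_bdry_mult[OF cH g]
  proof eventually_elim
    case (elim t)
    have "bdry (\<lambda>z. b z * f z) t * cnj (bdry (\<lambda>z. c z * g z) t) =
        (b (cis t) * cnj (c (cis t))) * (bdry f t * cnj (bdry g t))"
      unfolding elim[symmetric] bdry_continuous[OF b(2)] bdry_continuous[OF c(2)] by simp
    then show ?case by (simp add: bc)
  qed
  then show ?thesis unfolding hin_def by (intro L2inner_AE_cong bdry_sqint bf cg f g)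
qed

section \<open>Difference quotients and coanalytic Toeplitz operators\<close>

lemma mult_kern_H2: "f \<in> H2 \<Longrightarrow> cmod z < 1 \<Longrightarrow> (\<lambda>w. f w * kern z w) \<in> H2"
  using H2_bounded_mult[OF kern_holomorphic, of z "1 / (1 - cmod z)" f] kern_bound[of z]
  by (simp add: mult.commute)

lemma shift_kern_H2:
  assumes "g \<in> H2" "cmod z < 1"
  shows "(\<lambda>w. w * kern z w * g w) \<in> H2"
proof -
  have "(\<lambda>w. w * (g w * kern z w)) \<in> H2"
    by (rule H2_bounded_mult[where K = 1]) (auto intro: mult_kern_H2 assms)
  then show ?thesis by (simp add: mult_ac)
qed

text \<open>On the circle, (w - z) times the conjugate of w \<open>kern z w\<close> is 1, so both
  sides of the inner product may be multiplied by these factors. This turns \<open>quot z f\<close>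
  into f - f(z), and the constant f(z) drops out because w \<open>kern z w\<close> g(w) vanishes at
  0.\<close>

lemma quot_adjoint:
  assumes f: "f \<in> H2" and g: "g \<in> H2" and z: "cmod z < 1"
  shows "hin (quot z f) g = hin f (\<lambda>w. w * kern z w * g w)"
proof -
  define u where "u w = w * kern z w * g w" for w
  have u: "u \<in> H2" unfolding u_def by (rule shift_kern_H2[OF g z])
  have 1: "hin (\<lambda>w. (w - z) * quot z f w) u = hin (quot z f) g"
    unfolding u_def
  proof (rule hin_unimodular_mult)
    show "(cis t - z) * cnj (cis t * kern z (cis t)) = 1" for t
    proof -
      have "cis t * cnj (cis t) = 1" by (simp add: cis_cnj cis_mult)
      then have e: "(cis t - z) * cnj (cis t) = 1 - z * cnj (cis t)" by (simp add: algebra_simps)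
      have "1 - cnj z * cis t \<noteq> 0" by (rule kern_denom(2)[OF z]) simp
      then have "cnj (1 - cnj z * cis t) \<noteq> 0" by (metis complex_cnj_zero_iff)
      then have "(cis t - z) * cnj (cis t) * cnj (kern z (cis t)) = 1"
        unfolding e by (simp add: kern_def)
      then show ?thesis by (simp add: mult.assoc)
    qed
  qed (auto intro!: holomorphic_intros continuous_intros kern_holomorphic kern_continuous z g quot_H2 f)
  have 2: "(\<lambda>w. (w - z) * quot z f w) = (\<lambda>w. f w - f z * 1)" by (simp add: quot_eq)
  have 3: "hin (\<lambda>w. f w - f z * 1) u = hin f u - f z * hin (\<lambda>w. 1) u"
    using hin_diff_left[OF f H2_cmult[OF H2_one, of "f z"] u] hin_cmult_left[OF H2_one u, of "f z"] by simp
  have 4: "hin (\<lambda>w. 1) u = 0"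
    using hin_const_right[OF u] hin_cnj[of "\<lambda>w. 1" u] by (simp add: u_def)
  have "hin (quot z f) g = hin f u" unfolding 1[symmetric] 2 3 4 by simp
  then show ?thesis by (simp add: u_def[abs_def])
qed

text \<open>The adjoint is multiplication by w \<open>kern z w\<close>, a function bounded by 1 / (1
  - |z|). Testing the quotient against itself transfers this bound to the operator.\<close>

lemma H2norm_quot_le:
  assumes f: "f \<in> H2" and z: "cmod z < 1"
  shows "H2norm (quot z f) \<le> H2norm f / (1 - cmod z)"
proof -
  define q where "q = quot z f"
  have q: "q \<in> H2" unfolding q_def by (rule quot_H2[OF f z])
  have b: "cmod (w * kern z w) \<le> 1 / (1 - cmod z)" if "cmod w < 1" for w
  proof -
    have "cmod w * cmod (kern z w) \<le> 1 * (1 / (1 - cmod z))"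
      using that kern_bound[OF z, of w] by (intro mult_mono) auto
    then show ?thesis by (simp add: norm_mult)
  qed
  have "(H2norm q)\<^sup>2 = cmod (hin q q)" using hin_self[OF q] by (simp add: norm_power)
  also have "hin q q = hin f (\<lambda>w. w * kern z w * q w)"
    using quot_adjoint[OF f q z] by (simp add: q_def)
  also have "cmod \<dots> \<le> H2norm f * H2norm (\<lambda>w. w * kern z w * q w)"
    by (intro hin_Cauchy_Schwarz f shift_kern_H2 q z)
  also have "\<dots> \<le> H2norm f * (1 / (1 - cmod z) * H2norm q)"
    by (intro mult_left_mono H2norm_bounded_mult_le q b) (auto intro!: holomorphic_intros kern_holomorphic z)
  finally have *: "H2norm q * H2norm q \<le> (H2norm f / (1 - cmod z)) * H2norm q" by (simp add: power2_eq_square)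
  show ?thesis
  proof (cases "H2norm q = 0")
    case True
    then show ?thesis using z by (simp add: q_def)
  next
    case False
    then have "H2norm q > 0" using H2norm_nonneg[of q] by linarith
    with * show ?thesis unfolding q_def[symmetric] by (rule mult_right_le_imp_le)
  qed
qed

text \<open>The value at z of the Szego projection of conj(h) f. This form makes sense for every f
  in H^2, even if conj(h) f is not square integrable, and for fixed z it is continuous in f.\<close>

definition toep :: "(complex \<Rightarrow> complex) \<Rightarrow> (complex \<Rightarrow> complex) \<Rightarrow> complex \<Rightarrow> complex" where
  "toep h f z = hin f (\<lambda>w. h w * kern z w)"

text \<open>The difference quotient is \<open>S* (1 - z S*)^{-1}\<close>, which commutes with the coanalytic Toeplitz operator.\<close>

lemma toep_quot:
  assumes f: "f \<in> H2" and h: "h \<in> H2" and x: "cmod x < 1" and z: "cmod z < 1"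
  shows "toep h f x - toep h f z = (x - z) * toep h (quot z f) x"
proof -
  define G where "G w = w * kern z w * (h w * kern x w)" for w
  have G: "G \<in> H2" unfolding G_def by (intro shift_kern_H2 mult_kern_H2 h x z)
  have "toep h f x - toep h f z = hin f (\<lambda>w. h w * kern x w - h w * kern z w)"
    unfolding toep_def by (simp add: hin_diff_right mult_kern_H2 f h x z)
  also have "\<dots> = hin f (\<lambda>w. cnj (x - z) * G w)"
  proof (rule hin_cong)
    fix w :: complex assume w: "cmod w < 1"
    have "1 - cnj x * w \<noteq> 0" "1 - cnj z * w \<noteq> 0" using kern_denom(2) w x z by auto
    then have "kern x w - kern z w = cnj (x - z) * (w * kern z w * kern x w)"
      by (simp add: kern_def divide_simps) (simp add: algebra_simps)
    then show "h w * kern x w - h w * kern z w = cnj (x - z) * G w"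
      unfolding G_def by (metis (no_types, lifting) mult.assoc mult.left_commute right_diff_distrib)
  qed simp
  also have "\<dots> = (x - z) * hin f G" by (subst hin_cmult_right[OF G f]) simp
  also have "hin f G = toep h (quot z f) x"
    unfolding toep_def G_def by (rule quot_adjoint[symmetric]) (intro f z mult_kern_H2 h x)+
  finally show ?thesis .
qed

lemma toep_add_left: "f \<in> H2 \<Longrightarrow> g \<in> H2 \<Longrightarrow> h \<in> H2 \<Longrightarrow> cmod z < 1 \<Longrightarrow> toep h (\<lambda>w. f w + g w) z = toep h f z + toep h g z"
  unfolding toep_def by (intro hin_add_left mult_kern_H2)

lemma toep_diff_left: "f \<in> H2 \<Longrightarrow> g \<in> H2 \<Longrightarrow> h \<in> H2 \<Longrightarrow> cmod z < 1 \<Longrightarrow> toep h (\<lambda>w. f w - g w) z = toep h f z - toep h g z"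
  unfolding toep_def by (intro hin_diff_left mult_kern_H2)

lemma toep_cmult_left: "f \<in> H2 \<Longrightarrow> h \<in> H2 \<Longrightarrow> cmod z < 1 \<Longrightarrow> toep h (\<lambda>w. c * f w) z = c * toep h f z"
  unfolding toep_def by (intro hin_cmult_left mult_kern_H2)

lemma toep_sum_left: "(\<And>k. k \<in> A \<Longrightarrow> u k \<in> H2) \<Longrightarrow> h \<in> H2 \<Longrightarrow> cmod z < 1 \<Longrightarrow>
    toep h (\<lambda>w. \<Sum>k\<in>A. c k * u k w) z = (\<Sum>k\<in>A. c k * toep h (u k) z)"
  unfolding toep_def by (intro hin_sum_left mult_kern_H2)

lemma toep_cong: "(\<And>z. cmod z < 1 \<Longrightarrow> f z = g z) \<Longrightarrow> toep h f = toep h g"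
  unfolding toep_def by (intro ext hin_cong) auto

section \<open>Finite Blaschke products and the Takenaka-Malmquist-Walsh basis\<close>

lemma bfac_kern: "bfac l z = (z - l) * kern l z"
  by (simp add: bfac_def kern_def)

lemma bfac_holomorphic: "cmod l < 1 \<Longrightarrow> bfac l holomorphic_on ball 0 1"
  unfolding bfac_kern[abs_def] by (intro holomorphic_intros kern_holomorphic)

lemma bfac_continuous: "cmod l < 1 \<Longrightarrow> continuous_on (cball 0 1) (bfac l)"
  unfolding bfac_kern[abs_def] by (intro continuous_intros kern_continuous)

lemma norm_bfac_square:
  assumes "cmod l < 1" "cmod z \<le> 1"
  shows "1 - (cmod (bfac l z))\<^sup>2 = (1 - (cmod l)\<^sup>2) * (1 - (cmod z)\<^sup>2) / (cmod (1 - cnj l * z))\<^sup>2"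
proof -
  have nz: "cmod (1 - cnj l * z) \<noteq> 0" using kern_denom(2)[OF assms] by simp
  have "of_real ((cmod (1 - cnj l * z))\<^sup>2 - (cmod (z - l))\<^sup>2) = (of_real ((1 - (cmod l)\<^sup>2) * (1 - (cmod z)\<^sup>2)) :: complex)"
    unfolding of_real_diff of_real_mult complex_norm_square by (simp add: algebra_simps)
  then have "(cmod (1 - cnj l * z))\<^sup>2 - (cmod (z - l))\<^sup>2 = (1 - (cmod l)\<^sup>2) * (1 - (cmod z)\<^sup>2)"
    by (simp only: of_real_eq_iff)
  then show ?thesis using nz by (simp add: bfac_def norm_divide power_divide field_simps)
qed

lemma norm_bfac_le: 
  assumes "cmod l < 1" "cmod z \<le> 1"
  shows "cmod (bfac l z) \<le> 1"
proof -
  have "(cmod l)\<^sup>2 \<le> 1" "(cmod z)\<^sup>2 \<le> 1" using assms by (auto simp: abs_square_le_1)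
  then have "1 - (cmod (bfac l z))\<^sup>2 \<ge> 0"
    unfolding norm_bfac_square[OF assms] by (intro divide_nonneg_nonneg mult_nonneg_nonneg) auto
  then show ?thesis by (simp add: abs_square_le_1)
qed

lemma norm_bfac_cis: 
  assumes "cmod l < 1"
  shows "cmod (bfac l (cis t)) = 1"
proof -
  have "1 - (cmod (bfac l (cis t)))\<^sup>2 = 0" using norm_bfac_square[OF assms, of "cis t"] by simp
  then show ?thesis by (simp add: power2_eq_1_iff) (smt (verit) norm_ge_zero)
qed

text \<open>Built from \<open>bfac\<close>, as in \<open>tmw\<close>, and so without the unimodular
  constants of \<open>blaschke_factor\<close>; these are collected in \<open>bsign\<close>. Indices
  start at 0, so \<open>bprod lam n\<close> carries the zeros \<open>lam 0\<close> to
  \<open>lam (n - 1)\<close>.\<close>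

definition bprod :: "(nat \<Rightarrow> complex) \<Rightarrow> nat \<Rightarrow> complex \<Rightarrow> complex" where
  "bprod lam n z = (\<Prod>k<n. bfac (lam k) z)"

lemma tmw_eq: "tmw lam n z = bprod lam n z * (of_real (sqrt (1 - (cmod (lam n))\<^sup>2)) * kern (lam n) z)"
  by (simp add: tmw_def bprod_def kern_def)

context
  fixes lam :: "nat \<Rightarrow> complex"
  assumes lam: "\<And>n. cmod (lam n) < 1"
begin

lemma bprod_holomorphic: "bprod lam n holomorphic_on ball 0 1"
  unfolding bprod_def[abs_def] by (intro holomorphic_intros bfac_holomorphic lam)

lemma bprod_continuous: "continuous_on (cball 0 1) (bprod lam n)"
  unfolding bprod_def[abs_def] by (intro continuous_intros bfac_continuous lam)

lemma norm_bprod_le: "cmod z \<le> 1 \<Longrightarrow> cmod (bprod lam n z) \<le> 1"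
  unfolding bprod_def by (auto simp: prod_norm[symmetric] intro!: prod_le_1 norm_bfac_le lam)

lemma norm_bprod_cis: "cmod (bprod lam n (cis t)) = 1"
  unfolding bprod_def by (simp add: prod_norm[symmetric] norm_bfac_cis lam)

lemma bprod_mult_H2: "f \<in> H2 \<Longrightarrow> (\<lambda>z. bprod lam n z * f z) \<in> H2"
  by (rule H2_bounded_mult[OF bprod_holomorphic norm_bprod_le]) auto

lemma hin_bprod_mult:
  "f \<in> H2 \<Longrightarrow> g \<in> H2 \<Longrightarrow> hin (\<lambda>z. bprod lam n z * f z) (\<lambda>z. bprod lam n z * g z) = hin f g"
proof (rule hin_unimodular_mult[OF bprod_holomorphic bprod_continuous bprod_holomorphic bprod_continuous])
  show "bprod lam n (cis t) * cnj (bprod lam n (cis t)) = 1" for t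
    by (simp add: norm_bprod_cis flip: complex_norm_square)
qed

lemma weight_pos: "sqrt (1 - (cmod (lam n))\<^sup>2) > 0"
  using lam[of n] by (simp add: abs_square_less_1)

lemma tmw_continuous: "continuous_on (cball 0 1) (tmw lam n)"
  unfolding tmw_eq[abs_def] by (intro continuous_intros bprod_continuous kern_continuous lam)

lemma tmw_holomorphic: "tmw lam n holomorphic_on ball 0 1"
  unfolding tmw_eq[abs_def] by (intro holomorphic_intros bprod_holomorphic kern_holomorphic lam)

lemma tmw_bounded: "\<exists>K. \<forall>z. cmod z \<le> 1 \<longrightarrow> cmod (tmw lam n z) \<le> K"
  using H2_continuous_cball[OF tmw_holomorphic tmw_continuous] by metis

lemma tmw_H2: "tmw lam n \<in> H2"
  using tmw_bounded[of n] H2_bounded[OF tmw_holomorphic] by (meson less_imp_le)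

text \<open>\<open>tmw lam n\<close> is \<open>bprod lam n\<close> times the normalised Szego kernel
  at \<open>lam n\<close>. The unimodular factor cancels and the kernel evaluates
  \<open>g\<close>.\<close>

lemma hin_bprod_tmw:
  assumes "g \<in> H2"
  shows "hin (\<lambda>z. bprod lam n z * g z) (tmw lam n) = of_real (sqrt (1 - (cmod (lam n))\<^sup>2)) * g (lam n)"
proof -
  have "hin (\<lambda>z. bprod lam n z * g z) (tmw lam n) = hin g (\<lambda>z. of_real (sqrt (1 - (cmod (lam n))\<^sup>2)) * kern (lam n) z)"
    unfolding tmw_eq[abs_def] by (intro hin_bprod_mult assms H2_cmult kern_H2 lam)
  also have "\<dots> = of_real (sqrt (1 - (cmod (lam n))\<^sup>2)) * hin g (kern (lam n))"
    by (subst hin_cmult_right[OF kern_H2 assms]) (auto simp: lam)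
  finally show ?thesis by (simp add: hin_kern assms lam)
qed

text \<open>For m < N the cofactor of \<open>bprod lam m\<close> in \<open>bprod lam N\<close>
  contains \<open>bfac (lam m)\<close>, which vanishes at the point where
  \<open>hin_bprod_tmw\<close> evaluates.\<close>

lemma hin_bprod_tmw_0:
  assumes g: "g \<in> H2" and m: "m < N"
  shows "hin (\<lambda>z. bprod lam N z * g z) (tmw lam m) = 0"
proof -
  define r where "r z = (\<Prod>k\<in>{Suc m..<N}. bfac (lam k) z)" for z
  define u where "u z = (bfac (lam m) z * r z) * g z" for z
  have "u \<in> H2" unfolding u_def
  proof (rule H2_bounded_mult[OF _ _ g])
    show "(\<lambda>z. bfac (lam m) z * r z) holomorphic_on ball 0 1"
      unfolding r_def by (intro holomorphic_intros bfac_holomorphic lam)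
    show "cmod (bfac (lam m) z * r z) \<le> 1" if "cmod z < 1" for z
      unfolding norm_mult r_def using that
      by (intro mult_le_one) (auto simp: prod_norm[symmetric] prod_nonneg intro!: prod_le_1 norm_bfac_le lam)
  qed
  moreover have "bprod lam N z = bprod lam m z * (bfac (lam m) z * r z)" for z
  proof -
    have "{..<N} = insert m ({..<m} \<union> {Suc m..<N})" using m by auto
    moreover have "(\<Prod>k\<in>{..<m} \<union> {Suc m..<N}. bfac (lam k) z) = (\<Prod>k<m. bfac (lam k) z) * (\<Prod>k\<in>{Suc m..<N}. bfac (lam k) z)"
      by (rule prod.union_disjoint) auto
    ultimately show ?thesis unfolding bprod_def r_def by (simp add: mult_ac)
  qed
  ultimately show ?thesis
    using hin_bprod_tmw[of u m] by (simp add: u_def mult.assoc bfac_def)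
qed

lemma tmw_orthonormal: "hin (tmw lam j) (tmw lam k) = (if j = k then 1 else 0)"
proof -
  have w: "(\<lambda>z. of_real (sqrt (1 - (cmod (lam k))\<^sup>2)) * kern (lam k) z) \<in> H2" for k
    by (intro H2_cmult kern_H2 lam)
  have lt: "hin (tmw lam k) (tmw lam j) = 0" if "j < k" for j k
    using hin_bprod_tmw_0[OF w that, of k] by (simp add: tmw_eq[abs_def])
  have "hin (tmw lam k) (tmw lam k) = 1"
  proof -
    define c where "c = sqrt (1 - (cmod (lam k))\<^sup>2)"
    have c: "c * c = 1 - (cmod (lam k))\<^sup>2" "c > 0" using weight_pos[of k] lam[of k] by (auto simp: c_def)
    have "hin (tmw lam k) (tmw lam k) = of_real c * (of_real c * kern (lam k) (lam k))"
      using hin_bprod_tmw[OF w, of k k] by (simp add: tmw_eq[abs_def] c_def)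
    also have "\<dots> = of_real (c * c) / (1 - of_real ((cmod (lam k))\<^sup>2))"
      using complex_norm_square[of "lam k"] by (simp add: kern_def mult.commute)
    also have "\<dots> = 1" using c by (metis c_def divide_self_if less_irrefl mult_eq_0_iff of_real_1 of_real_diff of_real_eq_0_iff)
    finally show ?thesis .
  qed
  then show ?thesis using lt[of j k] lt[of k j] hin_cnj[of "tmw lam j" "tmw lam k"] by (cases j k rule: linorder_cases) auto
qed

text \<open>One zero is divided out at a time: orthogonality to \<open>tmw lam N\<close> says
  precisely that the current cofactor vanishes at \<open>lam N\<close>. Repeated zeros need no
  separate treatment, and the norm is kept because Blaschke products are unimodular on the
  circle.\<close>

lemma factor_bprod:
  assumes f: "f \<in> H2" and orth: "\<And>k. k < N \<Longrightarrow> hin f (tmw lam k) = 0"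
  shows "\<exists>g\<in>H2. (\<forall>z. cmod z < 1 \<longrightarrow> f z = bprod lam N z * g z) \<and> H2norm g = H2norm f"
proof -
  have "\<exists>g\<in>H2. (\<forall>z. cmod z < 1 \<longrightarrow> f z = bprod lam N z * g z)"
    using orth
  proof (induction N)
    case 0
    show ?case using f by (intro bexI[of _ f]) (auto simp: bprod_def)
  next
    case (Suc N)
    then obtain g where g: "g \<in> H2" "\<And>z. cmod z < 1 \<Longrightarrow> f z = bprod lam N z * g z" by force
    have "hin f (tmw lam N) = hin (\<lambda>z. bprod lam N z * g z) (tmw lam N)" by (rule hin_cong) (auto simp: g)
    then have g0: "g (lam N) = 0"
      using Suc.prems[of N] weight_pos[of N] by (simp add: hin_bprod_tmw g)
    \<comment> \<open>The factor 1 - cnj (lam N) w cancels the denominator of \<open>bfac\<close>,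
      so that \<open>bfac (lam N)\<close> times \<open>q\<close> is w - lam N times the difference
      quotient.\<close>
    define q where "q w = (1 - cnj (lam N) * w) * quot (lam N) g w" for w
    have "q \<in> H2" unfolding q_def
    proof (rule H2_bounded_mult[OF _ _ quot_H2[OF g(1) lam]])
      show "cmod (1 - cnj (lam N) * z) \<le> 2" if "cmod z < 1" for z
      proof -
        have "cmod (cnj (lam N) * z) \<le> 1 * 1" unfolding norm_mult using lam[of N] that by (intro mult_mono) auto
        then show ?thesis using norm_triangle_ineq4[of 1 "cnj (lam N) * z"] by simp
      qed
    qed (intro holomorphic_intros)
    moreover have "f z = bprod lam (Suc N) z * q z" if z: "cmod z < 1" for z
    proof -
      have "bfac (lam N) z * q z = (z - lam N) * quot (lam N) g z"
        using kern_denom(2)[OF lam[of N], of z] z by (simp add: bfac_def q_def)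
      also have "\<dots> = g z" using quot_eq[of g z "lam N"] g0 by simp
      finally show ?thesis using g(2)[OF z] by (simp add: bprod_def mult.assoc)
    qed
    ultimately show ?case by blast
  qed
  then obtain g where g: "g \<in> H2" "\<And>z. cmod z < 1 \<Longrightarrow> f z = bprod lam N z * g z" by blast
  have "hin f f = hin (\<lambda>z. bprod lam N z * g z) (\<lambda>z. bprod lam N z * g z)" by (rule hin_cong) (auto simp: g)
  then have "(H2norm f)\<^sup>2 = (H2norm g)\<^sup>2"
    using hin_bprod_mult[OF g(1) g(1)] f g(1) by (simp only: hin_self of_real_eq_iff)
  then have "H2norm g = H2norm f" by (simp add: power2_eq_iff_nonneg)
  with g show ?thesis by blast
qed

lemma H2norm_tmw_remainder:
  assumes f: "f \<in> H2"
  shows "(H2norm (\<lambda>z. f z - (\<Sum>k<N. c k * tmw lam k z)))\<^sup>2 =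
    (H2norm f)\<^sup>2 - (\<Sum>k<N. (cmod (hin f (tmw lam k)))\<^sup>2) + (\<Sum>k<N. (cmod (hin f (tmw lam k) - c k))\<^sup>2)"
proof -
  define s where "s z = (\<Sum>k<N. c k * tmw lam k z)" for z
  have s: "s \<in> H2" unfolding s_def by (intro H2_sum tmw_H2)
  have d: "(\<lambda>z. f z - s z) \<in> H2" by (intro H2_diff f s)
  have "AE t in circ. bdry f t - (\<Sum>k<N. c k * bdry (tmw lam k) t) = bdry (\<lambda>z. f z - s z) t"
    using AE_bdry_sum[of "{..<N}" "tmw lam" c] AE_bdry_diff[OF f s]
    by (auto simp: tmw_H2 s_def[abs_def] elim!: eventually_elim2)
  then have "l2n (bdry (\<lambda>z. f z - s z)) = l2n (\<lambda>t. bdry f t - (\<Sum>k<N. c k * bdry (tmw lam k) t))"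
    by (intro l2n_AE_cong sqint_diff sqint_sum bdry_sqint f tmw_H2)
  then show ?thesis
    using l2n_orthonormal_remainder[of N "\<lambda>k. bdry (tmw lam k)" "bdry f" c] tmw_orthonormal
    by (simp add: H2norm_l2n[OF d, unfolded s_def] s_def H2norm_l2n[OF f] hin_def bdry_sqint f tmw_H2)
qed

lemma tmw_Bessel:
  assumes f: "f \<in> H2"
  shows "(\<Sum>k<N. (cmod (hin f (tmw lam k)))\<^sup>2) \<le> (H2norm f)\<^sup>2"
proof -
  have "0 \<le> (H2norm (\<lambda>z. f z - (\<Sum>k<N. hin f (tmw lam k) * tmw lam k z)))\<^sup>2" by simp
  then show ?thesis using H2norm_tmw_remainder[OF f, of "\<lambda>k. hin f (tmw lam k)" N] by simp
qed

lemma tmw_coeff_summable: "f \<in> H2 \<Longrightarrow> summable (\<lambda>k. (cmod (hin f (tmw lam k)))\<^sup>2)"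
  using tmw_Bessel by (intro summableI_nonneg_bounded[where x = "(H2norm f)\<^sup>2"]) auto

lemma hin_tmw_sum:
  fixes c :: "nat \<Rightarrow> complex"
  assumes "j < N"
  shows "hin (\<lambda>z. \<Sum>k<N. c k * tmw lam k z) (tmw lam j) = c j"
proof -
  have "hin (\<lambda>z. \<Sum>k<N. c k * tmw lam k z) (tmw lam j) = (\<Sum>k<N. c k * (if k = j then 1 else 0))"
    by (subst hin_sum_left) (auto simp only: tmw_H2 tmw_orthonormal)
  also have "\<dots> = c j" using assms by (simp add: if_distrib cong: if_cong)
  finally show ?thesis .
qed

lemma H2norm_tmw_sum: "(H2norm (\<lambda>z. \<Sum>k<N. c k * tmw lam k z))\<^sup>2 = (\<Sum>k<N. (cmod (c k))\<^sup>2)"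
proof -
  have s: "(\<lambda>z. \<Sum>k<N. c k * tmw lam k z) \<in> H2" by (intro H2_sum tmw_H2)
  have "H2norm (\<lambda>z. 0) = 0" using H2norm_cmult[OF H2_one, of 0] by simp
  then show ?thesis using H2norm_tmw_remainder[OF s, of c N] by (simp add: hin_tmw_sum)
qed

text \<open>The remainder after projecting onto the first \<open>N\<close> basis functions is divisible by
  \<open>bprod lam N\<close> and orthogonal to all its multiples.\<close>

lemma tmw_finite_span:
  assumes f: "f \<in> H2" and orth: "\<And>g. g \<in> H2 \<Longrightarrow> hin f (\<lambda>z. bprod lam N z * g z) = 0" and z: "cmod z < 1"
  shows "f z = (\<Sum>k<N. hin f (tmw lam k) * tmw lam k z)"
proof -
  define s where "s z = (\<Sum>k<N. hin f (tmw lam k) * tmw lam k z)" for z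
  have s: "s \<in> H2" unfolding s_def by (intro H2_sum tmw_H2)
  define d where "d z = f z - s z" for z
  have d: "d \<in> H2" unfolding d_def by (intro H2_diff f s)
  have sj: "hin s (tmw lam j) = hin f (tmw lam j)" if "j < N" for j
    unfolding s_def by (rule hin_tmw_sum[OF that])
  have "hin d (tmw lam j) = 0" if "j < N" for j
    unfolding d_def using sj[OF that] by (simp add: hin_diff_left f s tmw_H2)
  then obtain g where g: "g \<in> H2" "\<And>z. cmod z < 1 \<Longrightarrow> d z = bprod lam N z * g z"
    using factor_bprod[OF d] by blast
  have "hin s (\<lambda>z. bprod lam N z * g z) = (\<Sum>k<N. hin f (tmw lam k) * hin (tmw lam k) (\<lambda>z. bprod lam N z * g z))"
    unfolding s_def by (rule hin_sum_left) (auto simp: tmw_H2 bprod_mult_H2 g)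
  also have "\<dots> = 0"
    using hin_bprod_tmw_0[OF g(1)] hin_cnj[of "tmw lam _"] by (intro sum.neutral) simp
  finally have "hin d (\<lambda>z. bprod lam N z * g z) = 0"
    unfolding d_def using orth[OF g(1)] by (simp add: hin_diff_left f s bprod_mult_H2 g)
  moreover have "hin d d = hin d (\<lambda>z. bprod lam N z * g z)" by (rule hin_cong) (auto simp: g)
  ultimately have "H2norm d = 0" using hin_self[OF d] by simp
  from H2norm_eq_0_imp[OF d this z] show ?thesis by (simp add: d_def s_def)
qed

end

text \<open>Dense bounded functions with explicit sup bounds: only for bounded q is the product of q
  with \<open>h\<close> certain to lie in H^2.\<close>

lemma taylor_polynomial_approx:
  assumes p: "p \<in> H2"
  obtains q K where "\<And>N. q N holomorphic_on ball 0 1" "\<And>N z. cmod z < 1 \<Longrightarrow> cmod (q N z) \<le> K N"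
    "(\<lambda>N. H2norm (\<lambda>z. p z - q N z)) \<longlonglongrightarrow> 0"
proof -
  define q where "q N z = (\<Sum>n<N. taylor p n * z ^ n)" for N z
  define K where "K N = (\<Sum>n<N. cmod (taylor p n))" for N
  have qh: "q N holomorphic_on ball 0 1" for N unfolding q_def by (intro holomorphic_intros)
  have qK: "cmod (q N z) \<le> K N" if "cmod z < 1" for N z
    unfolding q_def K_def using that
    by (intro order_trans[OF norm_sum] sum_mono) (auto simp: norm_mult norm_power intro!: mult_left_le power_le_one)
  have qH: "q N \<in> H2" for N by (rule H2_bounded[OF qh qK])
  have le: "H2norm (\<lambda>z. p z - q N z) \<le> sqrt (taylor_tail p N)" for N
  proof -
    have bq: "bdry (q N) t = (\<Sum>n<N. taylor p n * cis (real n * t))" for t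
    proof -
      have "bdry (q N) t = q N (cis t)" by (rule bdry_continuous) (auto simp: q_def intro!: continuous_intros)
      then show ?thesis by (simp only: q_def Complex.DeMoivre)
    qed
    have "l2n (bdry (\<lambda>z. p z - q N z)) = l2n (\<lambda>t. bdry p t - bdry (q N) t)"
      by (rule l2n_AE_cong[OF _ AE_bdry_diff[OF p qH]]) (intro sqint_diff bdry_sqint p qH)
    then have "H2norm (\<lambda>z. p z - q N z) = l2n (\<lambda>t. bdry p t - (\<Sum>n<N. taylor p n * cis (real n * t)))"
      by (simp add: H2norm_l2n H2_diff p qH bq)
    then show ?thesis using l2n_bdry_tail[OF p, of N] by (simp add: real_le_rsqrt)
  qed
  have lim: "(\<lambda>N. sqrt (taylor_tail p N)) \<longlonglongrightarrow> 0"
    using tendsto_real_sqrt[OF taylor_tail_tendsto[OF p]] by simp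
  have "(\<lambda>N. H2norm (\<lambda>z. p z - q N z)) \<longlonglongrightarrow> 0"
    by (rule Lim_null_comparison[OF _ lim]) (simp add: le)
  then show ?thesis using that[of q K] qh qK by blast
qed

text \<open>For bounded f, conj(h) f is square integrable and \<open>g\<close> is its Szego
  projection. Paired with a bounded function, conj(h) moves to the other side as h. For the last
  claim take a bounded q: h (b q) = b (q h) is again a multiple of \<open>b\<close>, so
  orthogonality of f applies; general p follows by density. With \<open>b\<close> = I this shows
  that K_I is preserved, with \<open>b\<close> = \<open>bprod\<close> that the finite spans
  are.\<close>

lemma toep_of_bounded:
  assumes f: "f holomorphic_on ball 0 1" "\<And>z. cmod z < 1 \<Longrightarrow> cmod (f z) \<le> K" and h: "h \<in> H2"
  obtains g where "g \<in> H2" "\<And>z. cmod z < 1 \<Longrightarrow> g z = toep h f z"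
    "\<And>k. k \<in> H2 \<Longrightarrow> hin g k = L2inner (\<lambda>t. cnj (bdry h t) * bdry f t) (bdry k)"
    "\<And>b p. b holomorphic_on ball 0 1 \<Longrightarrow> (\<And>z. cmod z < 1 \<Longrightarrow> cmod (b z) \<le> 1) \<Longrightarrow>
       (\<And>p. p \<in> H2 \<Longrightarrow> hin f (\<lambda>z. b z * p z) = 0) \<Longrightarrow> p \<in> H2 \<Longrightarrow> hin g (\<lambda>z. b z * p z) = 0"
proof -
  have fH: "f \<in> H2" by (rule H2_bounded[OF f])
  define \<phi> where "\<phi> t = cnj (bdry h t) * bdry f t" for t
  have cnjh: "(\<lambda>t. cnj (bdry h t)) \<in> sqint"
    using bdry_sqint[OF h] unfolding sqint_def by (auto intro: measurable_cnj)
  have bf: "AE t in circ. cmod (bdry f t) \<le> K" by (rule AE_norm_bdry_le[OF fH f(2)])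
  have \<phi>: "\<phi> \<in> sqint" unfolding \<phi>_def
    using sqint_mult_bounded[OF cnjh sqint_measurable[OF bdry_sqint[OF fH]] bf] by (simp add: mult.commute)
  obtain g where g: "g \<in> H2" "\<And>k. k \<in> H2 \<Longrightarrow> hin g k = L2inner \<phi> (bdry k)"
    using szego_projection[OF \<phi>] by blast
  have gb: "hin g k = hin f (\<lambda>w. h w * k w)"
    if k: "k holomorphic_on ball 0 1" "\<And>z. cmod z < 1 \<Longrightarrow> cmod (k z) \<le> L" for k L
  proof -
    have kH: "k \<in> H2" by (rule H2_bounded[OF k])
    have hk: "(\<lambda>w. h w * k w) \<in> H2" using H2_bounded_mult[OF k h] by (simp add: mult.commute)
    have "AE t in circ. \<phi> t * cnj (bdry k t) = bdry f t * cnj (bdry (\<lambda>w. h w * k w) t)"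
      using AE_bdry_mult[OF h kH] by eventually_elim (simp add: \<phi>_def flip: complex_cnj_mult)
    then have "L2inner \<phi> (bdry k) = L2inner (bdry f) (bdry (\<lambda>w. h w * k w))"
      by (intro L2inner_AE_cong \<phi> bdry_sqint kH fH hk)
    then show ?thesis using g(2)[OF kH] by (simp add: hin_def)
  qed
  show ?thesis
  proof (rule that)
    show "g \<in> H2" by (rule g)
    show "hin g k = L2inner (\<lambda>t. cnj (bdry h t) * bdry f t) (bdry k)" if "k \<in> H2" for k
      using g(2)[OF that] by (simp add: \<phi>_def[abs_def])
    show "g z = toep h f z" if z: "cmod z < 1" for z
      using gb[OF kern_holomorphic[OF z] kern_bound[OF z]] hin_kern[OF g(1) z] by (simp add: toep_def)
    fix b p :: "complex \<Rightarrow> complex"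
    assume b: "b holomorphic_on ball 0 1" "\<And>z. cmod z < 1 \<Longrightarrow> cmod (b z) \<le> 1"
      and orth: "\<And>p. p \<in> H2 \<Longrightarrow> hin f (\<lambda>z. b z * p z) = 0" and p: "p \<in> H2"
    obtain q L where q: "\<And>N. q N holomorphic_on ball 0 1" "\<And>N z. cmod z < 1 \<Longrightarrow> cmod (q N z) \<le> L N"
      and qlim: "(\<lambda>N. H2norm (\<lambda>z. p z - q N z)) \<longlonglongrightarrow> 0"
      using taylor_polynomial_approx[OF p] by blast
    have qH: "q N \<in> H2" for N by (rule H2_bounded[OF q(1) q(2)])
    have bH: "(\<lambda>z. b z * u z) \<in> H2" if "u \<in> H2" for u by (rule H2_bounded_mult[OF b that])
    have bq: "hin g (\<lambda>z. b z * q N z) = 0" for N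
    proof -
      have "hin g (\<lambda>z. b z * q N z) = hin f (\<lambda>w. h w * (b w * q N w))"
      proof (rule gb)
        show "(\<lambda>z. b z * q N z) holomorphic_on ball 0 1" by (intro holomorphic_intros b q)
        show "cmod (b z * q N z) \<le> 1 * L N" if "cmod z < 1" for z
          unfolding norm_mult by (intro mult_mono b q that) auto
      qed
      also have "\<dots> = hin f (\<lambda>w. b w * (q N w * h w))" by (simp add: mult_ac)
      also have "\<dots> = 0" by (rule orth, rule H2_bounded_mult[OF q(1) q(2) h])
      finally show ?thesis .
    qed
    have "(\<lambda>N. H2norm (\<lambda>z. b z * q N z - b z * p z)) \<longlonglongrightarrow> 0"
    proof (rule Lim_null_comparison[OF _ qlim])
      have "H2norm (\<lambda>z. b z * (p z - q N z)) \<le> 1 * H2norm (\<lambda>z. p z - q N z)" for N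
        by (intro H2norm_bounded_mult_le b H2_diff p qH)
      then show "\<forall>\<^sub>F N in sequentially. norm (H2norm (\<lambda>z. b z * q N z - b z * p z)) \<le> H2norm (\<lambda>z. p z - q N z)"
        using H2norm_minus_commute[OF bH[OF p] bH[OF qH]] by (simp add: right_diff_distrib)
    qed
    from hin_tendsto_left[OF bH[OF qH] bH[OF p] g(1) this]
    have "hin (\<lambda>z. b z * p z) g = 0"
      using bq hin_cnj[of _ g] by (simp add: LIMSEQ_const_iff)
    then show "hin g (\<lambda>z. b z * p z) = 0" by (subst hin_cnj) simp
  qed
qed

section \<open>Model spaces of Blaschke products\<close>

text \<open>\<open>J N\<close> is the tail of the Blaschke product \<open>I\<close> after its first \<open>N\<close> factors.\<close>

locale blaschke_model =
  fixes lam :: "nat \<Rightarrow> complex" and I :: "complex \<Rightarrow> complex" and J :: "nat \<Rightarrow> complex \<Rightarrow> complex"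
  assumes lam: "cmod (lam n) < 1"
    and J_holomorphic: "J N holomorphic_on ball 0 1"
    and norm_J_le: "cmod z < 1 \<Longrightarrow> cmod (J N z) \<le> 1"
    and I_eq: "cmod z < 1 \<Longrightarrow> I z = bprod lam N z * J N z"
    and norm_J_tendsto: "cmod z < 1 \<Longrightarrow> (\<lambda>N. cmod (J N z)) \<longlonglongrightarrow> 1"
begin

lemmas tmw_facts = tmw_H2[OF lam] tmw_holomorphic[OF lam] tmw_continuous[OF lam]

lemma I_eq_J0: "cmod z < 1 \<Longrightarrow> I z = J 0 z"
  using I_eq[of z 0] by (simp add: bprod_def)

lemma I_holomorphic: "I holomorphic_on ball 0 1"
  by (rule holomorphic_transform[OF J_holomorphic[of 0]]) (simp add: I_eq_J0)

lemma norm_I_le: "cmod z < 1 \<Longrightarrow> cmod (I z) \<le> 1"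
  using norm_J_le[of z 0] by (simp add: I_eq_J0)

lemma I_mult_H2: "f \<in> H2 \<Longrightarrow> (\<lambda>z. I z * f z) \<in> H2"
  by (rule H2_bounded_mult[OF I_holomorphic norm_I_le])

lemma J_mult_H2: "f \<in> H2 \<Longrightarrow> (\<lambda>z. J N z * f z) \<in> H2"
  by (rule H2_bounded_mult[OF J_holomorphic norm_J_le])

lemma model_space_iff: "f \<in> model_space I \<longleftrightarrow> f \<in> H2 \<and> (\<forall>g\<in>H2. hin f (\<lambda>z. I z * g z) = 0)"
  by (simp add: model_space_def hin_def)

lemma model_space_H2: "f \<in> model_space I \<Longrightarrow> f \<in> H2"
  by (simp add: model_space_iff)

lemma model_space_cong: 
  assumes "f \<in> model_space I" "\<And>z. cmod z < 1 \<Longrightarrow> g z = f z"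
  shows "g \<in> model_space I"
  using assms H2_cong[of f g] hin_cong[of g f] by (auto simp: model_space_iff)

lemma model_space_diff: "f \<in> model_space I \<Longrightarrow> g \<in> model_space I \<Longrightarrow> (\<lambda>z. f z - g z) \<in> model_space I"
  by (simp add: model_space_iff H2_diff hin_diff_left I_mult_H2)

lemma model_space_sum: "(\<And>k. k \<in> A \<Longrightarrow> u k \<in> model_space I) \<Longrightarrow> (\<lambda>z. \<Sum>k\<in>A. c k * u k z) \<in> model_space I"
  by (simp add: model_space_iff H2_sum hin_sum_left I_mult_H2)

lemma model_space_closed:
  assumes fs: "\<And>n. fs n \<in> model_space I" and f: "f \<in> H2"
    and lim: "(\<lambda>n. H2norm (\<lambda>z. fs n z - f z)) \<longlonglongrightarrow> 0"
  shows "f \<in> model_space I"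
  unfolding model_space_iff
proof (intro conjI ballI f)
  fix g assume g: "g \<in> H2"
  define u where "u z = I z * g z" for z
  have u: "u \<in> H2" unfolding u_def by (rule I_mult_H2[OF g])
  have "hin (fs n) u = 0" for n using fs[of n] g by (simp add: model_space_iff u_def[abs_def])
  then have "hin f u = 0"
    using hin_tendsto_left[OF model_space_H2[OF fs] f u lim] by (simp add: LIMSEQ_const_iff)
  then show "hin f (\<lambda>z. I z * g z) = 0" by (simp add: u_def[abs_def])
qed

text \<open>\<open>I\<close> is divisible by \<open>bprod lam (Suc m)\<close>, and
  \<open>tmw lam m\<close> is orthogonal to all multiples of that product.\<close>

lemma tmw_model: "tmw lam m \<in> model_space I"
  unfolding model_space_iff
proof (intro conjI ballI tmw_facts)
  fix g assume g: "g \<in> H2"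
  have "hin (tmw lam m) (\<lambda>z. I z * g z) = hin (tmw lam m) (\<lambda>z. bprod lam (Suc m) z * (J (Suc m) z * g z))"
    by (rule hin_cong) (auto simp: I_eq[of _ "Suc m"] mult.assoc)
  also have "\<dots> = cnj (hin (\<lambda>z. bprod lam (Suc m) z * (J (Suc m) z * g z)) (tmw lam m))" by (rule hin_cnj)
  also have "\<dots> = 0" by (subst hin_bprod_tmw_0[OF lam J_mult_H2[OF g]]) auto
  finally show "hin (tmw lam m) (\<lambda>z. I z * g z) = 0" .
qed

lemma tmw_bdd_model: "(\<lambda>z. \<Sum>k<N. c k * tmw lam k z) \<in> bdd_model I"
proof -
  have "continuous_on (cball 0 1) (\<lambda>z. \<Sum>k<N. c k * tmw lam k z)"
    by (intro continuous_intros tmw_facts)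
  then have "bounded ((\<lambda>z. \<Sum>k<N. c k * tmw lam k z) ` cball 0 1)"
    by (intro compact_imp_bounded compact_continuous_image) auto
  then have "bounded ((\<lambda>z. \<Sum>k<N. c k * tmw lam k z) ` ball 0 1)"
    by (rule bounded_subset) auto
  then show ?thesis by (simp add: bdd_model_def model_space_sum tmw_model)
qed

text \<open>A function in \<open>K_I\<close> orthogonal to the basis is \<open>B_N g_N\<close> with \<open>g_N \<in> K_(J_N)\<close>, and the
  reproducing kernel of \<open>K_(J_N)\<close> at \<open>z\<close> has square norm \<open>(1 - |J_N(z)|^2) / (1 - |z|^2)\<close>, which tends to 0.\<close>

lemma tmw_complete:
  assumes f: "f \<in> model_space I" and orth: "\<And>k. hin f (tmw lam k) = 0" and z: "cmod z < 1"
  shows "f z = 0"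
proof -
  note fH = model_space_H2[OF f]
  define \<kappa> where "\<kappa> = (H2norm (kern z))\<^sup>2"
  have k: "kern z \<in> H2" by (rule kern_H2[OF z])
  have b: "cmod (f z) \<le> H2norm f * sqrt (\<kappa> * (1 - (cmod (J N z))\<^sup>2))" for N
  proof -
    obtain g where g: "g \<in> H2" "\<And>z. cmod z < 1 \<Longrightarrow> f z = bprod lam N z * g z" "H2norm g = H2norm f"
      using factor_bprod[OF lam fH orth] by blast
    define w where "w = J N z"
    define Jk where "Jk u = J N u * kern z u" for u
    have Jk: "Jk \<in> H2" unfolding Jk_def by (rule J_mult_H2[OF k])
    have "hin g Jk = hin (\<lambda>u. bprod lam N u * g u) (\<lambda>u. bprod lam N u * Jk u)"
      by (rule hin_bprod_mult[OF lam g(1) Jk, symmetric])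
    also have "\<dots> = hin f (\<lambda>u. I u * kern z u)"
      by (rule hin_cong) (auto simp: g(2) I_eq[of _ N] Jk_def mult.assoc)
    also have "\<dots> = 0" using f k by (simp add: model_space_iff)
    finally have gJ: "hin g Jk = 0" .
    define d where "d u = kern z u - cnj w * Jk u" for u
    have d: "d \<in> H2" unfolding d_def by (intro H2_diff k H2_cmult Jk)
    have "g z = hin g d" unfolding d_def
      by (simp add: hin_diff_right hin_cmult_right k Jk H2_cmult g gJ hin_kern z)
    then have 1: "cmod (g z) \<le> H2norm f * H2norm d" using hin_Cauchy_Schwarz[OF g(1) d] g(3) by simp
    have kk: "hin (kern z) (kern z) = of_real \<kappa>" unfolding \<kappa>_def by (rule hin_self[OF k])
    have "hin Jk (kern z) = w * kern z z" using hin_kern[OF Jk z] by (simp add: Jk_def w_def)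
    then have Jkk: "hin Jk (kern z) = w * of_real \<kappa>" using kk hin_kern[OF k z] by simp
    then have kJk: "hin (kern z) Jk = cnj w * of_real \<kappa>" by (subst hin_cnj) simp
    have "of_real ((H2norm d)\<^sup>2) = hin d d" by (rule hin_self[OF d, symmetric])
    also have "\<dots> = hin (kern z) (kern z) - cnj w * hin Jk (kern z) - w * (hin (kern z) Jk - cnj w * hin Jk Jk)"
      unfolding d_def
      by (simp add: hin_diff_right hin_diff_left hin_cmult_right hin_cmult_left k Jk H2_cmult H2_diff right_diff_distrib)
    also have "\<dots> = of_real (\<kappa> - 2 * (cmod w)\<^sup>2 * \<kappa> + (cmod w)\<^sup>2 * (H2norm Jk)\<^sup>2)"
      unfolding kk Jkk kJk hin_self[OF Jk] of_real_add of_real_diff of_real_mult complex_norm_square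
      by (simp add: algebra_simps)
    finally have "(H2norm d)\<^sup>2 = \<kappa> - 2 * (cmod w)\<^sup>2 * \<kappa> + (cmod w)\<^sup>2 * (H2norm Jk)\<^sup>2"
      by (simp only: of_real_eq_iff)
    \<comment> \<open>Contractivity of multiplication by \<open>J N\<close> bounds the norm of the
      kernel \<open>d\<close> from above, which is all that the estimate of g(z) uses.\<close>
    moreover have "H2norm Jk \<le> 1 * H2norm (kern z)"
      unfolding Jk_def by (rule H2norm_bounded_mult_le[OF J_holomorphic norm_J_le k])
    then have "(H2norm Jk)\<^sup>2 \<le> \<kappa>" unfolding \<kappa>_def by (simp add: power_mono)
    then have "(cmod w)\<^sup>2 * (H2norm Jk)\<^sup>2 \<le> (cmod w)\<^sup>2 * \<kappa>" by (rule mult_left_mono) simp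
    ultimately have "(H2norm d)\<^sup>2 \<le> \<kappa> * (1 - (cmod w)\<^sup>2)" by (simp add: algebra_simps)
    then have "H2norm d \<le> sqrt (\<kappa> * (1 - (cmod w)\<^sup>2))" by (rule real_le_rsqrt)
    with 1 have "cmod (g z) \<le> H2norm f * sqrt (\<kappa> * (1 - (cmod w)\<^sup>2))"
      by (meson H2norm_nonneg mult_left_mono order_trans)
    moreover have "cmod (f z) \<le> 1 * cmod (g z)"
      unfolding g(2)[OF z] norm_mult using z by (intro mult_right_mono norm_bprod_le[OF lam]) auto
    ultimately show ?thesis by (simp add: w_def)
  qed
  have "(\<lambda>N. H2norm f * sqrt (\<kappa> * (1 - (cmod (J N z))\<^sup>2))) \<longlonglongrightarrow> H2norm f * sqrt (\<kappa> * (1 - 1\<^sup>2))"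
    by (intro tendsto_intros norm_J_tendsto z)
  then have "cmod (f z) \<le> H2norm f * sqrt (\<kappa> * (1 - 1\<^sup>2))"
    by (rule tendsto_lowerbound) (use b in \<open>auto intro: always_eventually\<close>)
  then show ?thesis by simp
qed

lemma tmw_series:
  assumes c: "summable (\<lambda>k. (cmod (c k))\<^sup>2)"
  shows "\<exists>f\<in>model_space I. (\<lambda>N. H2norm (\<lambda>z. (\<Sum>k<N. c k * tmw lam k z) - f z)) \<longlonglongrightarrow> 0 \<and>
    (\<forall>k. hin f (tmw lam k) = c k)"
proof -
  define s where "s N z = (\<Sum>k<N. c k * tmw lam k z)" for N z
  have sM: "s N \<in> model_space I" for N unfolding s_def by (intro model_space_sum tmw_model)
  note sH = model_space_H2[OF sM]
  have nrm: "(H2norm (\<lambda>z. s n z - s m z))\<^sup>2 = (\<Sum>k\<in>{m..<n}. (cmod (c k))\<^sup>2)" if "m \<le> n" for m n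
  proof -
    have "s n z - s m z = (\<Sum>k<n. (if k < m then 0 else c k) * tmw lam k z)" for z
    proof -
      have "s n z = s m z + (\<Sum>k\<in>{m..<n}. c k * tmw lam k z)"
        unfolding s_def lessThan_atLeast0 using that by (intro sum.atLeastLessThan_concat[symmetric]) auto
      moreover have "(\<Sum>k<n. (if k < m then 0 else c k) * tmw lam k z) = (\<Sum>k\<in>{m..<n}. c k * tmw lam k z)"
        by (intro sum.mono_neutral_cong_right) auto
      ultimately show ?thesis by simp
    qed
    then have "(H2norm (\<lambda>z. s n z - s m z))\<^sup>2 = (\<Sum>k<n. (cmod (if k < m then 0 else c k))\<^sup>2)"
      using H2norm_tmw_sum[OF lam, where c = "\<lambda>k. if k < m then 0 else c k" and N = n] by simp
    also have "\<dots> = (\<Sum>k\<in>{m..<n}. (cmod (c k))\<^sup>2)" by (intro sum.mono_neutral_cong_right) auto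
    finally show ?thesis .
  qed
  have "\<exists>M. \<forall>m\<ge>M. \<forall>n\<ge>M. H2norm (\<lambda>z. s m z - s n z) \<le> e" if e: "e > 0" for e
  proof -
    have "e\<^sup>2 > 0" using e by simp
    then obtain M where M: "\<And>m n. m \<ge> M \<Longrightarrow> norm (\<Sum>k\<in>{m..<n}. (cmod (c k))\<^sup>2) < e\<^sup>2"
      using c unfolding summable_Cauchy by blast
    have le: "H2norm (\<lambda>z. s n z - s m z) \<le> e" if "m \<ge> M" "m \<le> n" for m n
    proof (rule power2_le_imp_le)
      show "(H2norm (\<lambda>z. s n z - s m z))\<^sup>2 \<le> e\<^sup>2" unfolding nrm[OF that(2)] using M[OF that(1), of n] by simp
    qed (use e in simp)
    have "H2norm (\<lambda>z. s m z - s n z) \<le> e" if "m \<ge> M" "n \<ge> M" for m n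
      using le[of m n] le[of n m] that H2norm_minus_commute[OF sH[of m] sH[of n]] by (cases "m \<le> n") auto
    then show ?thesis by blast
  qed
  then obtain f where f: "f \<in> H2" "(\<lambda>n. H2norm (\<lambda>z. s n z - f z)) \<longlonglongrightarrow> 0"
    using H2_complete[of s, OF sH] by blast
  have "hin f (tmw lam k) = c k" for k
  proof -
    have "\<forall>\<^sub>F n in sequentially. hin (s n) (tmw lam k) = c k"
      using eventually_gt_at_top[of k]
      by eventually_elim (auto simp: s_def[abs_def] intro: hin_tmw_sum[of lam, OF lam])
    then have "(\<lambda>n. c k) \<longlonglongrightarrow> hin f (tmw lam k)"
      using hin_tendsto_left[of s, OF sH f(1) _ f(2), of "tmw lam k"] tmw_facts(1) by (simp add: tendsto_cong)
    then show ?thesis by (simp add: tendsto_const_iff)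
  qed
  then show ?thesis using model_space_closed[OF sM f] f(2) by (intro bexI[of _ f] conjI allI) (simp_all add: s_def[abs_def])
qed

text \<open>The sum of the series has the same coefficients as \<open>f\<close>, so the difference
  vanishes on the disk by \<open>tmw_complete\<close>. Off the disk the two may differ, which does
  not affect \<open>H2norm\<close>.\<close>

lemma tmw_expansion:
  assumes f: "f \<in> model_space I"
  shows "(\<lambda>N. H2norm (\<lambda>z. (\<Sum>k<N. hin f (tmw lam k) * tmw lam k z) - f z)) \<longlonglongrightarrow> 0"
proof -
  note fH = model_space_H2[OF f]
  obtain g where g: "g \<in> model_space I" "(\<lambda>N. H2norm (\<lambda>z. (\<Sum>k<N. hin f (tmw lam k) * tmw lam k z) - g z)) \<longlonglongrightarrow> 0"
    "\<And>k. hin g (tmw lam k) = hin f (tmw lam k)"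
    using tmw_series[OF tmw_coeff_summable[of lam, OF lam fH]] by auto
  have "f z - g z = 0" if "cmod z < 1" for z
    by (rule tmw_complete[OF model_space_diff[OF f g(1)] _ that])
       (simp add: hin_diff_left fH model_space_H2 g tmw_facts)
  then have "H2norm (\<lambda>z. (\<Sum>k<N. hin f (tmw lam k) * tmw lam k z) - f z) =
      H2norm (\<lambda>z. (\<Sum>k<N. hin f (tmw lam k) * tmw lam k z) - g z)" for N
    by (intro H2norm_cong) auto
  then show ?thesis using g(2) by simp
qed

text \<open>Existence in the definite description: the Szego projection of conj(h) f is orthogonal
  to I H^2, so it is already the projection onto K_I. Uniqueness: the difference of two candidates
  lies in K_I and is orthogonal to itself, and both vanish off the disk.\<close>

lemma
  assumes f: "f \<in> bdd_model I" and h: "h \<in> H2"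
  shows tto_eq: "tto I h f = (\<lambda>z. if cmod z < 1 then toep h f z else 0)"
    and tto_model: "tto I h f \<in> model_space I"
proof -
  have fM: "f \<in> model_space I" and "bounded (f ` ball 0 1)" using f by (auto simp: bdd_model_def)
  then obtain K where "\<forall>x\<in>ball 0 1. cmod (f x) \<le> K" unfolding bounded_iff by auto
  then have K: "cmod (f z) \<le> K" if "cmod z < 1" for z using that by simp
  note fH = model_space_H2[OF fM]
  obtain g where g: "g \<in> H2" "\<And>z. cmod z < 1 \<Longrightarrow> g z = toep h f z"
    and gk: "\<And>k. k \<in> H2 \<Longrightarrow> hin g k = L2inner (\<lambda>t. cnj (bdry h t) * bdry f t) (bdry k)"
    and gb: "\<And>b p. b holomorphic_on ball 0 1 \<Longrightarrow> (\<And>z. cmod z < 1 \<Longrightarrow> cmod (b z) \<le> 1) \<Longrightarrow>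
       (\<And>p. p \<in> H2 \<Longrightarrow> hin f (\<lambda>z. b z * p z) = 0) \<Longrightarrow> p \<in> H2 \<Longrightarrow> hin g (\<lambda>z. b z * p z) = 0"
    using toep_of_bounded[OF H2_holomorphic[OF fH] K h] by blast
  have gM: "g \<in> model_space I"
    unfolding model_space_iff using g(1) gb[OF I_holomorphic norm_I_le] fM by (auto simp: model_space_iff)
  define G where "G z = (if cmod z < 1 then toep h f z else 0)" for z
  have Gg: "G z = g z" if "cmod z < 1" for z using that g(2) by (simp add: G_def)
  have GM: "G \<in> model_space I" by (rule model_space_cong[OF gM Gg])
  have Gk: "L2inner (bdry G) (bdry k) = L2inner (\<lambda>t. cnj (bdry h t) * bdry f t) (bdry k)" if "k \<in> H2" for k
    using gk[OF that] bdry_cong[of G g] Gg by (simp add: hin_def)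
  have "tto I h f = G" unfolding tto_def
  proof (rule the_equality)
    show "G \<in> model_space I \<and> (\<forall>z. z \<notin> ball 0 1 \<longrightarrow> G z = 0) \<and>
      (\<forall>k\<in>model_space I. L2inner (bdry G) (bdry k) = L2inner (\<lambda>t. cnj (bdry h t) * bdry f t) (bdry k))"
      using GM Gk model_space_H2 by (auto simp: G_def)
  next
    fix g' assume g': "g' \<in> model_space I \<and> (\<forall>z. z \<notin> ball 0 1 \<longrightarrow> g' z = 0) \<and>
      (\<forall>k\<in>model_space I. L2inner (bdry g') (bdry k) = L2inner (\<lambda>t. cnj (bdry h t) * bdry f t) (bdry k))"
    define d where "d z = g' z - G z" for z
    have d: "d \<in> model_space I" unfolding d_def using g' GM by (intro model_space_diff) auto
    have "hin d d = hin g' d - hin G d"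
      unfolding d_def using model_space_H2 g' GM d by (intro hin_diff_left) (auto simp: d_def[abs_def])
    also have "\<dots> = 0" using g' d Gk[OF model_space_H2[OF d]] by (simp add: hin_def)
    finally have "H2norm d = 0" using hin_self[OF model_space_H2[OF d]] by simp
    then have "d z = 0" if "cmod z < 1" for z using H2norm_eq_0_imp[OF model_space_H2[OF d] _ that] by simp
    then have "g' z = G z" for z using g' by (cases "cmod z < 1") (auto simp: d_def G_def)
    then show "g' = G" by (rule ext)
  qed
  then show "tto I h f = (\<lambda>z. if cmod z < 1 then toep h f z else 0)" "tto I h f \<in> model_space I"
    using GM by (auto simp: G_def[abs_def])
qed

lemma tto_tmw: "h \<in> H2 \<Longrightarrow> cmod z < 1 \<Longrightarrow> tto I h (tmw lam k) z = toep h (tmw lam k) z"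
proof -
  have "(\<lambda>z. \<Sum>j<Suc k. (if j = k then 1 else 0) * tmw lam j z) = tmw lam k"
    by (simp add: fun_eq_iff if_distrib[of "\<lambda>x. x * _"] cong: if_cong)
  then have "tmw lam k \<in> bdd_model I" using tmw_bdd_model[of "\<lambda>j. if j = k then 1 else 0" "Suc k"] by simp
  then show "h \<in> H2 \<Longrightarrow> cmod z < 1 \<Longrightarrow> tto I h (tmw lam k) z = toep h (tmw lam k) z" by (simp add: tto_eq)
qed

end

section \<open>Convergence of Blaschke products\<close>

definition bsign :: "complex \<Rightarrow> complex" where
  "bsign l = (if l = 0 then 1 else - of_real (cmod l) / l)"

lemma norm_bsign: "cmod (bsign l) = 1"
  by (simp add: bsign_def norm_divide)

lemma blaschke_factor_bfac: "blaschke_factor l z = bsign l * bfac l z"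
  by (simp add: blaschke_factor_def bsign_def bfac_def divide_simps) (simp add: algebra_simps)

lemma norm_blaschke_factor_le: "cmod l < 1 \<Longrightarrow> cmod z \<le> 1 \<Longrightarrow> cmod (blaschke_factor l z) \<le> 1"
  by (simp add: blaschke_factor_bfac norm_mult norm_bsign norm_bfac_le)

text \<open>The numerator factors: |l| (l - z) - l (1 - cnj l z) = -(1 - |l|) (l + |l| z). The last
  factor is at most 2 |l|, so |l| cancels against the denominator and small zeros do no
  harm.\<close>

lemma norm_blaschke_factor_minus_1:
  assumes l: "cmod l < 1" and z: "cmod z \<le> r" and r: "r < 1"
  shows "cmod (blaschke_factor l z - 1) \<le> 2 / (1 - r) * (1 - cmod l)"
proof (cases "l = 0")
  case True
  have "0 \<le> r" using z norm_ge_zero[of z] by linarith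
  have "cmod (z - 1) \<le> 1 + 1" using norm_triangle_ineq4[of z 1] z r by simp
  also have "\<dots> \<le> 2 / (1 - r)" using r \<open>0 \<le> r\<close> by (simp add: field_simps)
  finally show ?thesis using True by (simp add: blaschke_factor_def)
next
  case False
  have nz: "1 - cnj l * z \<noteq> 0" by (rule kern_denom(2)[OF l]) (use z r in simp)
  have "cmod (cnj l * z) \<le> 1 * r"
    unfolding norm_mult using l z by (intro mult_mono) auto
  then have ge: "1 - r \<le> cmod (1 - cnj l * z)" using norm_triangle_ineq2[of 1 "cnj l * z"] by simp
  have "l * cnj l = of_real (cmod l) * of_real (cmod l)" by (simp add: complex_norm_square[symmetric] power2_eq_square)
  then have "of_real (cmod l) * (l - z) - l * (1 - cnj l * z) = - (of_real (1 - cmod l) * (l + of_real (cmod l) * z))"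
    by (simp add: algebra_simps)
  moreover have "blaschke_factor l z - 1 = (of_real (cmod l) * (l - z) - l * (1 - cnj l * z)) / (l * (1 - cnj l * z))"
    using False nz by (simp add: blaschke_factor_def diff_divide_distrib)
  ultimately have "cmod (blaschke_factor l z - 1) = (1 - cmod l) * cmod (l + of_real (cmod l) * z) / (cmod l * cmod (1 - cnj l * z))"
    using l by (simp only: norm_divide norm_minus_cancel norm_mult norm_of_real)
  also have "\<dots> \<le> (1 - cmod l) * (cmod l * 2) / (cmod l * (1 - r))"
  proof (intro frac_le mult_left_mono ge)
    have "cmod (l + of_real (cmod l) * z) \<le> cmod l + cmod l * cmod z"
      using norm_triangle_ineq[of l "of_real (cmod l) * z"] by (simp add: norm_mult)
    also have "\<dots> \<le> cmod l + cmod l * 1" using z r by (intro add_left_mono mult_left_mono) auto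
    finally show "cmod (l + of_real (cmod l) * z) \<le> cmod l * 2" by simp
  qed (use l False r in auto)
  also have "\<dots> = 2 / (1 - r) * (1 - cmod l)" using False by simp
  finally show ?thesis .
qed

context
  fixes lam :: "nat \<Rightarrow> complex"
  assumes lam: "\<And>n. cmod (lam n) < 1" and sm: "summable (\<lambda>n. 1 - cmod (lam n))"
begin

lemma convergent_blaschke:
  assumes z: "cmod z < 1"
  shows "convergent_prod (\<lambda>n. blaschke_factor (lam n) z)"
proof (rule abs_convergent_prod_imp_convergent_prod)
  have "summable (\<lambda>i. norm (blaschke_factor (lam i) z - 1))"
  proof (rule summable_comparison_test')
    show "summable (\<lambda>n. 2 / (1 - cmod z) * (1 - cmod (lam n)))" by (intro summable_mult sm)
    show "norm (norm (blaschke_factor (lam n) z - 1)) \<le> 2 / (1 - cmod z) * (1 - cmod (lam n))" if "0 \<le> n" for n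
      using norm_blaschke_factor_minus_1[OF lam _ z, of z n] by simp
  qed
  then show "abs_convergent_prod (\<lambda>n. blaschke_factor (lam n) z)"
    by (simp add: abs_convergent_prod_conv_summable)
qed

lemma blaschke_prod_tendsto:
  "cmod z < 1 \<Longrightarrow> (\<lambda>N. \<Prod>n<N. blaschke_factor (lam n) z) \<longlonglongrightarrow> blaschke_prod lam z"
  using convergent_prod_LIMSEQ[OF convergent_blaschke] unfolding blaschke_prod_def
  by (subst (asm) lessThan_Suc_atMost[symmetric]) (rule LIMSEQ_imp_Suc)

lemma norm_blaschke_prod_le:
  assumes "cmod z < 1"
  shows "cmod (blaschke_prod lam z) \<le> 1"
  by (rule tendsto_upperbound[OF tendsto_norm[OF blaschke_prod_tendsto[OF assms]]])
     (use assms in \<open>auto simp: prod_norm[symmetric] intro!: always_eventually prod_le_1 norm_blaschke_factor_le lam\<close>)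

lemma blaschke_prod_holomorphic: "blaschke_prod lam holomorphic_on ball 0 1"
proof (rule holomorphic_uniform_sequence[OF open_ball])
  have bh: "blaschke_factor l holomorphic_on ball 0 1" if "cmod l < 1" for l
    unfolding blaschke_factor_bfac[abs_def] by (intro holomorphic_intros bfac_holomorphic that)
  show "(\<lambda>z. \<Prod>n<N. blaschke_factor (lam n) z) holomorphic_on ball 0 1" for N
    by (intro holomorphic_intros bh lam)
  fix x :: complex assume "x \<in> ball 0 1"
  then have x: "cmod x < 1" by simp
  define d r where "d = (1 - cmod x) / 2" and "r = (1 + cmod x) / 2"
  have d: "d > 0" "r < 1" using x by (auto simp: d_def r_def)
  have cb: "cmod z \<le> r" if "z \<in> cball x d" for z
    using that norm_triangle_ineq2[of z x] by (auto simp: dist_norm norm_minus_commute d_def r_def field_simps)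
  then have sub: "cball x d \<subseteq> ball 0 1" using d by force
  have "uniformly_convergent_on (cball x d) (\<lambda>N z. \<Sum>n<N. norm (blaschke_factor (lam n) z - 1))"
  proof (rule Weierstrass_m_test')
    show "norm (norm (blaschke_factor (lam n) z - 1)) \<le> 2 / (1 - r) * (1 - cmod (lam n))" if "z \<in> cball x d" for n z
      using norm_blaschke_factor_minus_1[OF lam cb[OF that] d(2)] by simp
    show "summable (\<lambda>n. 2 / (1 - r) * (1 - cmod (lam n)))" by (intro summable_mult sm)
  qed
  then have "uniformly_convergent_on (cball x d) (\<lambda>N z. \<Prod>n<N. blaschke_factor (lam n) z)"
    by (intro uniformly_convergent_on_prod' holomorphic_on_imp_continuous_on[OF holomorphic_on_subset[OF bh[OF lam] sub]]) auto
  then obtain g where g: "uniform_limit (cball x d) (\<lambda>N z. \<Prod>n<N. blaschke_factor (lam n) z) g sequentially"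
    by (auto simp: uniformly_convergent_on_def)
  have gz: "g z = blaschke_prod lam z" if "z \<in> cball x d" for z
    using tendsto_uniform_limitI[OF g that] blaschke_prod_tendsto[of z] sub that
    by (intro LIMSEQ_unique) auto
  have "uniform_limit (cball x d) (\<lambda>N z. \<Prod>n<N. blaschke_factor (lam n) z) g sequentially \<longleftrightarrow>
      uniform_limit (cball x d) (\<lambda>N z. \<Prod>n<N. blaschke_factor (lam n) z) (blaschke_prod lam) sequentially"
    by (rule uniform_limit_cong'[OF refl gz])
  with g have "uniform_limit (cball x d) (\<lambda>N z. \<Prod>n<N. blaschke_factor (lam n) z) (blaschke_prod lam) sequentially"
    by blast
  with d sub show "\<exists>d. 0 < d \<and> cball x d \<subseteq> ball 0 1 \<and>
      uniform_limit (cball x d) (\<lambda>N z. \<Prod>n<N. blaschke_factor (lam n) z) (blaschke_prod lam) sequentially" by blast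
qed

end

text \<open>The tail is the Blaschke product of the remaining zeros times the constants that relate
  \<open>blaschke_factor\<close> to \<open>bfac\<close>. These constants are unimodular, so the
  moduli of the tails tend to 1 because tails of a convergent product do.\<close>

lemma blaschke_model_blaschke_prod:
  assumes lam: "\<And>n. cmod (lam n) < 1" and sm: "summable (\<lambda>n. 1 - cmod (lam n))"
  shows "blaschke_model lam (blaschke_prod lam)
    (\<lambda>N z. (\<Prod>k<N. bsign (lam k)) * blaschke_prod (\<lambda>n. lam (n + N)) z)"
proof -
  have lam': "cmod (lam (n + N)) < 1" for n N by (rule lam)
  have sm': "summable (\<lambda>n. 1 - cmod (lam (n + N)))" for N using summable_ignore_initial_segment[OF sm] .
  have u: "cmod (\<Prod>k<N. bsign (lam k)) = 1" for N by (simp add: prod_norm[symmetric] norm_bsign)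
  have split: "blaschke_prod (\<lambda>n. lam (n + M)) z =
      (\<Prod>k<N. blaschke_factor (lam (k + M)) z) * blaschke_prod (\<lambda>n. lam (n + (N + M))) z" if z: "cmod z < 1" for M N z
  proof (rule LIMSEQ_unique)
    show "(\<lambda>n. \<Prod>k<n + N. blaschke_factor (lam (k + M)) z) \<longlonglongrightarrow> blaschke_prod (\<lambda>n. lam (n + M)) z"
      using blaschke_prod_tendsto[OF lam' sm' z] by (rule LIMSEQ_ignore_initial_segment)
    have "(\<Prod>k<n + N. blaschke_factor (lam (k + M)) z) =
        (\<Prod>k<N. blaschke_factor (lam (k + M)) z) * (\<Prod>k<n. blaschke_factor (lam (k + (N + M))) z)" for n
      by (induction n) (simp_all add: mult_ac add_ac)
    then show "(\<lambda>n. \<Prod>k<n + N. blaschke_factor (lam (k + M)) z) \<longlonglongrightarrow>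
        (\<Prod>k<N. blaschke_factor (lam (k + M)) z) * blaschke_prod (\<lambda>n. lam (n + (N + M))) z"
      using tendsto_mult_left[OF blaschke_prod_tendsto[OF lam' sm' z]] by simp
  qed
  show ?thesis
  proof
    show "cmod (lam n) < 1" for n by (rule lam)
    show "(\<lambda>z. (\<Prod>k<N. bsign (lam k)) * blaschke_prod (\<lambda>n. lam (n + N)) z) holomorphic_on ball 0 1" for N
      by (intro holomorphic_intros blaschke_prod_holomorphic lam' sm')
    fix z :: complex assume z: "cmod z < 1"
    show "cmod ((\<Prod>k<N. bsign (lam k)) * blaschke_prod (\<lambda>n. lam (n + N)) z) \<le> 1" for N
      unfolding norm_mult u using norm_blaschke_prod_le[OF lam' sm' z] by simp
    show "blaschke_prod lam z = bprod lam N z * ((\<Prod>k<N. bsign (lam k)) * blaschke_prod (\<lambda>n. lam (n + N)) z)" for N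
      using split[OF z, of 0 N] by (simp add: blaschke_factor_bfac prod.distrib bprod_def mult_ac)
    show "(\<lambda>N. cmod ((\<Prod>k<N. bsign (lam k)) * blaschke_prod (\<lambda>n. lam (n + N)) z)) \<longlonglongrightarrow> 1"
    proof -
      define Q where "Q N = blaschke_prod (\<lambda>n. lam (n + N)) z" for N
      \<comment> \<open>Convergence of the product allows finitely many factors to be dropped so
        that the rest has a nonzero limit \<open>p\<close>, even when \<open>z\<close> is itself a
        zero. The later tails are then p divided by the partial products.\<close>
      obtain M p where Mp: "(\<lambda>n. \<Prod>i\<le>n. blaschke_factor (lam (i + M)) z) \<longlonglongrightarrow> p" "p \<noteq> 0"
        using convergent_blaschke[OF lam sm z] by (auto simp: convergent_prod_def raw_has_prod_def)
      have "(\<lambda>n. \<Prod>i<Suc n. blaschke_factor (lam (i + M)) z) \<longlonglongrightarrow> Q M"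
        unfolding Q_def using blaschke_prod_tendsto[OF lam' sm' z] by (rule LIMSEQ_Suc)
      then have QM: "Q M = p" using LIMSEQ_unique[OF Mp(1)] by (simp add: lessThan_Suc_atMost)
      define P where "P n = (\<Prod>i<n. blaschke_factor (lam (i + M)) z)" for n
      have "P \<longlonglongrightarrow> p" unfolding P_def QM[symmetric] Q_def by (rule blaschke_prod_tendsto[OF lam' sm' z])
      then have "(\<lambda>n. p / P n) \<longlonglongrightarrow> p / p" using Mp(2) by (intro tendsto_intros)
      moreover have "p / P n = Q (n + M)" for n
      proof -
        have "p = P n * Q (n + M)" using split[OF z, of M n] QM by (simp add: P_def Q_def)
        then show ?thesis using Mp(2) by auto
      qed
      ultimately have "(\<lambda>n. Q (n + M)) \<longlonglongrightarrow> 1" using Mp(2) by simp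
      then have "Q \<longlonglongrightarrow> 1" by (rule LIMSEQ_offset)
      then have "(\<lambda>N. cmod (Q N)) \<longlonglongrightarrow> 1" using tendsto_norm by fastforce
      then show ?thesis by (simp add: norm_mult u Q_def[abs_def])
    qed
  qed
qed

section \<open>A uniform boundedness principle for square summable sequences\<close>

lemma sum_lessThan_split:
  fixes f :: "nat \<Rightarrow> 'a::comm_monoid_add"
  shows "a \<le> b \<Longrightarrow> (\<Sum>n<b. f n) = (\<Sum>n<a. f n) + (\<Sum>n=a..<b. f n)"
  unfolding lessThan_atLeast0 by (simp add: sum.atLeastLessThan_concat)

lemma summable_mult_square_summable:
  fixes c a :: "nat \<Rightarrow> complex"
  assumes "summable (\<lambda>n. (cmod (c n))\<^sup>2)" "summable (\<lambda>n. (cmod (a n))\<^sup>2)"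
  shows "summable (\<lambda>n. cmod (c n * a n))"
    and "(\<Sum>n. cmod (c n * a n)) \<le> ((\<Sum>n. (cmod (c n))\<^sup>2) + (\<Sum>n. (cmod (a n))\<^sup>2)) / 2"
proof -
  have s: "summable (\<lambda>n. ((cmod (c n))\<^sup>2 + (cmod (a n))\<^sup>2) / 2)"
    by (intro summable_divide summable_add assms)
  have le: "cmod (c n * a n) \<le> ((cmod (c n))\<^sup>2 + (cmod (a n))\<^sup>2) / 2" for n
    using sum_squares_bound[of "cmod (c n)" "cmod (a n)"] by (simp add: norm_mult)
  show sca: "summable (\<lambda>n. cmod (c n * a n))"
    by (rule summable_comparison_test'[OF s]) (use le in simp)
  have "(\<Sum>n. cmod (c n * a n)) \<le> (\<Sum>n. ((cmod (c n))\<^sup>2 + (cmod (a n))\<^sup>2) / 2)"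
    by (rule suminf_le[OF le sca s])
  also have "\<dots> = ((\<Sum>n. (cmod (c n))\<^sup>2) + (\<Sum>n. (cmod (a n))\<^sup>2)) / 2"
    by (subst suminf_divide, intro summable_add assms) (subst suminf_add, use assms in auto)
  finally show "(\<Sum>n. cmod (c n * a n)) \<le> ((\<Sum>n. (cmod (c n))\<^sup>2) + (\<Sum>n. (cmod (a n))\<^sup>2)) / 2" .
qed

text \<open>Gliding hump: if \<open>b\<close> is not square summable, one finds indices \<open>j\<close> and disjoint blocks carrying a
  huge part of \<open>a j\<close> while the tail of \<open>a j\<close> is negligible; \<open>c\<close> is supported on these blocks.\<close>

lemma square_summable_of_bounded_functionals:
  fixes a :: "nat \<Rightarrow> nat \<Rightarrow> complex" and b :: "nat \<Rightarrow> complex"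
  assumes lim: "\<And>n. (\<lambda>j. a j n) \<longlonglongrightarrow> b n"
    and sq: "\<And>j. summable (\<lambda>n. (cmod (a j n))\<^sup>2)"
    and bdd: "\<And>c. summable (\<lambda>n. (cmod (c n))\<^sup>2) \<Longrightarrow> \<exists>K. \<forall>j. cmod (\<Sum>n. c n * a j n) \<le> K"
  shows "summable (\<lambda>n. (cmod (b n))\<^sup>2)"
proof (rule ccontr)
  assume ns: "\<not> summable (\<lambda>n. (cmod (b n))\<^sup>2)"
  \<comment> \<open>The summand 1 leaves room above the limit of the head sums of
    \<open>a j\<close>, so that these stay below \<open>D N\<close> for all large j.\<close>
  define D where "D N = (\<Sum>n<N. (cmod (b n))\<^sup>2) + 1" for N
  have D: "D N \<ge> 1" for N unfolding D_def by (simp add: sum_nonneg)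
  \<comment> \<open>A block of \<open>a j\<close> of norm at least \<open>H k N\<close> contributes
    at least k + 4 + 2 D to the pairing after the weight 2^-k. The head costs at most 1 + D and the
    tail at most 2, so more than k remains.\<close>
  define H where "H k N = 2 ^ k * (real k + 4 + 2 * D N)" for k N
  have Hpos: "H k N > 0" for k N using D[of N] by (simp add: H_def)
  have step: "\<exists>j N'. N < N' \<and> (\<Sum>n<N. (cmod (a j n))\<^sup>2) \<le> D N \<and> (H k N)\<^sup>2 \<le> (\<Sum>n=N..<N'. (cmod (a j n))\<^sup>2) \<and>
      (\<Sum>n. (cmod (a j (n + N')))\<^sup>2) \<le> 1" for k N
  proof -
    have "\<exists>M. (\<Sum>n<M. (cmod (b n))\<^sup>2) > D N + (H k N)\<^sup>2"
    proof (rule ccontr)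
      assume "\<not> ?thesis"
      then have "(\<Sum>n<M. (cmod (b n))\<^sup>2) \<le> D N + (H k N)\<^sup>2" for M by (simp add: not_less)
      then have "summable (\<lambda>n. (cmod (b n))\<^sup>2)" by (rule summableI_nonneg_bounded[rotated]) simp
      with ns show False by simp
    qed
    then obtain M where M: "(\<Sum>n<M. (cmod (b n))\<^sup>2) > D N + (H k N)\<^sup>2" by blast
    have "N < M"
    proof (rule ccontr)
      assume "\<not> N < M"
      then have "(\<Sum>n<M. (cmod (b n))\<^sup>2) \<le> (\<Sum>n<N. (cmod (b n))\<^sup>2)" by (intro sum_mono2) auto
      then show False using M zero_le_power2[of "H k N"] by (simp add: D_def)
    qed
    then have "(\<Sum>n<M. (cmod (b n))\<^sup>2) = (\<Sum>n<N. (cmod (b n))\<^sup>2) + (\<Sum>n=N..<M. (cmod (b n))\<^sup>2)"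
      by (intro sum_lessThan_split) simp
    then have big: "(H k N)\<^sup>2 < (\<Sum>n=N..<M. (cmod (b n))\<^sup>2)" using M by (simp add: D_def)
    have "(\<lambda>j. \<Sum>n<N. (cmod (a j n))\<^sup>2) \<longlonglongrightarrow> (\<Sum>n<N. (cmod (b n))\<^sup>2)" by (intro tendsto_intros lim)
    then have 1: "\<forall>\<^sub>F j in sequentially. (\<Sum>n<N. (cmod (a j n))\<^sup>2) < D N"
      by (rule order_tendstoD) (simp add: D_def)
    have "(\<lambda>j. \<Sum>n=N..<M. (cmod (a j n))\<^sup>2) \<longlonglongrightarrow> (\<Sum>n=N..<M. (cmod (b n))\<^sup>2)" by (intro tendsto_intros lim)
    then have 2: "\<forall>\<^sub>F j in sequentially. (H k N)\<^sup>2 < (\<Sum>n=N..<M. (cmod (a j n))\<^sup>2)"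
      by (rule order_tendstoD) (rule big)
    obtain j where j: "(\<Sum>n<N. (cmod (a j n))\<^sup>2) < D N" "(H k N)\<^sup>2 < (\<Sum>n=N..<M. (cmod (a j n))\<^sup>2)"
      using eventually_happens[OF eventually_conj[OF 1 2]] by auto
    \<comment> \<open>Now \<open>j\<close> is fixed, and its row is square summable: moving the end
      of the block out to \<open>max M L\<close> makes the tail small, while the block sum can only
      grow.\<close>
    obtain L where L: "\<And>n. n \<ge> L \<Longrightarrow> norm (\<Sum>i. (cmod (a j (i + n)))\<^sup>2) < 1"
      using suminf_exist_split[OF zero_less_one sq[of j]] by auto
    have "(\<Sum>n=N..<M. (cmod (a j n))\<^sup>2) \<le> (\<Sum>n=N..<max M L. (cmod (a j n))\<^sup>2)" by (intro sum_mono2) auto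
    then show ?thesis using j L[of "max M L"] \<open>N < M\<close> by (intro exI[of _ j] exI[of _ "max M L"]) auto
  qed
  then obtain jj nn where jn: "\<And>k N. N < nn k N" "\<And>k N. (\<Sum>n<N. (cmod (a (jj k N) n))\<^sup>2) \<le> D N"
      "\<And>k N. (H k N)\<^sup>2 \<le> (\<Sum>n=N..<nn k N. (cmod (a (jj k N) n))\<^sup>2)"
      "\<And>k N. (\<Sum>n. (cmod (a (jj k N) (n + nn k N)))\<^sup>2) \<le> 1"
    by metis
  define Ns where "Ns = rec_nat 0 (\<lambda>k N. nn k N)"
  have Ns: "Ns 0 = 0" "Ns (Suc k) = nn k (Ns k)" for k by (auto simp: Ns_def)
  have Nsm: "strict_mono Ns" by (rule strict_monoI_Suc) (simp add: Ns jn(1))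
  define A where "A k = a (jj k (Ns k))" for k
  define s where "s k = sqrt (\<Sum>n=Ns k..<Ns (Suc k). (cmod (A k n))\<^sup>2)" for k
  have s2: "(s k)\<^sup>2 = (\<Sum>n=Ns k..<Ns (Suc k). (cmod (A k n))\<^sup>2)" for k by (simp add: s_def sum_nonneg)
  have sH: "s k \<ge> H k (Ns k)" for k
    unfolding s_def using jn(3)[of k "Ns k"] by (intro real_le_rsqrt) (simp add: Ns A_def)
  have spos: "s k > 0" for k using sH[of k] Hpos[of k "Ns k"] by linarith
  define blk where "blk n = (LEAST k. n < Ns (Suc k))" for n
  have blk: "blk n = k" if "Ns k \<le> n" "n < Ns (Suc k)" for n k
    unfolding blk_def
  proof (rule Least_equality)
    fix k' assume k': "n < Ns (Suc k')"
    show "k \<le> k'"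
    proof (rule ccontr)
      assume "\<not> k \<le> k'"
      then have "Ns (Suc k') \<le> Ns k" using Nsm by (simp add: strict_mono_less_eq)
      with k' that show False by simp
    qed
  qed (rule that)
  \<comment> \<open>On block k this is the conjugate of the row \<open>A k\<close>, scaled to norm
    2^-k: the squares sum to a convergent geometric series, and the pairing with \<open>A k\<close>
    over the block is s k / 2^k.\<close>
  define c where "c n = cnj (A (blk n) n) / of_real (2 ^ blk n * s (blk n))" for n
  have c_sq: "(\<Sum>n=Ns k..<Ns (Suc k). (cmod (c n))\<^sup>2) = (1/4) ^ k" for k
  proof -
    have "(\<Sum>n=Ns k..<Ns (Suc k). (cmod (c n))\<^sup>2) = (\<Sum>n=Ns k..<Ns (Suc k). (cmod (A k n))\<^sup>2 / (2 ^ k * s k)\<^sup>2)"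
      using spos[of k] by (intro sum.cong) (auto simp: c_def blk norm_divide norm_mult norm_power power_divide power_mult_distrib)
    also have "\<dots> = (s k)\<^sup>2 / (2 ^ k * s k)\<^sup>2" by (simp add: s2 sum_divide_distrib)
    also have "\<dots> = 1 / ((2 ^ k)\<^sup>2)" using spos[of k] by (simp add: power_mult_distrib)
    also have "\<dots> = (1/4) ^ k" by (simp add: power_divide power2_eq_square flip: power_mult_distrib)
    finally show ?thesis .
  qed
  have c_part: "(\<Sum>n<Ns k. (cmod (c n))\<^sup>2) \<le> 2" for k
  proof -
    have "(\<Sum>n<Ns k. (cmod (c n))\<^sup>2) = (\<Sum>i<k. (1/4) ^ i)"
    proof (induction k)
      case (Suc k)
      have "Ns k \<le> Ns (Suc k)" using Nsm by (simp add: strict_mono_less_eq)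
      then have "(\<Sum>n<Ns (Suc k). (cmod (c n))\<^sup>2) = (\<Sum>n<Ns k. (cmod (c n))\<^sup>2) + (\<Sum>n=Ns k..<Ns (Suc k). (cmod (c n))\<^sup>2)"
        by (intro sum_lessThan_split) simp
      then show ?case using Suc c_sq[of k] by simp
    qed (simp add: Ns)
    also have "\<dots> \<le> (\<Sum>i. (1/4::real) ^ i)" by (intro sum_le_suminf summable_geometric) auto
    also have "\<dots> = 4/3" by (subst suminf_geometric) auto
    finally show ?thesis by simp
  qed
  have c_bd: "(\<Sum>n<m. (cmod (c n))\<^sup>2) \<le> 2" for m
  proof -
    have "m \<le> Ns m" using Nsm by (rule strict_mono_imp_increasing)
    then have "(\<Sum>n<m. (cmod (c n))\<^sup>2) \<le> (\<Sum>n<Ns m. (cmod (c n))\<^sup>2)" by (intro sum_mono2) auto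
    with c_part[of m] show ?thesis by simp
  qed
  have c_sum: "summable (\<lambda>n. (cmod (c n))\<^sup>2)"
    by (rule summableI_nonneg_bounded[OF _ c_bd]) simp
  obtain K where K: "\<And>j. cmod (\<Sum>n. c n * a j n) \<le> K" using bdd[OF c_sum] by auto
  have low: "real k < K" for k
  proof -
    note As = sq[of "jj k (Ns k)", folded A_def]
    have sca: "summable (\<lambda>n. c n * A k n)" by (rule summable_norm_cancel[OF summable_mult_square_summable(1)[OF c_sum As]])
    define T where "T = (\<Sum>n. c (n + Ns (Suc k)) * A k (n + Ns (Suc k)))"
    have "Ns k \<le> Ns (Suc k)" using Nsm by (simp add: strict_mono_less_eq)
    then have "(\<Sum>n<Ns (Suc k). c n * A k n) = (\<Sum>n<Ns k. c n * A k n) + (\<Sum>n=Ns k..<Ns (Suc k). c n * A k n)"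
      by (intro sum_lessThan_split) simp
    then have split: "(\<Sum>n. c n * A k n) = T + (\<Sum>n<Ns k. c n * A k n) + (\<Sum>n=Ns k..<Ns (Suc k). c n * A k n)"
      unfolding T_def using suminf_split_initial_segment[OF sca, of "Ns (Suc k)"] by simp
    have c2: "summable (\<lambda>n. (cmod (c (n + Ns (Suc k))))\<^sup>2)" and A2: "summable (\<lambda>n. (cmod (A k (n + Ns (Suc k))))\<^sup>2)"
      using summable_ignore_initial_segment[OF c_sum] summable_ignore_initial_segment[OF As] by auto
    have p: "(\<Sum>n. (cmod (c (n + Ns (Suc k))))\<^sup>2) \<le> 2"
    proof (rule suminf_le_const[OF c2])
      fix m
      have "(\<Sum>n<m. (cmod (c (n + Ns (Suc k))))\<^sup>2) = (\<Sum>n=Ns (Suc k)..<m + Ns (Suc k). (cmod (c n))\<^sup>2)"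
        by (simp add: sum.shift_bounds_nat_ivl[of _ 0 _ m, simplified] lessThan_atLeast0)
      also have "\<dots> \<le> (\<Sum>n<m + Ns (Suc k). (cmod (c n))\<^sup>2)" by (intro sum_mono2) auto
      finally show "(\<Sum>n<m. (cmod (c (n + Ns (Suc k))))\<^sup>2) \<le> 2" using c_bd by (rule order_trans)
    qed
    have q: "(\<Sum>n. (cmod (A k (n + Ns (Suc k))))\<^sup>2) \<le> 1" using jn(4)[of k "Ns k"] by (simp add: A_def Ns)
    have "cmod T \<le> (\<Sum>n. cmod (c (n + Ns (Suc k)) * A k (n + Ns (Suc k))))"
      unfolding T_def by (rule summable_norm[OF summable_mult_square_summable(1)[OF c2 A2]])
    also note summable_mult_square_summable(2)[OF c2 A2]
    also have "((\<Sum>n. (cmod (c (n + Ns (Suc k))))\<^sup>2) + (\<Sum>n. (cmod (A k (n + Ns (Suc k))))\<^sup>2)) / 2 \<le> (2 + 1) / 2"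
      by (intro divide_right_mono add_mono p q) simp
    finally have T: "cmod T \<le> 2" by simp
    have "cmod (\<Sum>n<Ns k. c n * A k n) \<le> (\<Sum>n<Ns k. ((cmod (c n))\<^sup>2 + (cmod (A k n))\<^sup>2) / 2)"
    proof (intro order_trans[OF norm_sum] sum_mono)
      show "cmod (c n * A k n) \<le> ((cmod (c n))\<^sup>2 + (cmod (A k n))\<^sup>2) / 2" for n
        using sum_squares_bound[of "cmod (c n)" "cmod (A k n)"] by (simp add: norm_mult)
    qed
    also have "\<dots> = ((\<Sum>n<Ns k. (cmod (c n))\<^sup>2) + (\<Sum>n<Ns k. (cmod (A k n))\<^sup>2)) / 2"
      by (simp add: sum.distrib flip: sum_divide_distrib)
    also have "\<dots> \<le> 1 + D (Ns k)"
      using c_part[of k] jn(2)[where k = k and N = "Ns k"] D[of "Ns k"] by (simp add: A_def)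
    finally have F: "cmod (\<Sum>n<Ns k. c n * A k n) \<le> 1 + D (Ns k)" .
    have "(\<Sum>n=Ns k..<Ns (Suc k). c n * A k n) = (\<Sum>n=Ns k..<Ns (Suc k). of_real ((cmod (A k n))\<^sup>2) / of_real (2 ^ k * s k))"
    proof (rule sum.cong)
      fix n assume "n \<in> {Ns k..<Ns (Suc k)}"
      then have "blk n = k" by (intro blk) auto
      then show "c n * A k n = of_real ((cmod (A k n))\<^sup>2) / of_real (2 ^ k * s k)"
        unfolding c_def complex_norm_square by (simp add: mult.commute)
    qed simp
    also have "\<dots> = of_real ((s k)\<^sup>2 / (2 ^ k * s k))" by (simp add: s2 sum_divide_distrib)
    also have "(s k)\<^sup>2 / (2 ^ k * s k) = s k / 2 ^ k" using spos[of k] by (simp add: power2_eq_square)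
    finally have "cmod (\<Sum>n=Ns k..<Ns (Suc k). c n * A k n) = s k / 2 ^ k" using spos[of k] by (simp add: norm_divide norm_power)
    moreover have "s k / 2 ^ k \<ge> real k + 4 + 2 * D (Ns k)" using sH[of k] by (simp add: H_def field_simps)
    ultimately have B: "cmod (\<Sum>n=Ns k..<Ns (Suc k). c n * A k n) \<ge> real k + 4 + 2 * D (Ns k)" by simp
    have "cmod (\<Sum>n=Ns k..<Ns (Suc k). c n * A k n) \<le> cmod (\<Sum>n. c n * A k n) + (cmod T + cmod (\<Sum>n<Ns k. c n * A k n))"
      using norm_triangle_ineq4[of "\<Sum>n. c n * A k n" "T + (\<Sum>n<Ns k. c n * A k n)"] norm_triangle_ineq[of T "\<Sum>n<Ns k. c n * A k n"]
      unfolding split by simp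
    then show ?thesis using B F T D[of "Ns k"] K[of "jj k (Ns k)"] unfolding A_def by linarith
  qed
  obtain k where "K < real k" using reals_Archimedean2 by blast
  with low[of k] show False by simp
qed

section \<open>Boundary values in the range of the operator\<close>

lemma at_within_ball_nontrivial:
  assumes "cmod \<zeta> = 1"
  shows "at \<zeta> within ball 0 1 \<noteq> bot"
  using assms by (simp add: trivial_limit_within islimpt_ball)

lemma stolz_radial:
  assumes \<zeta>: "cmod \<zeta> = 1" and \<alpha>: "\<alpha> > 1"
  shows "filterlim (\<lambda>j. of_real (1 - 1 / real (j+2)) * \<zeta>) (at \<zeta> within stolz \<zeta> \<alpha>) sequentially"
proof -
  define r where "r j = 1 - 1 / real (j+2)" for j
  have r: "0 < r j" "r j < 1" for j by (auto simp: r_def field_simps)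
  have "r \<longlonglongrightarrow> 1" unfolding r_def by real_asymp
  then have "(\<lambda>j. of_real (r j) * \<zeta>) \<longlonglongrightarrow> of_real 1 * \<zeta>" by (intro tendsto_intros)
  moreover have "of_real (r j) * \<zeta> \<in> stolz \<zeta> \<alpha> \<and> of_real (r j) * \<zeta> \<noteq> \<zeta>" for j
  proof -
    have "of_real (r j) * \<zeta> - \<zeta> = of_real (r j - 1) * \<zeta>" by (simp add: algebra_simps)
    then have n: "cmod (of_real (r j) * \<zeta> - \<zeta>) = 1 - r j"
      using r[of j] by (simp only: norm_mult norm_of_real \<zeta>) simp
    moreover have "cmod (of_real (r j) * \<zeta>) = r j" using r[of j] by (simp add: norm_mult \<zeta>)
    moreover have "1 * (1 - r j) < \<alpha> * (1 - r j)" using \<alpha> r[of j] by (intro mult_strict_right_mono) auto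
    ultimately show ?thesis using r[of j] by (auto simp: stolz_def)
  qed
  ultimately show ?thesis unfolding filterlim_at r_def by (auto intro!: always_eventually)
qed

context blaschke_model
begin

context
  fixes h :: "complex \<Rightarrow> complex" and \<zeta> :: complex
  assumes h: "h \<in> H2" and \<zeta>: "cmod \<zeta> = 1"
begin

text \<open>\<open>tmw lam k\<close> is orthogonal to the multiples of
  \<open>bprod lam (Suc k)\<close>, and the operator preserves this, so the image lies in the span
  of the first k + 1 basis functions. It thus extends continuously to the closed disk, which gives
  \<open>bval\<close> its meaning.\<close>

lemma toep_tmw_span:
  assumes z: "cmod z < 1"
  shows "toep h (tmw lam k) z = (\<Sum>j<Suc k. L2inner (\<lambda>t. cnj (bdry h t) * bdry (tmw lam k) t) (bdry (tmw lam j)) * tmw lam j z)"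
proof -
  obtain K where K: "\<And>z. cmod z \<le> 1 \<Longrightarrow> cmod (tmw lam k z) \<le> K" using tmw_bounded[of lam k, OF lam] by auto
  have K': "cmod (tmw lam k z) \<le> K" if "cmod z < 1" for z using K that by simp
  obtain g where g: "g \<in> H2" "\<And>z. cmod z < 1 \<Longrightarrow> g z = toep h (tmw lam k) z"
    and gk: "\<And>u. u \<in> H2 \<Longrightarrow> hin g u = L2inner (\<lambda>t. cnj (bdry h t) * bdry (tmw lam k) t) (bdry u)"
    and gb: "\<And>b p. b holomorphic_on ball 0 1 \<Longrightarrow> (\<And>z. cmod z < 1 \<Longrightarrow> cmod (b z) \<le> 1) \<Longrightarrow>
       (\<And>p. p \<in> H2 \<Longrightarrow> hin (tmw lam k) (\<lambda>z. b z * p z) = 0) \<Longrightarrow> p \<in> H2 \<Longrightarrow> hin g (\<lambda>z. b z * p z) = 0"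
    using toep_of_bounded[OF tmw_facts(2) K' h] by blast
  have "hin g (\<lambda>z. bprod lam (Suc k) z * p z) = 0" if "p \<in> H2" for p
  proof (rule gb[OF bprod_holomorphic[OF lam] norm_bprod_le[OF lam] _ that])
    show "hin (tmw lam k) (\<lambda>z. bprod lam (Suc k) z * p z) = 0" if "p \<in> H2" for p
      using hin_bprod_tmw_0[of lam p k "Suc k", OF lam that] by (subst hin_cnj) simp
  qed auto
  then have "g z = (\<Sum>j<Suc k. hin g (tmw lam j) * tmw lam j z)"
    using tmw_finite_span[of lam g "Suc k" z, OF lam g(1) _ z] by blast
  then show ?thesis using g(2)[OF z] by (simp add: gk tmw_facts)
qed

lemma toep_tmw_tendsto:
  "(toep h (tmw lam k) \<longlongrightarrow> bval (tto I h (tmw lam k)) \<zeta>) (at \<zeta> within ball 0 1)"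
proof -
  define F where "F z = (\<Sum>j<Suc k. L2inner (\<lambda>t. cnj (bdry h t) * bdry (tmw lam k) t) (bdry (tmw lam j)) * tmw lam j z)" for z
  have "continuous_on (cball 0 1) F" unfolding F_def by (intro continuous_intros tmw_facts)
  then have "(F \<longlongrightarrow> F \<zeta>) (at \<zeta> within cball 0 1)" using \<zeta> by (simp add: continuous_on_def)
  then have F: "(F \<longlongrightarrow> F \<zeta>) (at \<zeta> within ball 0 1)" by (rule tendsto_within_subset) auto
  have ev: "\<forall>\<^sub>F z in at \<zeta> within ball 0 1. z \<in> ball 0 1" by (simp add: eventually_at_filter)
  have 1: "(toep h (tmw lam k) \<longlongrightarrow> F \<zeta>) (at \<zeta> within ball 0 1)"
    by (rule Lim_transform_eventually[OF F]) (use ev in eventually_elim, simp add: F_def toep_tmw_span)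
  have 2: "(tto I h (tmw lam k) \<longlongrightarrow> F \<zeta>) (at \<zeta> within ball 0 1)"
    by (rule Lim_transform_eventually[OF F]) (use ev in eventually_elim, simp add: F_def toep_tmw_span tto_tmw h)
  have "bval (tto I h (tmw lam k)) \<zeta> = F \<zeta>"
    unfolding bval_def by (rule tendsto_Lim[OF at_within_ball_nontrivial[OF \<zeta>] 2])
  with 1 show ?thesis by simp
qed

lemma toep_sum_tendsto:
  "(toep h (\<lambda>w. \<Sum>k<N. c k * tmw lam k w) \<longlongrightarrow> (\<Sum>k<N. c k * bval (tto I h (tmw lam k)) \<zeta>)) (at \<zeta> within ball 0 1)"
proof (rule Lim_transform_eventually)
  show "((\<lambda>x. \<Sum>k<N. c k * toep h (tmw lam k) x) \<longlongrightarrow> (\<Sum>k<N. c k * bval (tto I h (tmw lam k)) \<zeta>)) (at \<zeta> within ball 0 1)"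
    by (intro tendsto_intros toep_tmw_tendsto)
  have "\<forall>\<^sub>F x in at \<zeta> within ball 0 1. cmod x < 1" by (simp add: eventually_at_filter)
  then show "\<forall>\<^sub>F x in at \<zeta> within ball 0 1.
      (\<Sum>k<N. c k * toep h (tmw lam k) x) = toep h (\<lambda>w. \<Sum>k<N. c k * tmw lam k w) x"
    by eventually_elim (simp add: toep_sum_left tmw_facts h)
qed

text \<open>With \<open>v = f + (z - \<zeta>) Q_z f\<close>, i.e. \<open>v = (1 - \<zeta> S*)(1 - z S*)^{-1} f\<close>, the value at \<open>\<zeta>\<close> of the image of \<open>v\<close> is
  the value at \<open>z\<close> of the image of \<open>f\<close>, while the norm of \<open>v\<close> is controlled on Stolz angles.\<close>

lemma toep_span_bound:
  fixes c :: "nat \<Rightarrow> complex" and N :: nat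
  assumes z: "cmod z < 1"
  defines "f \<equiv> \<lambda>w. \<Sum>k<N. c k * tmw lam k w"
  shows "cmod (toep h f z) \<le> H2norm f * (1 + cmod (z - \<zeta>) / (1 - cmod z)) *
    sqrt (\<Sum>k<N. (cmod (bval (tto I h (tmw lam k)) \<zeta>))\<^sup>2)"
proof -
  define a where "a k = bval (tto I h (tmw lam k)) \<zeta>" for k
  have f: "f \<in> H2" unfolding f_def by (intro H2_sum tmw_facts)
  define q where "q = quot z f"
  have q: "q \<in> H2" unfolding q_def by (rule quot_H2[OF f z])
  define v where "v w = f w + (z - \<zeta>) * q w" for w
  have v: "v \<in> H2" unfolding v_def by (intro H2_add H2_cmult f q)
  have forth: "hin f (\<lambda>w. bprod lam N w * p w) = 0" if p: "p \<in> H2" for p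
  proof -
    have "hin f (\<lambda>w. bprod lam N w * p w) = (\<Sum>k<N. c k * hin (tmw lam k) (\<lambda>w. bprod lam N w * p w))"
      unfolding f_def by (rule hin_sum_left) (auto intro: tmw_facts bprod_mult_H2[OF lam] p)
    also have "\<dots> = 0"
    proof (rule sum.neutral, rule ballI)
      fix k assume "k \<in> {..<N}"
      then show "c k * hin (tmw lam k) (\<lambda>w. bprod lam N w * p w) = 0"
        using hin_bprod_tmw_0[of lam p k N, OF lam p] hin_cnj[of "tmw lam k"] by simp
    qed
    finally show ?thesis .
  qed
  \<comment> \<open>The adjoint of the difference quotient is a multiplication operator, which maps
    multiples of \<open>bprod lam N\<close> to such multiples. Hence \<open>v\<close> stays in the
    finite span.\<close>
  have "hin v (\<lambda>w. bprod lam N w * p w) = 0" if p: "p \<in> H2" for p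
  proof -
    have B: "(\<lambda>w. bprod lam N w * p w) \<in> H2" by (rule bprod_mult_H2[OF lam p])
    have "hin q (\<lambda>w. bprod lam N w * p w) = hin f (\<lambda>w. w * kern z w * (bprod lam N w * p w))"
      unfolding q_def by (rule quot_adjoint[OF f B z])
    also have "\<dots> = hin f (\<lambda>w. bprod lam N w * (w * kern z w * p w))" by (simp add: mult_ac)
    also have "\<dots> = 0" by (rule forth[OF shift_kern_H2[OF p z]])
    finally show ?thesis
      unfolding v_def using forth[OF p] by (simp add: hin_add_left hin_cmult_left f q B H2_cmult)
  qed
  then have vspan: "v w = (\<Sum>k<N. hin v (tmw lam k) * tmw lam k w)" if "cmod w < 1" for w
    using tmw_finite_span[of lam v N w, OF lam v _ that] by blast
  have ev: "\<forall>\<^sub>F x in at \<zeta> within ball 0 1. cmod x < 1" by (simp add: eventually_at_filter)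
  note nt = at_within_ball_nontrivial[OF \<zeta>]
  define L where "L = (\<Sum>k<N. c k * a k)"
  have limf: "(toep h f \<longlongrightarrow> L) (at \<zeta> within ball 0 1)"
    unfolding f_def L_def a_def by (rule toep_sum_tendsto)
  have "toep h v = toep h (\<lambda>w. \<Sum>k<N. hin v (tmw lam k) * tmw lam k w)"
    by (rule toep_cong) (rule vspan)
  then have limv: "(toep h v \<longlongrightarrow> (\<Sum>k<N. hin v (tmw lam k) * a k)) (at \<zeta> within ball 0 1)"
    unfolding a_def by (simp only: toep_sum_tendsto)
  have zz: "\<zeta> - z \<noteq> 0" using z \<zeta> by auto
  \<comment> \<open>For x near \<open>\<zeta>\<close> the difference quotient of the image is the
    image of the difference quotient, so this expression is \<open>toep h v x\<close>; at x = zeta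
    the terms with \<open>L\<close> cancel and the value of the image of f at z is left.\<close>
  have "((\<lambda>x. toep h f x + (z - \<zeta>) * ((toep h f x - toep h f z) / (x - z))) \<longlongrightarrow>
      L + (z - \<zeta>) * ((L - toep h f z) / (\<zeta> - z))) (at \<zeta> within ball 0 1)"
    using zz by (intro tendsto_intros limf)
  moreover have "\<forall>\<^sub>F x in at \<zeta> within ball 0 1. toep h f x + (z - \<zeta>) * ((toep h f x - toep h f z) / (x - z)) = toep h v x"
  proof -
    have "\<forall>\<^sub>F x in at \<zeta> within ball 0 1. x \<noteq> z"
      by (rule tendsto_imp_eventually_ne[OF tendsto_ident_at]) (use zz in auto)
    with ev show ?thesis
    proof eventually_elim
      case (elim x)
      then have "(toep h f x - toep h f z) / (x - z) = toep h q x"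
        using toep_quot[OF f h elim(1) z] by (simp add: q_def)
      then show ?case unfolding v_def using elim
        by (simp add: toep_add_left toep_cmult_left f q h H2_cmult)
    qed
  qed
  ultimately have "(toep h v \<longlongrightarrow> L + (z - \<zeta>) * ((L - toep h f z) / (\<zeta> - z))) (at \<zeta> within ball 0 1)"
    by (rule Lim_transform_eventually)
  moreover have "L + (z - \<zeta>) * ((L - toep h f z) / (\<zeta> - z)) = toep h f z"
  proof -
    have "(z - \<zeta>) * ((L - toep h f z) / (\<zeta> - z)) = - (L - toep h f z)" using zz by (simp add: divide_simps) (simp add: algebra_simps)
    then show ?thesis by simp
  qed
  ultimately have eq: "toep h f z = (\<Sum>k<N. hin v (tmw lam k) * a k)"
    using tendsto_unique[OF nt _ limv] by auto
  have "cmod (toep h f z) \<le> (\<Sum>k<N. \<bar>cmod (hin v (tmw lam k))\<bar> * \<bar>cmod (a k)\<bar>)"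
    unfolding eq by (rule order_trans[OF norm_sum]) (simp add: norm_mult)
  also have "\<dots> \<le> L2_set (\<lambda>k. cmod (hin v (tmw lam k))) {..<N} * L2_set (\<lambda>k. cmod (a k)) {..<N}"
    by (rule L2_set_mult_ineq)
  also have "\<dots> \<le> H2norm v * L2_set (\<lambda>k. cmod (a k)) {..<N}"
  proof (rule mult_right_mono)
    show "L2_set (\<lambda>k. cmod (hin v (tmw lam k))) {..<N} \<le> H2norm v"
      unfolding L2_set_def by (rule real_le_lsqrt) (use tmw_Bessel[of lam v N, OF lam v] in \<open>auto simp: sum_nonneg\<close>)
  qed (simp add: L2_set_nonneg)
  also have "\<dots> \<le> (H2norm f * (1 + cmod (z - \<zeta>) / (1 - cmod z))) * L2_set (\<lambda>k. cmod (a k)) {..<N}"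
  proof (rule mult_right_mono)
    have "H2norm v \<le> H2norm f + cmod (z - \<zeta>) * H2norm q"
      unfolding v_def using H2norm_add_le[OF f H2_cmult[OF q]] H2norm_cmult[OF q] by simp
    also have "\<dots> \<le> H2norm f + cmod (z - \<zeta>) * (H2norm f / (1 - cmod z))"
      unfolding q_def by (intro add_left_mono mult_left_mono H2norm_quot_le f z) simp
    finally show "H2norm v \<le> H2norm f * (1 + cmod (z - \<zeta>) / (1 - cmod z))" by (simp add: algebra_simps)
  qed (simp add: L2_set_nonneg)
  finally show ?thesis by (simp add: L2_set_def a_def)
qed

text \<open>In the Stolz angle |z - zeta| / (1 - |z|) is below \<open>\<alpha>\<close>, so
  \<open>toep_span_bound\<close> holds for the partial sums of f with constants free of N and z. For
  fixed z both sides are continuous along these sums.\<close>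

lemma toep_stolz_bound:
  assumes A: "summable (\<lambda>k. (cmod (bval (tto I h (tmw lam k)) \<zeta>))\<^sup>2)"
    and f: "f \<in> model_space I" and z: "z \<in> stolz \<zeta> \<alpha>"
  shows "cmod (toep h f z) \<le> H2norm f * (1 + \<alpha>) * sqrt (\<Sum>k. (cmod (bval (tto I h (tmw lam k)) \<zeta>))\<^sup>2)"
proof -
  define S where "S = sqrt (\<Sum>k. (cmod (bval (tto I h (tmw lam k)) \<zeta>))\<^sup>2)"
  have z1: "cmod z < 1" and za: "cmod (z - \<zeta>) < \<alpha> * (1 - cmod z)" using z by (auto simp: stolz_def)
  have zr: "cmod (z - \<zeta>) / (1 - cmod z) \<le> \<alpha>" using z1 za by (simp add: field_simps)
  have \<alpha>: "\<alpha> \<ge> 0" by (rule order_trans[OF _ zr]) (use z1 in simp)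
  note fH = model_space_H2[OF f]
  define s where "s N w = (\<Sum>k<N. hin f (tmw lam k) * tmw lam k w)" for N w
  have s: "s N \<in> H2" for N unfolding s_def by (intro H2_sum tmw_facts)
  have lim: "(\<lambda>N. H2norm (\<lambda>w. s N w - f w)) \<longlonglongrightarrow> 0" using tmw_expansion[OF f] by (simp add: s_def)
  have b: "cmod (toep h (s N) z) \<le> (H2norm f + H2norm (\<lambda>w. s N w - f w)) * ((1 + \<alpha>) * S)" for N
  proof -
    have "cmod (toep h (s N) z) \<le> H2norm (s N) * (1 + cmod (z - \<zeta>) / (1 - cmod z)) * sqrt (\<Sum>k<N. (cmod (bval (tto I h (tmw lam k)) \<zeta>))\<^sup>2)"
      unfolding s_def by (rule toep_span_bound[OF z1])
    also have "\<dots> \<le> H2norm (s N) * (1 + \<alpha>) * S"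
      unfolding S_def using zr \<alpha> z1
      by (intro mult_mono mult_nonneg_nonneg real_sqrt_le_mono sum_le_suminf A add_nonneg_nonneg) (auto simp: sum_nonneg)
    also have "\<dots> = H2norm (s N) * ((1 + \<alpha>) * S)" by simp
    also have "\<dots> \<le> (H2norm f + H2norm (\<lambda>w. s N w - f w)) * ((1 + \<alpha>) * S)"
      using H2norm_triangle_sub[OF s[of N] fH] \<alpha> suminf_nonneg[OF A]
      by (intro mult_right_mono) (auto simp: S_def)
    finally show ?thesis .
  qed
  have "(\<lambda>N. (H2norm f + H2norm (\<lambda>w. s N w - f w)) * ((1 + \<alpha>) * S)) \<longlonglongrightarrow> (H2norm f + 0) * ((1 + \<alpha>) * S)"
    by (intro tendsto_intros lim)
  moreover have "(\<lambda>N. cmod (toep h (s N) z)) \<longlonglongrightarrow> cmod (toep h f z)"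
    unfolding toep_def by (intro tendsto_norm hin_tendsto_left[OF s fH mult_kern_H2[OF h z1] lim])
  ultimately have "cmod (toep h f z) \<le> (H2norm f + 0) * ((1 + \<alpha>) * S)"
    using b by (intro LIMSEQ_le[of "\<lambda>N. cmod (toep h (s N) z)"]) auto
  then show ?thesis by (simp add: S_def)
qed

text \<open>The limit is the sum over k of the coefficient of f times a_k, absolutely convergent
  since both sequences are square summable. In each Stolz angle the error splits in three: the
  remainder f - s_N through the uniform bound, the continuous image of s_N, and the tail of the
  series.\<close>

lemma nt_limit_toep:
  assumes A: "summable (\<lambda>k. (cmod (bval (tto I h (tmw lam k)) \<zeta>))\<^sup>2)"
    and f: "f \<in> model_space I" and g: "\<And>z. cmod z < 1 \<Longrightarrow> g z = toep h f z"
  shows "\<exists>L. nt_limit g \<zeta> L"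
proof -
  define a where "a k = bval (tto I h (tmw lam k)) \<zeta>" for k
  define S where "S = sqrt (\<Sum>k. (cmod (a k))\<^sup>2)"
  note fH = model_space_H2[OF f]
  define s where "s N w = (\<Sum>k<N. hin f (tmw lam k) * tmw lam k w)" for N w
  have sM: "s N \<in> model_space I" for N unfolding s_def by (intro model_space_sum tmw_model)
  note s = model_space_H2[OF sM]
  have lim: "(\<lambda>N. H2norm (\<lambda>w. s N w - f w)) \<longlonglongrightarrow> 0" using tmw_expansion[OF f] by (simp add: s_def)
  define L where "L N = (\<Sum>k<N. hin f (tmw lam k) * a k)" for N
  have "summable (\<lambda>k. cmod (hin f (tmw lam k) * a k))"
    by (rule summable_mult_square_summable(1)[OF tmw_coeff_summable[of lam, OF lam fH]]) (use A in \<open>simp add: a_def\<close>)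
  then have L: "L \<longlonglongrightarrow> (\<Sum>k. hin f (tmw lam k) * a k)"
    unfolding L_def[abs_def] by (rule summable_LIMSEQ[OF summable_norm_cancel])
  have sub: "at \<zeta> within stolz \<zeta> \<alpha> \<le> at \<zeta> within ball 0 1" for \<alpha>
    by (rule at_le) (auto simp: stolz_def)
  have limN: "(toep h (s N) \<longlongrightarrow> L N) (at \<zeta> within ball 0 1)" for N
    unfolding s_def[abs_def] L_def a_def by (rule toep_sum_tendsto)
  have "(g \<longlongrightarrow> (\<Sum>k. hin f (tmw lam k) * a k)) (at \<zeta> within stolz \<zeta> \<alpha>)" if \<alpha>: "\<alpha> > 1" for \<alpha>
  proof (rule tendstoI)
    fix e :: real assume e: "e > 0"
    define C where "C = (1 + \<alpha>) * S"
    have "(\<lambda>N. H2norm (\<lambda>w. s N w - f w) * C) \<longlonglongrightarrow> 0 * C" by (intro tendsto_intros lim)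
    then have "\<forall>\<^sub>F N in sequentially. H2norm (\<lambda>w. s N w - f w) * C < e/3"
      by (rule order_tendstoD) (use e in simp)
    moreover have "\<forall>\<^sub>F N in sequentially. dist (L N) (\<Sum>k. hin f (tmw lam k) * a k) < e/3"
      by (rule tendstoD[OF L]) (use e in simp)
    ultimately have "\<forall>\<^sub>F N in sequentially. H2norm (\<lambda>w. s N w - f w) * C < e/3 \<and> dist (L N) (\<Sum>k. hin f (tmw lam k) * a k) < e/3"
      by (rule eventually_conj)
    then obtain N where N: "H2norm (\<lambda>w. s N w - f w) * C < e/3" "dist (L N) (\<Sum>k. hin f (tmw lam k) * a k) < e/3"
      using eventually_happens by force
    have "\<forall>\<^sub>F z in at \<zeta> within ball 0 1. dist (toep h (s N) z) (L N) < e/3"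
      by (rule tendstoD[OF limN]) (use e in simp)
    then have "\<forall>\<^sub>F z in at \<zeta> within stolz \<zeta> \<alpha>. dist (toep h (s N) z) (L N) < e/3"
      using sub by (rule filter_leD[rotated])
    moreover have "\<forall>\<^sub>F z in at \<zeta> within stolz \<zeta> \<alpha>. z \<in> stolz \<zeta> \<alpha>" by (simp add: eventually_at_filter)
    ultimately show "\<forall>\<^sub>F z in at \<zeta> within stolz \<zeta> \<alpha>. dist (g z) (\<Sum>k. hin f (tmw lam k) * a k) < e"
    proof eventually_elim
      case (elim z)
      then have z: "cmod z < 1" by (simp add: stolz_def)
      have "cmod (toep h (\<lambda>w. s N w - f w) z) \<le> H2norm (\<lambda>w. s N w - f w) * (1 + \<alpha>) * S"
        unfolding S_def a_def by (rule toep_stolz_bound[OF A model_space_diff[OF sM f] elim(2)])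
      then have "cmod (toep h (s N) z - toep h f z) < e/3"
        using N(1) by (simp add: toep_diff_left s fH h z C_def mult.assoc)
      then have "dist (g z) (toep h (s N) z) < e/3" by (simp add: g[OF z] dist_norm norm_minus_commute)
      then show ?case using elim(1) N(2)
          dist_triangle[of "g z" "\<Sum>k. hin f (tmw lam k) * a k" "toep h (s N) z"]
          dist_triangle[of "toep h (s N) z" "\<Sum>k. hin f (tmw lam k) * a k" "L N"] by linarith
    qed
  qed
  then show ?thesis unfolding nt_limit_def by blast
qed

text \<open>Norm convergence in H^2 implies pointwise convergence in the disk, and
  \<open>toep\<close> at a fixed point is continuous in its argument; comparing the two limits
  identifies the extension of the operator.\<close>

lemma tto_range_imp_toep:
  assumes "g \<in> tto_range I h"
  obtains f where "f \<in> model_space I" "\<And>z. cmod z < 1 \<Longrightarrow> g z = toep h f z"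
proof -
  obtain f fs where g: "g \<in> model_space I" and f: "f \<in> model_space I" and fs: "\<And>n. fs n \<in> bdd_model I"
    and l1: "(\<lambda>n. H2norm (\<lambda>z. fs n z - f z)) \<longlonglongrightarrow> 0"
    and l2: "(\<lambda>n. H2norm (\<lambda>z. tto I h (fs n) z - g z)) \<longlonglongrightarrow> 0"
    using assms by (auto simp: tto_range_def)
  note gH = model_space_H2[OF g] and fH = model_space_H2[OF f]
  have fsM: "fs n \<in> model_space I" for n using fs by (simp add: bdd_model_def)
  note fsH = model_space_H2[OF fsM]
  have tH: "tto I h (fs n) \<in> H2" for n by (rule model_space_H2[OF tto_model[OF fs h]])
  have "g z = toep h f z" if z: "cmod z < 1" for z
  proof (rule LIMSEQ_unique)
    show "(\<lambda>n. toep h (fs n) z) \<longlonglongrightarrow> g z"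
      using H2_tendsto_pointwise[OF tH gH l2 z] by (simp add: tto_eq[OF fs h] z)
    show "(\<lambda>n. toep h (fs n) z) \<longlonglongrightarrow> toep h f z"
      unfolding toep_def by (rule hin_tendsto_left[OF fsH fH mult_kern_H2[OF h z] l1])
  qed
  with f show ?thesis by (rule that)
qed

text \<open>Boundedness makes the images of the partial sums a Cauchy sequence, and point
  evaluations turn its norm limit into the stated series. Any square summable \<open>c\<close> is
  thus tested by an actual function in the range.\<close>

lemma toep_series_in_tto_range:
  assumes bdd: "tto_bounded I h" and c: "summable (\<lambda>k. (cmod (c k))\<^sup>2)"
  shows "\<exists>g\<in>tto_range I h. \<forall>z. cmod z < 1 \<longrightarrow> (\<lambda>k. c k * toep h (tmw lam k) z) sums g z"
proof -
  obtain B where B: "\<And>f. f \<in> bdd_model I \<Longrightarrow> H2norm (tto I h f) \<le> B * H2norm f"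
    using bdd by (auto simp: tto_bounded_def)
  define s where "s N w = (\<Sum>k<N. c k * tmw lam k w)" for N w
  have sB: "s N \<in> bdd_model I" for N unfolding s_def by (rule tmw_bdd_model)
  have sM: "s N \<in> model_space I" for N using sB by (simp add: bdd_model_def)
  note s = model_space_H2[OF sM]
  obtain f where f: "f \<in> model_space I" and lim: "(\<lambda>N. H2norm (\<lambda>z. s N z - f z)) \<longlonglongrightarrow> 0"
    using tmw_series[OF c] by (auto simp: s_def)
  note fH = model_space_H2[OF f]
  define G where "G N = tto I h (s N)" for N
  have GM: "G N \<in> model_space I" for N unfolding G_def by (rule tto_model[OF sB h])
  note GH = model_space_H2[OF GM]
  have Gz: "G N z = toep h (s N) z" if "cmod z < 1" for N z using that by (simp add: G_def tto_eq[OF sB h])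
  have Gdiff: "H2norm (\<lambda>z. G m z - G n z) \<le> B * H2norm (\<lambda>z. s m z - s n z)" for m n
  proof -
    have d: "(\<lambda>z. s m z - s n z) \<in> bdd_model I"
    proof -
      have "(\<lambda>z. s m z - s n z) ` ball 0 1 \<subseteq> (\<lambda>(x, y). x - y) ` ((s m ` ball 0 1) \<times> (s n ` ball 0 1))" by auto
      moreover have "bounded ((\<lambda>(x, y). x - y) ` ((s m ` ball 0 1) \<times> (s n ` ball 0 1)))"
        using sB by (intro bounded_minus) (auto simp: bdd_model_def)
      ultimately have "bounded ((\<lambda>z. s m z - s n z) ` ball 0 1)" using bounded_subset by blast
      then show ?thesis using model_space_diff[OF sM[of m] sM[of n]] by (simp add: bdd_model_def)
    qed
    have "H2norm (\<lambda>z. G m z - G n z) = H2norm (tto I h (\<lambda>z. s m z - s n z))"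
      by (rule H2norm_cong) (simp add: Gz tto_eq[OF d h] toep_diff_left s h)
    then show ?thesis using B[OF d] by simp
  qed
  \<comment> \<open>The constant provided by \<open>tto_bounded\<close> carries no sign, so it is
    replaced by a positive one.\<close>
  define b where "b = \<bar>B\<bar> + 1"
  have b: "b > 0" "B \<le> b" by (auto simp: b_def)
  have Bp: "B * H2norm (\<lambda>z. s m z - s n z) \<le> b * H2norm (\<lambda>z. s m z - s n z)" for m n
    by (rule mult_right_mono) (auto simp: b)
  have "\<exists>M. \<forall>m\<ge>M. \<forall>n\<ge>M. H2norm (\<lambda>z. G m z - G n z) \<le> e" if e: "e > 0" for e
  proof -
    define d where "d = e / (2 * b)"
    have d: "d > 0" using e b by (simp add: d_def)
    obtain M where M: "\<And>n. n \<ge> M \<Longrightarrow> H2norm (\<lambda>z. s n z - f z) < d"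
      using order_tendstoD(2)[OF lim d] by (auto simp: eventually_sequentially)
    have "H2norm (\<lambda>z. G m z - G n z) \<le> e" if "m \<ge> M" "n \<ge> M" for m n
    proof -
      have "H2norm (\<lambda>z. s m z - s n z) \<le> H2norm (\<lambda>z. s m z - f z) + H2norm (\<lambda>z. f z - s n z)"
        by (rule H2norm_triangle_dist[OF s fH s])
      also have "\<dots> \<le> d + d"
        using M[OF that(1)] M[OF that(2)] H2norm_minus_commute[OF fH s[of n]] by simp
      finally have "b * H2norm (\<lambda>z. s m z - s n z) \<le> b * (d + d)" by (rule mult_left_mono) (use b in simp)
      also have "\<dots> = e" using b(1) by (simp add: d_def)
      finally show ?thesis using Gdiff[of m n] Bp[of m n] by linarith
    qed
    then show ?thesis by blast
  qed
  then obtain g where g: "g \<in> H2" and glim: "(\<lambda>n. H2norm (\<lambda>z. G n z - g z)) \<longlonglongrightarrow> 0"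
    using H2_complete[of G, OF GH] by blast
  have "g \<in> tto_range I h"
    unfolding tto_range_def
    using model_space_closed[OF GM g glim] f sB lim glim by (auto simp: G_def intro!: bexI[of _ f] exI[of _ s])
  moreover have "(\<lambda>k. c k * toep h (tmw lam k) z) sums g z" if z: "cmod z < 1" for z
  proof -
    have "(\<lambda>n. G n z) \<longlonglongrightarrow> g z" by (rule H2_tendsto_pointwise[OF GH g glim z])
    moreover have "G n z = (\<Sum>k<n. c k * toep h (tmw lam k) z)" for n
      unfolding Gz[OF z] s_def by (rule toep_sum_left) (auto simp: tmw_facts h z)
    ultimately show ?thesis by (simp add: sums_def)
  qed
  ultimately show ?thesis by blast
qed

text \<open>The gliding hump lemma applied to the values of the images of the basis at radial points
  z_j. Each row consists, up to conjugation, of the coefficients of \<open>h\<close> times the Szego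
  kernel at z_j, hence is square summable; its pairing with \<open>c\<close> is the value at z_j of
  one function in the range, which converges and so stays bounded in j.\<close>

lemma summable_of_nt_limits:
  assumes bdd: "tto_bounded I h" and nt: "\<And>g. g \<in> tto_range I h \<Longrightarrow> \<exists>L. nt_limit g \<zeta> L"
  shows "summable (\<lambda>k. (cmod (bval (tto I h (tmw lam k)) \<zeta>))\<^sup>2)"
proof -
  define zs where "zs j = of_real (1 - 1 / real (j+2)) * \<zeta>" for j
  have zs: "cmod (zs j) < 1" for j
  proof -
    have "1 - 1 / real (j+2) \<ge> 0" by (simp add: field_simps)
    then have "cmod (zs j) = 1 - 1 / real (j+2)" by (simp only: zs_def norm_mult norm_of_real \<zeta> abs_of_nonneg mult_1_right)
    then show ?thesis by simp
  qed
  have rad: "filterlim zs (at \<zeta> within stolz \<zeta> 2) sequentially"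
    unfolding zs_def by (rule stolz_radial[OF \<zeta>]) simp
  have sub: "at \<zeta> within stolz \<zeta> 2 \<le> at \<zeta> within ball 0 1"
    by (rule at_le) (auto simp: stolz_def)
  show ?thesis
  proof (rule square_summable_of_bounded_functionals)
    show "(\<lambda>j. toep h (tmw lam k) (zs j)) \<longlonglongrightarrow> bval (tto I h (tmw lam k)) \<zeta>" for k
      using filterlim_compose[OF tendsto_mono[OF sub toep_tmw_tendsto] rad] .
    show "summable (\<lambda>k. (cmod (toep h (tmw lam k) (zs j)))\<^sup>2)" for j
    proof -
      have u: "(\<lambda>w. h w * kern (zs j) w) \<in> H2" by (rule mult_kern_H2[OF h zs])
      have "cmod (toep h (tmw lam k) (zs j)) = cmod (hin (\<lambda>w. h w * kern (zs j) w) (tmw lam k))" for k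
        unfolding toep_def by (subst hin_cnj) simp
      then show ?thesis using tmw_coeff_summable[of lam, OF lam u] by simp
    qed
    fix c :: "nat \<Rightarrow> complex" assume "summable (\<lambda>n. (cmod (c n))\<^sup>2)"
    then obtain g where g: "g \<in> tto_range I h"
      and gs: "\<And>z. cmod z < 1 \<Longrightarrow> (\<lambda>k. c k * toep h (tmw lam k) z) sums g z"
      using toep_series_in_tto_range[OF bdd] by blast
    obtain L where "nt_limit g \<zeta> L" using nt[OF g] by blast
    then have "(g \<longlongrightarrow> L) (at \<zeta> within stolz \<zeta> 2)" by (simp add: nt_limit_def)
    then have "(\<lambda>j. g (zs j)) \<longlonglongrightarrow> L" using rad by (rule filterlim_compose)
    then have "Bseq (\<lambda>j. g (zs j))" by (intro convergent_imp_Bseq) (auto simp: convergent_def)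
    then obtain K where "\<And>j. cmod (g (zs j)) \<le> K" by (auto simp: Bseq_def)
    then show "\<exists>K. \<forall>j. cmod (\<Sum>n. c n * toep h (tmw lam n) (zs j)) \<le> K"
      using sums_unique[OF gs[OF zs]] by auto
  qed
qed

end

end

theorem theorem1p7:
  fixes lam :: "nat \<Rightarrow> complex" and h :: "complex \<Rightarrow> complex" and \<zeta> :: complex
  assumes "\<forall>n. cmod (lam n) < 1"
    and "summable (\<lambda>n. 1 - cmod (lam n))"
    and "h \<in> H2"
    and "tto_bounded (blaschke_prod lam) h"
    and "cmod \<zeta> = 1"
  shows "(\<forall>g \<in> tto_range (blaschke_prod lam) h. \<exists>L. nt_limit g \<zeta> L) \<longleftrightarrow>
         summable (\<lambda>n. (cmod (bval (tto (blaschke_prod lam) h (tmw lam n)) \<zeta>))\<^sup>2)"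
proof -
  interpret blaschke_model lam "blaschke_prod lam"
    "\<lambda>N z. (\<Prod>k<N. bsign (lam k)) * blaschke_prod (\<lambda>n. lam (n + N)) z"
    using assms by (intro blaschke_model_blaschke_prod) auto
  show ?thesis
  proof
    assume "\<forall>g \<in> tto_range (blaschke_prod lam) h. \<exists>L. nt_limit g \<zeta> L"
    then show "summable (\<lambda>n. (cmod (bval (tto (blaschke_prod lam) h (tmw lam n)) \<zeta>))\<^sup>2)"
      using summable_of_nt_limits[OF assms(3,5,4)] by blast
  next
    assume s: "summable (\<lambda>n. (cmod (bval (tto (blaschke_prod lam) h (tmw lam n)) \<zeta>))\<^sup>2)"
    show "\<forall>g \<in> tto_range (blaschke_prod lam) h. \<exists>L. nt_limit g \<zeta> L"
    proof
      fix g assume "g \<in> tto_range (blaschke_prod lam) h"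
      then obtain f where "f \<in> model_space (blaschke_prod lam)" "\<And>z. cmod z < 1 \<Longrightarrow> g z = toep h f z"
        using tto_range_imp_toep[OF assms(3,5)] by blast
      then show "\<exists>L. nt_limit g \<zeta> L" by (rule nt_limit_toep[OF assms(3,5) s])
    qed
  qed
qed

end
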